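(* Let $z=(z_n)\in\overline B_{\ell_\infty}$ and let $\mathbb N=\mathbb N_1\cup\mathbb N_2\cup\mathbb N_3$ be an associated decomposition (as defined in the context). Then the Gleason part $\mathcal{GP}(\delta_z)$ in $\mathcal M(\mathcal A_u(B_{c_0}))$ satisfies one of the following: (i) If $\mathbb N=\mathbb N_2$, then $z\in B_{\ell_\infty}$ and $\mathcal{GP}(\delta_z)=\mathcal{GP}(\delta_0)=\{\delta_w \mid w\in B_{\ell_\infty}\}$. This produces the identification $\mathcal{GP}(\delta_z)\approx B_{\ell_\infty}$. (ii) If $\mathbb N=\mathbb N_1$, then $z\in\mathbb T^{\mathbb N}$ and $\mathcal{GP}(\delta_z)=\{\delta_z\}$. (iii) If $\mathbb N_3=\varnothing$ and $\mathbb N_1,\mathbb N_2\neq\varnothing$, then $\mathcal{GP}(\delta_z)=\{\delta_w \mid w_n=z_n\text{ if } n\in\mathbb N_1\text{ and }\sup_{n\in\mathbb N_2}|w_n|<1\}$. So, if $\#(\mathbb N_2)=k$ is finite, then $\mathcal{GP}(\delta_z)\approx\mathbb D^k$, and if $\mathbb N_2$ is infinite, then $\mathcal{GP}(\delta_z)\approx B_{\ell_\infty}$; both identifications are (surjective) isometries with respect to the Gleason metric. (iv) If $\mathbb N_3$ is infinite and $\mathbb N_2=\varnothing$, then for every $k\in\mathbb N$, $\mathcal{GP}(\delta_z)$ contains a copy of $\mathbb D^k$, the inclusion being an isometry for the Gleason metric. There is also a continuous injection of $B_{\ell_\infty}$ into $\mathcal{GP}(\delta_z)$. (v) If both $\mathbb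 N_2$ and $\mathbb N_3$ are infinite, then $\mathcal{GP}(\delta_z)$ contains an isometric copy of $B_{\ell_\infty}$, for the Gleason metric.
   Context: $c_0$ is the complex Banach space of null sequences, with bidual $\ell_\infty$; $B_{c_0}$, $B_{\ell_\infty}$ are open unit balls, $\overline B_{\ell_\infty}$ the closed unit ball. $\mathbb D$ is the open unit disc in $\mathbb C$, $\mathbb T$ the unit circle. $\mathcal A_u(B_{c_0})$ is the Banach algebra (sup norm) of holomorphic, uniformly continuous functions $f\colon B_{c_0}\to\mathbb C$. Each such $f$ has a canonical extension $\tilde f$ to $\overline B_{\ell_\infty}$, its unique weak-star ($w(\ell_\infty,\ell_1)$) continuous extension. For $z\in\overline B_{\ell_\infty}$, $\delta_z(f)=\tilde f(z)$. $\mathcal M(\mathcal A_u(B_{c_0}))$, the set of nonzero $\mathbb C$-valued homomorphisms, equals $\{\delta_z \mid z\in\overline B_{\ell_\infty}\}$. For a uniform algebra $\mathcal A$ and $\varphi,\psi\in\mathcal M(\mathcal A)$: the Gleason metric is $\|\varphi-\psi\|=\sup_{\|f\|\le1}|\varphi(f)-\psi(f)|$; $\rho(\varphi,\psi)=\sup\{|\varphi(f)| \mid f\in\mathcal A,\ \|f\|\le 1,\ \psi(f)=0\}$; $\mathcal{GP}(\varphi)=\{\psi\in\mathcal M(\mathcal A) \mid \rho(\varphi,\psi)<1\}$. The Gleason metric on $B_{\ell_\infty}$ is obtained by viewing $u\in B_{\ell_\infty}$ as $\delta_u\in\mathcal M(\mathcal A_u(B_{c_0}))$; the Gleason metric on $\mathbb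 D^k$ is obtained by viewing $u\in\mathbb D^k$ as the evaluation $\delta_u$ on the algebra $\mathcal A_u(\mathbb D^k)$ of uniformly continuous holomorphic functions on $\mathbb D^k$ (the open unit ball of $(\mathbb C^k,\|\cdot\|_\infty)$). In (iv), continuity of the injection refers to the norm topology on $B_{\ell_\infty}$ and the Gleason metric on $\mathcal{GP}(\delta_z)$. Decomposition: $\mathbb N_1=\{n\in\mathbb N \mid |z_n|=1\}$ and $\mathbb N\setminus\mathbb N_1$ is split into two disjoint sets $\mathbb N_2\cup\mathbb N_3$ such that $\sup_{n\in\mathbb N_2}|z_n|<1$ if $\mathbb N_2\ne\varnothing$, and $\sup_{n\in\mathbb N_3}|z_n|=1$ if $\mathbb N_3\ne\varnothing$ (so $\mathbb N_3$ is empty or infinite). Any of the sets may be empty and $\mathbb N_2,\mathbb N_3$ are not uniquely determined; when $\mathbb N_3$ is infinite and $\mathbb N_2$ is finite, the elements of $\mathbb N_2$ are moved into $\mathbb N_3$ and $\mathbb N_2$ is redefined to be empty. *)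

theory Defs
  imports "HOL-Analysis.Analysis"
begin

text \<open>
  Since \<^typ>\<open>nat\<close> is discrete, every function on it is continuous and \<open>nat \<Rightarrow>\<^sub>C complex\<close> is the
  Banach space \<open>\<ell>\<^sub>\<infinity>\<close> of bounded complex sequences with the supremum norm. The library makes it a
  real normed space only, so complex scalar multiplication is added here.
\<close>

type_synonym linf = "nat \<Rightarrow>\<^sub>C complex"

definition cscale :: "complex \<Rightarrow> linf \<Rightarrow> linf" where
  "cscale c x = Bcontfun (\<lambda>n. c * x n)"

lemma apply_cscale [simp]: "cscale c x n = c * x n"
proof -
  have "bounded (range (\<lambda>n. c * x n))"
    unfolding bounded_iff
    by (rule exI[of _ "cmod c * norm x"])
       (auto simp: norm_mult intro!: mult_left_mono norm_bounded)
  then have "(\<lambda>n. c * x n) \<in> bcontfun"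
    by (simp add: bcontfun_def)
  then show ?thesis
    by (simp add: cscale_def Bcontfun_inverse)
qed

definition c0 :: "linf set" where
  "c0 = {x :: linf. (\<lambda>n. x n) \<longlonglongrightarrow> 0}"

text \<open>
  \<open>\<complex>\<^sup>k\<close> with the maximum norm, realised as the sequences supported in \<open>{..<k}\<close>, so that \<open>k\<close> can be
  quantified over.
\<close>

definition coord_space :: "nat \<Rightarrow> linf set" where
  "coord_space k = {x :: linf. \<forall>n\<ge>k. x n = 0}"

definition unit_ball :: "linf set \<Rightarrow> linf set" where
  "unit_ball V = V \<inter> ball 0 1"

abbreviation polydisc :: "nat \<Rightarrow> linf set" where
  "polydisc k \<equiv> unit_ball (coord_space k)"

text \<open>
  For a complex subspace \<open>V\<close> of \<open>\<ell>\<^sub>\<infinity>\<close>: complex Frechet differentiability, relative to \<open>V\<close>, at every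
  point of the open unit ball of \<open>V\<close>.
\<close>

definition holomorphic_on_ball :: "linf set \<Rightarrow> (linf \<Rightarrow> complex) \<Rightarrow> bool" where
  "holomorphic_on_ball V f \<longleftrightarrow>
     (\<forall>x\<in>unit_ball V. \<exists>L :: linf \<Rightarrow> complex.
        (\<forall>u\<in>V. \<forall>v\<in>V. L (u + v) = L u + L v) \<and>
        (\<forall>c. \<forall>u\<in>V. L (cscale c u) = c * L u) \<and>
        (\<exists>K. \<forall>u\<in>V. cmod (L u) \<le> K * norm u) \<and>
        ((\<lambda>y. (f y - f x - L (y - x)) /\<^sub>R norm (y - x)) \<longlongrightarrow> 0) (at x within V))"

text \<open>
  A function on a set \<open>X\<close> is represented by an element of \<^term>\<open>extensional X\<close>, so that functions
  agreeing on \<open>X\<close> are equal; likewise a character of an algebra \<open>A\<close> of bounded functions on \<open>X\<close>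
  is an element of \<^term>\<open>extensional A\<close>. The suprema below are over real sets that are nonempty
  and bounded when \<open>X\<close> is nonempty, \<open>A\<close> is a uniform algebra and \<open>\<phi>\<close>, \<open>\<psi>\<close> are characters.
\<close>

definition Au :: "linf set \<Rightarrow> (linf \<Rightarrow> complex) set" where
  "Au V = {f \<in> extensional (unit_ball V).
             holomorphic_on_ball V f \<and> uniformly_continuous_on (unit_ball V) f}"

definition unorm :: "'a set \<Rightarrow> ('a \<Rightarrow> complex) \<Rightarrow> real" where
  "unorm X f = (SUP x\<in>X. cmod (f x))"

definition characters :: "'a set \<Rightarrow> ('a \<Rightarrow> complex) set \<Rightarrow> (('a \<Rightarrow> complex) \<Rightarrow> complex) set" where
  "characters X A = {\<phi> \<in> extensional A.
     (\<exists>f\<in>A. \<phi> f \<noteq> 0) \<and>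
     (\<forall>f\<in>A. \<forall>g\<in>A. \<phi> (\<lambda>x\<in>X. f x + g x) = \<phi> f + \<phi> g) \<and>
     (\<forall>c. \<forall>f\<in>A. \<phi> (\<lambda>x\<in>X. c * f x) = c * \<phi> f) \<and>
     (\<forall>f\<in>A. \<forall>g\<in>A. \<phi> (\<lambda>x\<in>X. f x * g x) = \<phi> f * \<phi> g)}"

definition gleason_dist ::
  "'a set \<Rightarrow> ('a \<Rightarrow> complex) set \<Rightarrow> (('a \<Rightarrow> complex) \<Rightarrow> complex) \<Rightarrow> (('a \<Rightarrow> complex) \<Rightarrow> complex) \<Rightarrow> real"
  where "gleason_dist X A \<phi> \<psi> = (SUP f\<in>{f\<in>A. unorm X f \<le> 1}. cmod (\<phi> f - \<psi> f))"

definition gleason_rho ::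
  "'a set \<Rightarrow> ('a \<Rightarrow> complex) set \<Rightarrow> (('a \<Rightarrow> complex) \<Rightarrow> complex) \<Rightarrow> (('a \<Rightarrow> complex) \<Rightarrow> complex) \<Rightarrow> real"
  where "gleason_rho X A \<phi> \<psi> = (SUP f\<in>{f\<in>A. unorm X f \<le> 1 \<and> \<psi> f = 0}. cmod (\<phi> f))"

definition gleason_part ::
  "'a set \<Rightarrow> ('a \<Rightarrow> complex) set \<Rightarrow> (('a \<Rightarrow> complex) \<Rightarrow> complex) \<Rightarrow> (('a \<Rightarrow> complex) \<Rightarrow> complex) set"
  where "gleason_part X A \<phi> = {\<psi> \<in> characters X A. gleason_rho X A \<phi> \<psi> < 1}"

abbreviation gdist_c0 where "gdist_c0 \<equiv> gleason_dist (unit_ball c0) (Au c0)"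
abbreviation GP where "GP \<equiv> gleason_part (unit_ball c0) (Au c0)"

text \<open>
  The topology \<open>w(\<ell>\<^sub>\<infinity>, \<ell>\<^sub>1)\<close>: the coarsest one making the pairings with all \<open>y \<in> \<ell>\<^sub>1\<close> continuous.
\<close>

definition weak_star :: "linf topology" where
  "weak_star = topology_generated_by
     {{x :: linf. (\<Sum>n. x n * y n) \<in> U} | y U. summable (\<lambda>n. cmod (y n)) \<and> open U}"

definition canonical_ext :: "(linf \<Rightarrow> complex) \<Rightarrow> (linf \<Rightarrow> complex)" where
  "canonical_ext f = (THE g. g \<in> extensional (cball 0 1) \<and>
     (\<forall>x\<in>unit_ball c0. g x = f x) \<and>
     continuous_map (subtopology weak_star (cball 0 1)) euclidean g)"

definition delta :: "linf \<Rightarrow> (linf \<Rightarrow> complex) \<Rightarrow> complex" where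
  "delta z = (\<lambda>f\<in>Au c0. canonical_ext f z)"

definition delta_poly :: "nat \<Rightarrow> linf \<Rightarrow> (linf \<Rightarrow> complex) \<Rightarrow> complex" where
  "delta_poly k u = (\<lambda>f\<in>Au (coord_space k). f u)"

text \<open>
  The Gleason metric transported to \<open>B\<close> of \<open>\<ell>\<^sub>\<infinity>\<close> along \<open>u \<mapsto> \<delta>\<^sub>u\<close> uses the algebra over \<open>c\<^sub>0\<close>; the one
  on the polydisc uses the polydisc's own algebra.
\<close>

definition gdist_linf_ball :: "linf \<Rightarrow> linf \<Rightarrow> real" where
  "gdist_linf_ball u v = gdist_c0 (delta u) (delta v)"

definition gdist_polydisc :: "nat \<Rightarrow> linf \<Rightarrow> linf \<Rightarrow> real" where
  "gdist_polydisc k u v =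
     gleason_dist (polydisc k) (Au (coord_space k)) (delta_poly k u) (delta_poly k v)"

definition isometric_map ::
  "'a set \<Rightarrow> ('a \<Rightarrow> 'a \<Rightarrow> real) \<Rightarrow> 'b set \<Rightarrow> ('b \<Rightarrow> 'b \<Rightarrow> real) \<Rightarrow> ('a \<Rightarrow> 'b) \<Rightarrow> bool" where
  "isometric_map S d T d' \<Phi> \<longleftrightarrow>
     \<Phi> \<in> S \<rightarrow> T \<and> inj_on \<Phi> S \<and> (\<forall>u\<in>S. \<forall>v\<in>S. d' (\<Phi> u) (\<Phi> v) = d u v)"

text \<open>
  The last conjunct is the convention that a finite \<open>N2\<close> is absorbed into an infinite \<open>N3\<close>.
\<close>

definition assoc_decomposition :: "linf \<Rightarrow> nat set \<Rightarrow> nat set \<Rightarrow> nat set \<Rightarrow> bool" where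
  "assoc_decomposition z N1 N2 N3 \<longleftrightarrow>
     N1 = {n. cmod (z n) = 1} \<and>
     N2 \<union> N3 = UNIV - N1 \<and> N2 \<inter> N3 = {} \<and>
     (N2 \<noteq> {} \<longrightarrow> (SUP n\<in>N2. cmod (z n)) < 1) \<and>
     (N3 \<noteq> {} \<longrightarrow> (SUP n\<in>N3. cmod (z n)) = 1) \<and>
     (infinite N3 \<and> finite N2 \<longrightarrow> N2 = {})"

end

theory Submission
  imports Defs "HOL-Complex_Analysis.Complex_Analysis"
begin

text \<open>
  Every \<open>f\<close> in the algebra over \<open>c\<^sub>0\<close> is a uniform limit of polynomials in finitely many coordinates:
  its dilated Taylor polynomials converge uniformly, and a homogeneous polynomial \<open>P\<close> on \<open>c\<^sub>0\<close> maps bounded,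
  coordinatewise convergent sequences to Cauchy sequences, so \<open>P\<close> is uniformly approximated by its values on
  truncations. Hence the canonical extension exists, every character is a point evaluation, and \<open>\<delta>\<^sub>w\<close> lies in
  the Gleason part of \<open>\<delta>\<^sub>z\<close> iff the pseudohyperbolic distances of \<open>z\<^sub>n\<close> and \<open>w\<^sub>n\<close> (with \<open>0/0 = 0\<close>) are
  bounded by some \<open>s < 1\<close>: the upper estimate is the Schwarz lemma on an analytic disc through \<open>z\<close> and \<open>w\<close>,
  the lower one comes from Moebius functions of a single coordinate. The embeddings substitute a new variable
  for some coordinates of \<open>z\<close>.
\<close>

subsection \<open>Null sequences and the Schur property\<close>

text \<open>Uniform continuity on the ball does not by itself bring a function close to finitely
  many coordinates; what helps is special to \<open>c0\<close>. A bounded, coordinatewise null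
  sequence in \<open>c0\<close> has a subsequence whose sums of moduli are bounded at every
  coordinate, and the derivatives of a bounded polynomial along such directions are absolutely
  summable. Polynomials are treated through their restrictions to complex lines, never through
  symmetric multilinear forms, because infinite series of derivatives must again count as
  polynomials. The five cases reflect the shape of pseudohyperbolic discs: for fixed
  \<open>s < 1\<close>, the disc of radius \<open>s\<close> about \<open>z n\<close> has Euclidean
  size comparable to \<open>1 - |z n|\<close>. A coordinate in \<open>N1\<close> is therefore rigid,
  those in \<open>N2\<close> move in discs of uniform size, and those in \<open>N3\<close> have less
  and less room. Freeing \<open>N2\<close>, or finitely many coordinates of \<open>N3\<close>, gives
  isometric copies; freeing all of \<open>N3\<close> is done with a separate scaling for each
  coordinate, which yields a continuous injection.\<close>

lemma cscale_simps [simp]: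
  "cscale c 0 = 0" "cscale 0 x = 0" "cscale 1 x = x" "cscale c (cscale d x) = cscale (c * d) x"
  by (auto intro!: bcontfun_eqI)

lemma norm_cscale: "norm (cscale c x) = cmod c * norm x"
proof -
  have le: "norm (cscale c x) \<le> cmod c * norm x" for c x
    by (rule norm_bound) (auto simp: norm_mult intro!: mult_left_mono norm_bounded)
  show ?thesis
  proof (cases "c = 0")
    case False
    have "norm (cscale (inverse c) (cscale c x)) \<le> cmod (inverse c) * norm (cscale c x)"
      by (rule le)
    then have "cmod c * norm x \<le> cmod c * (cmod (inverse c) * norm (cscale c x))"
      using False by (intro mult_left_mono) auto
    also have "\<dots> = norm (cscale c x)"
      using False by (simp add: norm_inverse)
    finally have "cmod c * norm x \<le> norm (cscale c x)" .
    with le[of c x] show ?thesis by simp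
  qed auto
qed

lemma apply_sum_linf [simp]: "apply_bcontfun (\<Sum>i\<in>A. x i) n = (\<Sum>i\<in>A. apply_bcontfun (x i) n)"
  for x :: "'i \<Rightarrow> linf"
  by (induction A rule: infinite_finite_induct) auto

lemma linf_norm_le_iff: "norm (x :: linf) \<le> r \<longleftrightarrow> (\<forall>n. cmod (x n) \<le> r)"
  using norm_bound norm_bounded order_trans by metis

lemma c0_zero [simp]: "0 \<in> c0"
  by (simp add: c0_def)

lemma c0_add [simp]: "x \<in> c0 \<Longrightarrow> y \<in> c0 \<Longrightarrow> x + y \<in> c0"
  by (auto simp: c0_def intro: tendsto_add_zero)

lemma c0_diff [simp]: "x \<in> c0 \<Longrightarrow> y \<in> c0 \<Longrightarrow> x - y \<in> c0"
  using tendsto_diff[of "\<lambda>n. x n" 0 sequentially "\<lambda>n. y n" 0] by (auto simp: c0_def)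

lemma c0_cscale [simp]: "x \<in> c0 \<Longrightarrow> cscale c x \<in> c0"
proof -
  assume "x \<in> c0"
  then have "(\<lambda>n. c * x n) \<longlonglongrightarrow> 0"
    unfolding c0_def by (intro tendsto_mult_right_zero) auto
  moreover have "apply_bcontfun (cscale c x) = (\<lambda>n. c * x n)" by auto
  ultimately show ?thesis by (simp add: c0_def)
qed

lemma c0_sum [simp]: "(\<And>i. i \<in> A \<Longrightarrow> x i \<in> c0) \<Longrightarrow> (\<Sum>i\<in>A. x i) \<in> c0"
  by (induction A rule: infinite_finite_induct) auto

definition linf_of :: "(nat \<Rightarrow> complex) \<Rightarrow> linf" where
  "linf_of f = Bcontfun f"

lemma apply_linf_of: "(\<And>n. cmod (f n) \<le> b) \<Longrightarrow> linf_of f n = f n"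
  unfolding linf_of_def
  by (subst Bcontfun_inverse) (auto simp: bcontfun_def bounded_iff)

definition trunc :: "nat \<Rightarrow> linf \<Rightarrow> linf" where
  "trunc m x = linf_of (\<lambda>n. if n < m then x n else 0)"

lemma apply_trunc [simp]: "trunc m x n = (if n < m then x n else 0)"
  unfolding trunc_def by (rule apply_linf_of[where b = "norm x"]) (auto intro: norm_bounded)

lemma norm_trunc_le: "norm (trunc m x) \<le> norm x"
  by (auto simp: linf_norm_le_iff norm_bounded)

lemma trunc_in_c0 [simp]: "trunc m x \<in> c0"
  unfolding c0_def
  by (auto intro!: tendsto_eventually eventually_at_top_linorderI[of m])

definition basis_vec :: "nat \<Rightarrow> linf" where
  "basis_vec m = linf_of (\<lambda>n. if n = m then 1 else 0)"

lemma apply_basis_vec [simp]: "basis_vec m n = (if n = m then 1 else 0)"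
  unfolding basis_vec_def by (rule apply_linf_of[where b = 1]) auto

lemma basis_vec_in_c0 [simp]: "basis_vec m \<in> c0"
  unfolding c0_def
  by (auto intro!: tendsto_eventually eventually_at_top_linorderI[of "Suc m"])

lemma trunc_Suc: "trunc (Suc m) x = trunc m x + cscale (x m) (basis_vec m)"
  by (auto intro!: bcontfun_eqI simp: less_Suc_eq)

lemma trunc_zero [simp]: "trunc 0 x = 0"
  by (auto intro!: bcontfun_eqI)

lemma not_Cauchy_subseqs:
  fixes q :: "nat \<Rightarrow> 'a::metric_space"
  assumes "\<not> Cauchy q"
  obtains e a b where "e > 0" "\<And>k. a k \<ge> k" "\<And>k. b k \<ge> k" "\<And>k. dist (q (a k)) (q (b k)) \<ge> e"
proof -
  from assms obtain e where e: "e > 0" "\<forall>M. \<exists>m\<ge>M. \<exists>n\<ge>M. dist (q m) (q n) \<ge> e"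
    unfolding Cauchy_def by (auto simp: not_less)
  then obtain a b where "\<And>M. a M \<ge> M \<and> b M \<ge> M \<and> dist (q (a M)) (q (b M)) \<ge> e" by metis
  with e show thesis using that by blast
qed

text \<open>Gliding hump: the partial sums of the chosen terms stay bounded because each new term is tiny
  wherever the earlier ones are not.\<close>

lemma weakly_null_subseq_bounded_sums:
  fixes u :: "nat \<Rightarrow> linf"
  assumes u: "\<And>k. u k \<in> c0" and B: "\<And>k. norm (u k) \<le> B"
    and null: "\<And>n. (\<lambda>k. u k n) \<longlonglongrightarrow> 0"
  obtains r :: "nat \<Rightarrow> nat" where "strict_mono r" "\<And>n N. (\<Sum>k<N. cmod (u (r k) n)) \<le> B + 1"
proof -
  define S where "S ks n = (\<Sum>k\<leftarrow>ks. cmod (u k n))" for ks :: "nat list" and n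
  \<comment> \<open>The slack below \<open>B + 1\<close> is \<open>(1/2) ^ m\<close>, and each new
    term may use up half of it. From \<open>n0\<close> on, the earlier terms sum to less than
    \<open>?e\<close> and the new one is at most \<open>B\<close>; before \<open>n0\<close> the new
    one is less than \<open>?e\<close>.\<close>
  have step: "\<exists>k>K. \<forall>n. S ks n + cmod (u k n) \<le> B + 1 - (1/2) ^ Suc m"
    if bd: "\<forall>n. S ks n \<le> B + 1 - (1/2) ^ m" for ks K m
  proof -
    let ?e = "(1/2) ^ Suc m :: real"
    have "(\<lambda>n. S ks n) \<longlonglongrightarrow> 0"
      unfolding S_def
    proof (induction ks)
      case (Cons k ks)
      have "(\<lambda>n. cmod (u k n)) \<longlonglongrightarrow> 0"
        using u[of k] by (simp add: c0_def tendsto_norm_zero)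
      from tendsto_add[OF this Cons.IH] show ?case by simp
    qed auto
    then have "eventually (\<lambda>n. S ks n < ?e) sequentially"
      by (rule order_tendstoD) simp
    then obtain n0 where n0: "\<And>n. n \<ge> n0 \<Longrightarrow> S ks n < ?e"
      by (auto simp: eventually_sequentially)
    have "eventually (\<lambda>k. \<forall>n\<in>{..<n0}. cmod (u k n) < ?e) sequentially"
      by (rule eventually_ball_finite)
         (auto intro!: order_tendstoD tendsto_norm_zero null simp del: power_Suc)
    with eventually_gt_at_top[of K] have "eventually (\<lambda>k. k > K \<and> (\<forall>n\<in>{..<n0}. cmod (u k n) < ?e)) sequentially"
      by eventually_elim auto
    then obtain k where k: "k > K" "\<And>n. n < n0 \<Longrightarrow> cmod (u k n) < ?e"
      by (auto dest!: eventually_happens)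
    have "S ks n + cmod (u k n) \<le> B + 1 - ?e" for n
    proof (cases "n < n0")
      case True
      have "(1/2::real) ^ m = 2 * ?e" by simp
      then show ?thesis using bd[rule_format, of n] k(2)[OF True] by linarith
    next
      case False
      have "?e \<le> 1/2" using power_le_one[of "1/2::real" m] by simp
      moreover have "cmod (u k n) \<le> B" using norm_bounded[of "u k" n] B[of k] by linarith
      ultimately show ?thesis using n0[of n] False by linarith
    qed
    with k show ?thesis by blast
  qed
  define nxt where "nxt ks = (SOME k. (\<forall>i\<in>set ks. k > i) \<and>
      (\<forall>n. S ks n + cmod (u k n) \<le> B + 1 - (1/2) ^ Suc (length ks)))" for ks
  \<comment> \<open>The indices chosen so far, latest first. The choice of the next index depends on
    all of them, so the recursion carries the whole list.\<close>
  define L where "L = rec_nat [] (\<lambda>_ ks. nxt ks # ks)"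
  have L_Suc: "L (Suc m) = nxt (L m) # L m" and L_0: "L 0 = []" for m by (auto simp: L_def)
  have len: "length (L m) = m" for m by (induction m) (auto simp: L_0 L_Suc)
  have inv: "\<forall>n. S (L m) n \<le> B + 1 - (1/2) ^ m" and gt: "\<forall>i\<in>set (L m). nxt (L m) > i" for m
  proof -
    have good: "(\<forall>i\<in>set (L m). nxt (L m) > i) \<and>
      (\<forall>n. S (L m) n + cmod (u (nxt (L m)) n) \<le> B + 1 - (1/2) ^ Suc m)"
      if bd: "\<forall>n. S (L m) n \<le> B + 1 - (1/2) ^ m" for m
    proof -
      obtain k where "k > Max (insert 0 (set (L m)))"
        "\<forall>n. S (L m) n + cmod (u k n) \<le> B + 1 - (1/2) ^ Suc m"
        using step[OF bd] by blast
      then have "\<exists>k. (\<forall>i\<in>set (L m). k > i) \<and>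
         (\<forall>n. S (L m) n + cmod (u k n) \<le> B + 1 - (1/2) ^ Suc (length (L m)))"
        by (auto simp: len)
      from someI_ex[OF this] show ?thesis by (simp add: nxt_def len)
    qed
    have B0: "B \<ge> 0" using B[of 0] norm_ge_zero[of "u 0"] by linarith
    have inv: "\<forall>n. S (L m) n \<le> B + 1 - (1/2) ^ m" for m
    proof (induction m)
      case 0
      then show ?case using B0 by (auto simp: L_0 S_def)
    next
      case (Suc m)
      from good[OF this] show ?case by (auto simp: L_Suc S_def add.commute)
    qed
    show "\<forall>n. S (L m) n \<le> B + 1 - (1/2) ^ m" "\<forall>i\<in>set (L m). nxt (L m) > i"
      using inv good by blast+
  qed
  define r where "r m = nxt (L m)" for m
  have "strict_mono r"
    unfolding strict_mono_Suc_iff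
  proof
    fix m show "r m < r (Suc m)" using gt[of "Suc m"] by (simp add: r_def L_Suc)
  qed
  moreover have "(\<Sum>k<N. cmod (u (r k) n)) \<le> B + 1" for n N
  proof -
    have "(\<Sum>k<N. cmod (u (r k) n)) = S (L N) n"
      by (induction N) (auto simp: L_0 L_Suc S_def r_def)
    also have "\<dots> \<le> B + 1 - (1/2) ^ N" using inv by blast
    also have "\<dots> \<le> B + 1" by simp
    finally show ?thesis .
  qed
  ultimately show thesis by (intro that[of r])
qed

text \<open>The Schur property of \<open>\<ell>\<^sub>1\<close>, applied to the rows of a matrix.\<close>

lemma Schur_diagonal_null:
  fixes a :: "nat \<Rightarrow> nat \<Rightarrow> complex"
  assumes bd: "\<And>k N. (\<Sum>j<N. cmod (a k j)) \<le> C"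
    and cv: "\<And>A. Cauchy (\<lambda>k. \<Sum>j. if j \<in> A then a k j else 0)"
  shows "(\<lambda>k. a k k) \<longlonglongrightarrow> 0"
proof -
  have "Cauchy (\<lambda>k. a k j)" for j
  proof -
    have "(\<lambda>k. \<Sum>i. if i \<in> {j} then a k i else 0) = (\<lambda>k. a k j)"
      by (rule ext, subst suminf_finite[of "{j}"]) auto
    with cv[of "{j}"] show ?thesis by (simp only:)
  qed
  then obtain l where l: "\<And>j. (\<lambda>k. a k j) \<longlonglongrightarrow> l j"
    unfolding Cauchy_convergent_iff convergent_def by metis
  have lbd: "(\<Sum>j<N. cmod (l j)) \<le> C" for N
    by (rule LIMSEQ_le_const2[OF tendsto_sum[OF tendsto_norm[OF l]]]) (use bd in auto)
  have suml: "summable (\<lambda>j. cmod (l j))"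
    by (rule bounded_imp_summable[OF _ lbd[of "Suc _", unfolded lessThan_Suc_atMost]]) auto
  \<comment> \<open>Subtracting the limit row, which is again absolutely summable, leaves rows with
    bounded sums of moduli in which every column is null. The diagonal is restored at the end
    because the limit row itself tends to 0.\<close>
  define b where "b k j = a k j - l j" for k j
  have b0: "(\<lambda>k. b k j) \<longlonglongrightarrow> 0" for j
    unfolding b_def using tendsto_diff[OF l[of j] tendsto_const[of "l j"]] by simp
  have bbd: "(\<Sum>j<N. cmod (b k j)) \<le> 2 * C" for k N
  proof -
    have "(\<Sum>j<N. cmod (b k j)) \<le> (\<Sum>j<N. cmod (a k j) + cmod (l j))"
      by (intro sum_mono) (auto simp: b_def norm_triangle_ineq4)
    then show ?thesis using bd[where k=k and N=N] lbd[of N] by (simp add: sum.distrib)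
  qed
  have sumb: "summable (\<lambda>j. cmod (b k j))" for k
    by (rule bounded_imp_summable[OF _ bbd[where N="Suc _", unfolded lessThan_Suc_atMost]]) auto
  have suma: "summable (\<lambda>j. cmod (a k j))" for k
    by (rule bounded_imp_summable[OF _ bd[where N="Suc _", unfolded lessThan_Suc_atMost]]) auto
  have sumA: "summable (\<lambda>j. if j \<in> A then f j else 0)" if "summable (\<lambda>j. cmod (f j))"
    for A and f :: "nat \<Rightarrow> complex"
    by (rule summable_comparison_test[OF _ that]) (auto intro!: exI[of _ 0])
  define s where "s A k = (\<Sum>j. if j \<in> A then b k j else 0)" for A k
  have s_Cauchy: "Cauchy (s A)" for A
  proof -
    have "s A = (\<lambda>k. (\<Sum>j. if j \<in> A then a k j else 0) - (\<Sum>j. if j \<in> A then l j else 0))"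
    proof
      fix k
      have "(\<Sum>j. if j \<in> A then a k j else 0) - (\<Sum>j. if j \<in> A then l j else 0)
          = (\<Sum>j. (if j \<in> A then a k j else 0) - (if j \<in> A then l j else 0))"
        by (rule suminf_diff[OF sumA[OF suma] sumA[OF suml]])
      also have "\<dots> = s A k"
        unfolding s_def b_def by (intro arg_cong[where f=suminf]) auto
      finally show "s A k = (\<Sum>j. if j \<in> A then a k j else 0) - (\<Sum>j. if j \<in> A then l j else 0)"
        by simp
    qed
    moreover have "convergent (\<lambda>k. (\<Sum>j. if j \<in> A then a k j else 0) - (\<Sum>j. if j \<in> A then l j else 0))"
      using cv[of A] by (intro convergent_diff convergent_const) (simp add: Cauchy_convergent_iff)
    ultimately show ?thesis by (simp add: Cauchy_convergent_iff)
  qed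
  have "(\<lambda>k. b k k) \<longlonglongrightarrow> 0"
  proof (rule ccontr)
    assume "\<not> ?thesis"
    then obtain e where e: "e > 0" and inf: "\<And>N. \<exists>k\<ge>N. cmod (b k k) \<ge> e"
      unfolding lim_sequentially by (auto simp: not_less)
    have tail: "\<exists>N. (\<Sum>j. cmod (b k (j + N))) < e/8" for k
    proof -
      have "eventually (\<lambda>N. norm (\<Sum>j. cmod (b k (j + N))) < e/8) sequentially"
        using suminf_exist_split[OF _ sumb[of k], of "e/8"] e by (auto simp: eventually_sequentially)
      then obtain N where "norm (\<Sum>j. cmod (b k (j + N))) < e/8"
        by (auto dest!: eventually_happens)
      then have "(\<Sum>j. cmod (b k (j + N))) < e/8"
        by (simp add: abs_less_iff)
      then show ?thesis ..
    qed
    then obtain T where T: "\<And>k. (\<Sum>j. cmod (b k (j + T k))) < e/8" by metis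
    have "\<exists>k'>k. k' \<ge> T k \<and> cmod (b k' k') \<ge> e \<and> (\<Sum>j\<le>k. cmod (b k' j)) < e/8" for k
    proof -
      have "(\<lambda>k'. \<Sum>j\<le>k. cmod (b k' j)) \<longlonglongrightarrow> (\<Sum>j\<le>k. 0)"
        by (intro tendsto_sum tendsto_norm_zero b0)
      then have "eventually (\<lambda>k'. (\<Sum>j\<le>k. cmod (b k' j)) < e/8) sequentially"
        by (rule order_tendstoD) (use e in auto)
      then obtain N where "\<And>k'. k' \<ge> N \<Longrightarrow> (\<Sum>j\<le>k. cmod (b k' j)) < e/8"
        by (auto simp: eventually_sequentially)
      moreover obtain k' where "k' \<ge> max N (max (T k) (Suc k))" "cmod (b k' k') \<ge> e"
        using inf by blast
      ultimately show ?thesis by (intro exI[of _ k']) auto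
    qed
    then obtain nx where nx: "\<And>k. nx k > k" "\<And>k. nx k \<ge> T k" "\<And>k. cmod (b (nx k) (nx k)) \<ge> e"
        "\<And>k. (\<Sum>j\<le>k. cmod (b (nx k) j)) < e/8"
      by metis
    \<comment> \<open>\<open>Suc i\<close> makes every \<open>q i\<close>, including
      \<open>q 0\<close>, a value of \<open>nx\<close>, so the lower bound on the diagonal holds
      along all of \<open>q\<close>.\<close>
    define q where "q i = (nx ^^ Suc i) 0" for i
    have q_Suc: "q (Suc i) = nx (q i)" for i by (simp add: q_def)
    have q_mono: "strict_mono q" unfolding strict_mono_Suc_iff using nx(1) by (simp add: q_Suc)
    have qd: "cmod (b (q i) (q i)) \<ge> e" for i by (simp add: q_def nx)
    \<comment> \<open>Only every second index is selected. Along \<open>q\<close> the sums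
      \<open>s A\<close> then alternate between values near a diagonal entry of modulus at least
      \<open>e\<close> and values near 0, which no Cauchy sequence does.\<close>
    define A where "A = range (\<lambda>i. q (2 * i))"
    have est: "cmod (s A (q (Suc i)) - (if even (Suc i) then b (q (Suc i)) (q (Suc i)) else 0)) \<le> e/4" for i
    proof -
      let ?k = "q (Suc i)"
      let ?f = "\<lambda>j. if j \<in> A - {?k} then b ?k j else 0"
      have mem: "?k \<in> A \<longleftrightarrow> even (Suc i)"
        unfolding A_def image_iff strict_mono_eq[OF q_mono] dvd_def by simp
      have sf: "summable (\<lambda>j. cmod (?f j))"
        by (rule summable_comparison_test[OF _ sumb[of ?k]]) (auto intro!: exI[of _ 0])
      have "s A ?k = (\<Sum>j. (if j \<in> {?k} then (if even (Suc i) then b ?k ?k else 0) else 0) + ?f j)"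
        unfolding s_def by (intro arg_cong[where f=suminf] ext) (auto simp: mem simp del: even_Suc)
      also have "\<dots> = (\<Sum>j. (if j \<in> {?k} then (if even (Suc i) then b ?k ?k else 0) else 0)) + (\<Sum>j. ?f j)"
        by (rule suminf_add[OF _ sumA[OF sumb], symmetric], rule summable_finite[of "{?k}"]) auto
      also have "(\<Sum>j. (if j \<in> {?k} then (if even (Suc i) then b ?k ?k else 0) else 0))
          = (if even (Suc i) then b ?k ?k else 0)"
        by (subst suminf_finite[of "{?k}"]) auto
      finally have "cmod (s A ?k - (if even (Suc i) then b ?k ?k else 0)) = cmod (\<Sum>j. ?f j)" by simp
      also have "\<dots> \<le> (\<Sum>j. cmod (?f j))" by (rule summable_norm[OF sf])
      also have "\<dots> = (\<Sum>j. cmod (?f (j + T ?k))) + (\<Sum>j<T ?k. cmod (?f j))"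
        by (rule suminf_split_initial_segment[OF sf])
      also have "(\<Sum>j. cmod (?f (j + T ?k))) \<le> (\<Sum>j. cmod (b ?k (j + T ?k)))"
        by (intro suminf_le summable_ignore_initial_segment[OF sf]
              summable_ignore_initial_segment[OF sumb[of ?k]]) auto
      also have "\<dots> \<le> e/8" using T by (rule less_imp_le)
      also have "(\<Sum>j<T ?k. cmod (?f j)) \<le> (\<Sum>j\<le>q i. cmod (b ?k j))"
      proof -
        \<comment> \<open>An index of \<open>A\<close> above \<open>q i\<close> other than
          \<open>?k\<close> is at least \<open>q (Suc (Suc i))\<close>, which \<open>nx\<close> has
          placed at or beyond the cutoff \<open>T ?k\<close>. So only the head up to
          \<open>q i\<close> and the tail from \<open>T ?k\<close> contribute, each at most
          \<open>e/8\<close>.\<close>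
        have "?f j = 0" if "j < T ?k" "j > q i" for j
        proof (rule ccontr)
          assume "?f j \<noteq> 0"
          then have "j \<in> A" "j \<noteq> ?k" by (auto split: if_splits)
          then obtain i' where i': "j = q i'" by (auto simp: A_def)
          with that(2) have "i' > i" using strict_mono_less[OF q_mono] by auto
          with i' \<open>j \<noteq> ?k\<close> have "i' \<ge> Suc (Suc i)" by (cases "i' = Suc i") auto
          then have "j \<ge> q (Suc (Suc i))" using strict_mono_less_eq[OF q_mono] i' by auto
          moreover have "q (Suc (Suc i)) \<ge> T ?k" using nx(2)[of ?k] by (simp add: q_Suc)
          ultimately show False using that by simp
        qed
        then have "(\<Sum>j<T ?k. cmod (?f j)) = (\<Sum>j\<in>{..<T ?k} \<inter> {..q i}. cmod (?f j))"
          by (intro sum.mono_neutral_right) (auto simp: not_le)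
        also have "\<dots> \<le> (\<Sum>j\<in>{..<T ?k} \<inter> {..q i}. cmod (b ?k j))"
          by (intro sum_mono) auto
        also have "\<dots> \<le> (\<Sum>j\<le>q i. cmod (b ?k j))"
          by (intro sum_mono2) auto
        finally show ?thesis .
      qed
      also have "\<dots> \<le> e/8" using nx(4)[of "q i"] by (simp add: q_Suc)
      finally show ?thesis by simp
    qed
    from s_Cauchy[of A] e obtain M where M: "\<And>m n. m \<ge> M \<Longrightarrow> n \<ge> M \<Longrightarrow> dist (s A m) (s A n) < e/4"
      unfolding Cauchy_def by (metis divide_pos_pos zero_less_numeral)
    have ge: "q i \<ge> i" for i using strict_mono_imp_increasing[OF q_mono] .
    let ?x = "q (Suc (2 * M + 1))" and ?y = "q (Suc (2 * M))"
    have "dist (s A ?x) (s A ?y) < e/4"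
      by (rule M) (use ge[of "Suc (2*M+1)"] ge[of "Suc (2*M)"] in auto)
    moreover have "cmod (s A ?x - b ?x ?x) \<le> e/4" using est[of "2*M+1"] by simp
    moreover have "cmod (s A ?y) \<le> e/4" using est[of "2*M"] by simp
    moreover have "cmod (b ?x ?x) \<ge> e" by (rule qd)
    moreover have "cmod (b ?x ?x) \<le> cmod (s A ?x - b ?x ?x) + cmod (s A ?x - s A ?y) + cmod (s A ?y)"
      using norm_triangle_ineq4[of "s A ?x" "s A ?x - b ?x ?x"] norm_triangle_ineq[of "s A ?x - s A ?y" "s A ?y"]
      by simp
    ultimately show False using e by (simp add: dist_norm)
  qed
  moreover have "l \<longlonglongrightarrow> 0"
    using summable_LIMSEQ_zero[OF suml] by (simp add: tendsto_norm_zero_iff)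
  ultimately have "(\<lambda>k. b k k + l k) \<longlonglongrightarrow> 0 + 0" by (rule tendsto_add)
  then show ?thesis by (simp add: b_def)
qed

subsection \<open>Homogeneous polynomials on the null sequences\<close>

text \<open>The Lagrange basis polynomial of the node \<open>j\<close> among the nodes
  \<open>0\<close>, ..., \<open>d\<close>.\<close>

definition lag :: "nat \<Rightarrow> nat \<Rightarrow> complex \<Rightarrow> complex" where
  "lag d j s = (\<Prod>i\<in>{..d} - {j}. (s - of_nat i) / (of_nat j - of_nat i))"

lemma lag_node: "i \<le> d \<Longrightarrow> lag d j (of_nat i) = (if i = j then 1 else 0)"
  unfolding lag_def by (auto intro!: prod_zero prod.neutral)

lemma lag_zero: "lag d j 0 = (if j = 0 then 1 else 0)"
  using lag_node[of 0 d j] by auto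

lemma lag_holomorphic: "lag d j holomorphic_on A"
  unfolding lag_def by (intro holomorphic_intros) auto

text \<open>Both sides are polynomials of degree at most \<open>d\<close> that agree at
  \<open>d + 1\<close> nodes.\<close>

lemma Lagrange_interpolation:
  assumes f: "\<And>s. f s = (\<Sum>k\<le>d. a k * s ^ k)"
  shows "f s = (\<Sum>j\<le>d. lag d j s * f (of_nat j))"
proof -
  define p where "p = (\<Sum>k\<le>d. monom (a k) k)"
  define q where "q = (\<Sum>j\<le>d. smult (f (of_nat j))
      (\<Prod>i\<in>{..d} - {j}. [: - of_nat i / (of_nat j - of_nat i), 1 / (of_nat j - of_nat i) :]))"
  have p: "poly p s = f s" for s by (simp add: p_def poly_sum poly_monom f)
  have q: "poly q s = (\<Sum>j\<le>d. lag d j s * f (of_nat j))" for s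
    by (simp add: q_def poly_sum poly_prod lag_def mult.commute diff_divide_distrib)
  have "p = q"
  proof (rule poly_eqI_degree[where A = "of_nat ` {..d}"])
    fix x assume "x \<in> (of_nat ` {..d} :: complex set)"
    then obtain i where i: "x = of_nat i" "i \<le> d" by auto
    have "poly q x = (\<Sum>j\<le>d. if j = i then f (of_nat j) else 0)"
      unfolding q i(1) by (intro sum.cong) (auto simp: lag_node i(2))
    then show "poly p x = poly q x" using i by (simp add: p)
  next
    have card: "card (of_nat ` {..d} :: complex set) = Suc d"
      by (subst card_image) (auto simp: inj_on_def)
    have "degree p \<le> d"
      unfolding p_def by (intro degree_sum_le) (auto intro: order_trans[OF degree_monom_le])
    then show "degree p < card (of_nat ` {..d} :: complex set)" by (simp add: card)
    have "degree q \<le> d"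
      unfolding q_def
    proof (rule degree_sum_le)
      fix j assume "j \<in> {..d}"
      let ?g = "\<lambda>i. [: - of_nat i / (of_nat j - of_nat i), 1 / (of_nat j - of_nat i) :] :: complex poly"
      have "degree (smult (f (of_nat j)) (\<Prod>i\<in>{..d} - {j}. ?g i)) \<le> degree (\<Prod>i\<in>{..d} - {j}. ?g i)"
        by (rule degree_smult_le)
      also have "\<dots> \<le> sum (degree \<circ> ?g) ({..d} - {j})"
        by (rule degree_prod_sum_le) auto
      also have "\<dots> \<le> sum (\<lambda>_. 1) ({..d} - {j})"
        by (intro sum_mono) auto
      also have "\<dots> = d" using \<open>j \<in> {..d}\<close> by simp
      finally show "degree (smult (f (of_nat j)) (\<Prod>i\<in>{..d} - {j}. ?g i)) \<le> d" .
    qed auto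
    then show "degree q < card (of_nat ` {..d} :: complex set)" by (simp add: card)
  qed
  with p q show ?thesis by metis
qed

text \<open>Polynomials on \<open>c\<^sub>0\<close> of degree at most \<open>d\<close> on each complex line. Stating this by Lagrange
  interpolation at \<open>0, \<dots>, d\<close> makes it stable under pointwise limits.\<close>

definition line_poly :: "nat \<Rightarrow> (linf \<Rightarrow> complex) \<Rightarrow> bool" where
  "line_poly d P \<longleftrightarrow> (\<forall>x\<in>c0. \<forall>y\<in>c0. \<forall>s.
     P (x + cscale s y) = (\<Sum>j\<le>d. lag d j s * P (x + cscale (of_nat j) y)))"

lemma line_polyD:
  "line_poly d P \<Longrightarrow> x \<in> c0 \<Longrightarrow> y \<in> c0 \<Longrightarrow>
     P (x + cscale s y) = (\<Sum>j\<le>d. lag d j s * P (x + cscale (of_nat j) y))"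
  unfolding line_poly_def by blast

definition dlag :: "nat \<Rightarrow> nat \<Rightarrow> complex" where
  "dlag d j = deriv (lag d j) 0"

lemma lag_DERIV: "(lag d j has_field_derivative dlag d j) (at 0)"
  unfolding dlag_def
  using holomorphic_derivI[OF lag_holomorphic[of d j UNIV]] by auto

text \<open>The derivative of \<open>P\<close> at \<open>x\<close> in direction \<open>u\<close>,
  obtained by differentiating the interpolation formula at 0. Being a fixed finite combination of
  values of \<open>P\<close>, it inherits bounds and linear identities from
  \<open>P\<close>.\<close>

definition dirder :: "nat \<Rightarrow> (linf \<Rightarrow> complex) \<Rightarrow> linf \<Rightarrow> linf \<Rightarrow> complex" where
  "dirder d P u x = (\<Sum>j\<le>d. dlag d j * P (x + cscale (of_nat j) u))"

lemma cscale_add_right: "cscale a (x + y) = cscale a x + cscale a y"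
  by (auto intro!: bcontfun_eqI simp: algebra_simps)

lemma dirder_DERIV:
  assumes P: "line_poly d P" and xu: "x \<in> c0" "u \<in> c0"
  shows "((\<lambda>t. P (x + cscale t u)) has_field_derivative dirder d P u (x + cscale s u)) (at s)"
proof -
  have eq: "P (x + cscale t u) = (\<Sum>j\<le>d. lag d j (t - s) * P (x + cscale s u + cscale (of_nat j) u))" for t
  proof -
    have "x + cscale t u = (x + cscale s u) + cscale (t - s) u"
      by (auto intro!: bcontfun_eqI simp: algebra_simps)
    then show ?thesis using line_polyD[OF P, of "x + cscale s u" u "t - s"] xu by (simp only: c0_add c0_cscale)
  qed
  have "((\<lambda>t. lag d j (t - s)) has_field_derivative dlag d j) (at s)" for j
    using lag_DERIV[of d j] DERIV_shift[of "lag d j" "dlag d j" s "-s"] by simp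
  then have "((\<lambda>t. \<Sum>j\<le>d. lag d j (t - s) * P (x + cscale s u + cscale (of_nat j) u))
      has_field_derivative dirder d P u (x + cscale s u)) (at s)"
    unfolding dirder_def by (intro DERIV_sum DERIV_cmult_right)
  then show ?thesis by (simp only: eq)
qed

lemma dirder_DERIV_0:
  assumes "line_poly d P" "x \<in> c0" "u \<in> c0"
  shows "((\<lambda>t. P (x + cscale t u)) has_field_derivative dirder d P u x) (at 0)"
  using dirder_DERIV[OF assms, of 0] by simp

lemma dirder_add:
  assumes P: "line_poly d P" and xu: "x \<in> c0" "u \<in> c0" "v \<in> c0"
  shows "dirder d P (u + v) x = dirder d P u x + dirder d P v x"
proof -
  have eq: "P (x + cscale t (u + v)) = (\<Sum>j\<le>d. lag d j t * P ((x + cscale (of_nat j) v) + cscale t u))" for t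
    using line_polyD[OF P, of "x + cscale t u" v t] xu
    by (simp add: cscale_add_right algebra_simps)
  have "((\<lambda>t. \<Sum>j\<le>d. lag d j t * P ((x + cscale (of_nat j) v) + cscale t u)) has_field_derivative
     (\<Sum>j\<le>d. dlag d j * P ((x + cscale (of_nat j) v) + cscale 0 u) +
        dirder d P u (x + cscale (of_nat j) v) * lag d j 0)) (at 0)"
    by (intro DERIV_sum DERIV_mult lag_DERIV dirder_DERIV_0 P) (use xu in auto)
  moreover have "(\<Sum>j\<le>d. dlag d j * P ((x + cscale (of_nat j) v) + cscale 0 u) +
        dirder d P u (x + cscale (of_nat j) v) * lag d j 0) = dirder d P u x + dirder d P v x"
  proof -
    have "(\<Sum>j\<le>d. dirder d P u (x + cscale (of_nat j) v) * lag d j 0) =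
        (\<Sum>j\<le>d. if j = 0 then dirder d P u x else 0)"
      by (intro sum.cong) (auto simp: lag_zero)
    then show ?thesis unfolding sum.distrib by (simp add: dirder_def[of d P v])
  qed
  ultimately have "((\<lambda>t. P (x + cscale t (u + v))) has_field_derivative dirder d P u x + dirder d P v x) (at 0)"
    by (simp only: eq)
  then show ?thesis
    using dirder_DERIV_0[OF P, of x "u + v"] xu DERIV_unique by auto
qed

lemma dirder_cscale:
  assumes P: "line_poly d P" and xu: "x \<in> c0" "u \<in> c0"
  shows "dirder d P (cscale c u) x = c * dirder d P u x"
proof -
  have "((\<lambda>t. P (x + cscale t u)) has_field_derivative dirder d P u x) (at (c * 0))"
    using dirder_DERIV_0[OF P xu] by simp
  then have "((\<lambda>t. P (x + cscale (c * t) u)) has_field_derivative dirder d P u x * c) (at 0)"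
    by (rule DERIV_chain2) (auto intro!: derivative_eq_intros)
  then show ?thesis
    using dirder_DERIV_0[OF P, of x "cscale c u"] xu DERIV_unique by (force simp: mult.commute)
qed

lemma dirder_zero:
  assumes P: "line_poly d P" and x: "x \<in> c0"
  shows "dirder d P 0 x = 0"
  using dirder_cscale[OF P x c0_zero, of 0] by simp

lemma dirder_sum:
  assumes P: "line_poly d P" and x: "x \<in> c0" and u: "\<And>i. u i \<in> c0"
  shows "dirder d P (\<Sum>i<(N::nat). u i) x = (\<Sum>i<N. dirder d P (u i) x)"
  by (induction N) (auto simp: dirder_zero dirder_add P x u)

text \<open>\<open>d\<close> bounds the degree on lines and \<open>m\<close> is the degree of
  homogeneity. Differentiation lowers \<open>m\<close> only, so \<open>d\<close> can stay fixed in
  an induction on \<open>m\<close>. Boundedness on bounded sets stands in for continuity.\<close>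

definition hom_poly :: "nat \<Rightarrow> nat \<Rightarrow> (linf \<Rightarrow> complex) \<Rightarrow> bool" where
  "hom_poly d m P \<longleftrightarrow> line_poly d P \<and> (\<forall>x\<in>c0. \<forall>s. s \<noteq> 0 \<longrightarrow> P (cscale s x) = s ^ m * P x) \<and>
     (\<forall>R. \<exists>C. \<forall>x\<in>c0. norm x \<le> R \<longrightarrow> cmod (P x) \<le> C)"

text \<open>Differentiating \<open>P (s x + t u) = s ^ Suc m P (x + (t / s) u)\<close> in
  \<open>t\<close> at 0 costs one factor \<open>s\<close>.\<close>

lemma dirder_homogeneous:
  assumes P: "hom_poly d (Suc m) P" and xu: "x \<in> c0" "u \<in> c0" and s: "s \<noteq> 0"
  shows "dirder d P u (cscale s x) = s ^ m * dirder d P u x"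
proof -
  have lp: "line_poly d P" using P by (simp add: hom_poly_def)
  have eq: "P (cscale s x + cscale t u) = s ^ Suc m * P (x + cscale (t / s) u)" for t
  proof -
    have "cscale s x + cscale t u = cscale s (x + cscale (t / s) u)"
      using s by (simp add: cscale_add_right)
    then show ?thesis using P xu s by (simp add: hom_poly_def del: power_Suc)
  qed
  have "((\<lambda>t. P (x + cscale t u)) has_field_derivative dirder d P u x) (at (0 / s))"
    using dirder_DERIV_0[OF lp xu] by simp
  then have "((\<lambda>t. P (x + cscale (t / s) u)) has_field_derivative dirder d P u x * (1 / s)) (at 0)"
    by (rule DERIV_chain2) (use s in \<open>auto intro!: derivative_eq_intros\<close>)
  then have "((\<lambda>t. s ^ Suc m * P (x + cscale (t / s) u)) has_field_derivative
      s ^ Suc m * (dirder d P u x * (1 / s))) (at 0)"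
    by (rule DERIV_cmult)
  then have "((\<lambda>t. P (cscale s x + cscale t u)) has_field_derivative
      s ^ Suc m * (dirder d P u x * (1 / s))) (at 0)"
    by (simp only: eq)
  from DERIV_unique[OF this dirder_DERIV_0[OF lp]] xu s show ?thesis by simp
qed

lemma line_poly_dirder:
  assumes P: "line_poly d P" and u: "u \<in> c0"
  shows "line_poly d (dirder d P u)"
  unfolding line_poly_def
proof (intro ballI allI)
  fix x y s assume xy: "x \<in> c0" "y \<in> c0"
  have "P (x + cscale s y + cscale (of_nat i) u) =
      (\<Sum>j\<le>d. lag d j s * P (x + cscale (of_nat j) y + cscale (of_nat i) u))" for i
    using line_polyD[OF P, of "x + cscale (of_nat i) u" y s] xy u by (simp add: algebra_simps)
  then have "dirder d P u (x + cscale s y) =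
      (\<Sum>i\<le>d. \<Sum>j\<le>d. dlag d i * (lag d j s * P (x + cscale (of_nat j) y + cscale (of_nat i) u)))"
    by (simp add: dirder_def sum_distrib_left)
  also have "\<dots> = (\<Sum>j\<le>d. \<Sum>i\<le>d. dlag d i * (lag d j s * P (x + cscale (of_nat j) y + cscale (of_nat i) u)))"
    by (rule sum.swap)
  also have "\<dots> = (\<Sum>j\<le>d. lag d j s * dirder d P u (x + cscale (of_nat j) y))"
    by (simp add: dirder_def sum_distrib_left mult.left_commute)
  finally show "dirder d P u (x + cscale s y) = (\<Sum>j\<le>d. lag d j s * dirder d P u (x + cscale (of_nat j) y))" .
qed

lemma dirder_bounded:
  assumes P: "hom_poly d m P"
  obtains C where "C \<ge> 0" "\<And>x u. x \<in> c0 \<Longrightarrow> u \<in> c0 \<Longrightarrow> norm x \<le> R \<Longrightarrow> norm u \<le> K \<Longrightarrow> cmod (dirder d P u x) \<le> C"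
proof -
  obtain C where C: "\<And>x. x \<in> c0 \<Longrightarrow> norm x \<le> R + real d * K \<Longrightarrow> cmod (P x) \<le> C"
    using P unfolding hom_poly_def by metis
  have "cmod (dirder d P u x) \<le> (\<Sum>j\<le>d. cmod (dlag d j) * C)"
    if xu: "x \<in> c0" "u \<in> c0" "norm x \<le> R" "norm u \<le> K" for x u
    unfolding dirder_def
  proof (rule order_trans[OF norm_sum sum_mono])
    fix j assume j: "j \<in> {..d}"
    have "norm (x + cscale (of_nat j) u) \<le> norm x + real j * norm u"
      using norm_triangle_ineq[of x "cscale (of_nat j) u"] by (simp add: norm_cscale)
    also have "\<dots> \<le> R + real d * K"
      using j xu by (intro add_mono mult_mono) auto
    finally have "cmod (P (x + cscale (of_nat j) u)) \<le> C" using xu by (intro C) auto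
    then show "cmod (dlag d j * P (x + cscale (of_nat j) u)) \<le> cmod (dlag d j) * C"
      by (simp add: norm_mult mult_left_mono)
  qed
  then show thesis using that[of "max 0 (\<Sum>j\<le>d. cmod (dlag d j) * C)"] by fastforce
qed

text \<open>Coefficients \<open>c i\<close> of modulus at most 1 turn each derivative into its
  modulus. The combination of the \<open>u i\<close> with these coefficients has norm at most
  \<open>K\<close> for every \<open>N\<close>, so a bound on a single directional derivative bounds
  the whole sum.\<close>

lemma dirder_sum_bounded:
  fixes u :: "nat \<Rightarrow> linf"
  assumes P: "hom_poly d m P" and u: "\<And>i. u i \<in> c0" and K: "\<And>n N. (\<Sum>i<N. cmod (u i n)) \<le> K"
  obtains C where "\<And>x N. x \<in> c0 \<Longrightarrow> norm x \<le> R \<Longrightarrow> (\<Sum>i<N. cmod (dirder d P (u i) x)) \<le> C"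
proof -
  have lp: "line_poly d P" using P by (simp add: hom_poly_def)
  obtain C where C: "\<And>x u. x \<in> c0 \<Longrightarrow> u \<in> c0 \<Longrightarrow> norm x \<le> R \<Longrightarrow> norm u \<le> K \<Longrightarrow> cmod (dirder d P u x) \<le> C"
    using dirder_bounded[OF P] by blast
  have "(\<Sum>i<N. cmod (dirder d P (u i) x)) \<le> C" if x: "x \<in> c0" "norm x \<le> R" for x N
  proof -
    define c where "c i = cnj (sgn (dirder d P (u i) x))" for i
    have c: "c i * dirder d P (u i) x = of_real (cmod (dirder d P (u i) x))" "cmod (c i) \<le> 1" for i
    proof -
      show "cmod (c i) \<le> 1" by (simp add: c_def norm_sgn)
      show "c i * dirder d P (u i) x = of_real (cmod (dirder d P (u i) x))"
        using complex_norm_square[of "dirder d P (u i) x"]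
        by (cases "dirder d P (u i) x = 0")
           (simp_all add: c_def sgn_eq divide_eq_eq power2_eq_square mult.commute)
    qed
    let ?w = "\<Sum>i<N. cscale (c i) (u i)"
    have "norm ?w \<le> K"
      unfolding linf_norm_le_iff
    proof
      fix n
      have "cmod (?w n) \<le> (\<Sum>i<N. cmod (c i * u i n))"
        by (simp add: sum_norm_le)
      also have "\<dots> \<le> (\<Sum>i<N. cmod (u i n))"
        using c(2) by (intro sum_mono) (auto simp: norm_mult intro: mult_left_le_one_le)
      also have "\<dots> \<le> K" by (rule K)
      finally show "cmod (?w n) \<le> K" .
    qed
    then have "cmod (dirder d P ?w x) \<le> C" using x u by (intro C) auto
    also have "dirder d P ?w x = of_real (\<Sum>i<N. cmod (dirder d P (u i) x))"
      using x u by (simp add: dirder_sum[OF lp] dirder_cscale[OF lp] c)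
    finally show ?thesis unfolding norm_of_real by linarith
  qed
  then show thesis using that by blast
qed

text \<open>The interpolation form of \<open>line_poly\<close> pays off here: it passes to the
  series term by term. Arbitrary index sets \<open>A\<close> are needed because the Schur property
  is tested against every set of columns.\<close>

lemma hom_poly_dirder_series:
  fixes u :: "nat \<Rightarrow> linf"
  assumes P: "hom_poly d (Suc m) P" and u: "\<And>i. u i \<in> c0" and K: "\<And>n N. (\<Sum>i<N. cmod (u i n)) \<le> K"
  shows "hom_poly d m (\<lambda>x. \<Sum>i. if i \<in> A then dirder d P (u i) x else 0)"
proof -
  have lp: "line_poly d P" using P by (simp add: hom_poly_def)
  have summ0: "summable (\<lambda>i. cmod (dirder d P (u i) x))" if "x \<in> c0" for x
  proof -
    obtain C where "\<And>y N. y \<in> c0 \<Longrightarrow> norm y \<le> norm x \<Longrightarrow> (\<Sum>i<N. cmod (dirder d P (u i) y)) \<le> C"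
      using dirder_sum_bounded[OF P u K, of "norm x"] by blast
    from this[OF that, of "Suc _", unfolded lessThan_Suc_atMost] show ?thesis
      by (intro bounded_imp_summable) auto
  qed
  have summA: "summable (\<lambda>i. cmod (if i \<in> A then dirder d P (u i) x else 0))" if "x \<in> c0" for x
    by (rule summable_comparison_test[OF _ summ0[OF that]]) (auto intro!: exI[of _ 0])
  have summ: "summable (\<lambda>i. if i \<in> A then dirder d P (u i) x else 0)" if "x \<in> c0" for x
    by (rule summable_norm_cancel[OF summA[OF that]])
  show ?thesis
    unfolding hom_poly_def
  proof (intro conjI allI ballI impI)
    show "line_poly d (\<lambda>x. \<Sum>i. if i \<in> A then dirder d P (u i) x else 0)"
      unfolding line_poly_def
    proof (intro ballI allI)
      fix x y s assume xy: "x \<in> c0" "y \<in> c0"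
      have "(\<Sum>j\<le>d. lag d j s * (\<Sum>i. if i \<in> A then dirder d P (u i) (x + cscale (of_nat j) y) else 0))
          = (\<Sum>j\<le>d. \<Sum>i. lag d j s * (if i \<in> A then dirder d P (u i) (x + cscale (of_nat j) y) else 0))"
        using xy by (intro sum.cong suminf_mult[symmetric] summ) auto
      also have "\<dots> = (\<Sum>i. \<Sum>j\<le>d. lag d j s * (if i \<in> A then dirder d P (u i) (x + cscale (of_nat j) y) else 0))"
        using xy by (intro suminf_sum[symmetric] summable_mult summ) auto
      also have "\<dots> = (\<Sum>i. if i \<in> A then dirder d P (u i) (x + cscale s y) else 0)"
        by (intro arg_cong[where f=suminf] ext)
           (simp add: line_polyD[OF line_poly_dirder[OF lp u] xy, of _ s, symmetric])
      finally show "(\<Sum>i. if i \<in> A then dirder d P (u i) (x + cscale s y) else 0) =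
          (\<Sum>j\<le>d. lag d j s * (\<Sum>i. if i \<in> A then dirder d P (u i) (x + cscale (of_nat j) y) else 0))"
        by simp
    qed
  next
    fix x :: linf and s :: complex assume x: "x \<in> c0" "s \<noteq> 0"
    have "(\<Sum>i. if i \<in> A then dirder d P (u i) (cscale s x) else 0)
       = (\<Sum>i. s ^ m * (if i \<in> A then dirder d P (u i) x else 0))"
      by (intro arg_cong[where f=suminf] ext) (simp add: dirder_homogeneous[OF P x(1) u x(2)])
    also have "\<dots> = s ^ m * (\<Sum>i. if i \<in> A then dirder d P (u i) x else 0)"
      by (rule suminf_mult[OF summ[OF x(1)]])
    finally show "(\<Sum>i. if i \<in> A then dirder d P (u i) (cscale s x) else 0) =
       s ^ m * (\<Sum>i. if i \<in> A then dirder d P (u i) x else 0)" .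
  next
    fix R :: real
    obtain C where C: "\<And>x N. x \<in> c0 \<Longrightarrow> norm x \<le> R \<Longrightarrow> (\<Sum>i<N. cmod (dirder d P (u i) x)) \<le> C"
      using dirder_sum_bounded[OF P u K] by blast
    have "cmod (\<Sum>i. if i \<in> A then dirder d P (u i) x else 0) \<le> C" if x: "x \<in> c0" "norm x \<le> R" for x
    proof -
      have "cmod (\<Sum>i. if i \<in> A then dirder d P (u i) x else 0)
          \<le> (\<Sum>i. cmod (if i \<in> A then dirder d P (u i) x else 0))"
        by (rule summable_norm[OF summA[OF x(1)]])
      also have "\<dots> \<le> (\<Sum>i. cmod (dirder d P (u i) x))"
        by (intro suminf_le summA summ0 x) auto
      also have "\<dots> \<le> C"
        using C[OF x] by (intro suminf_le_const summ0 x)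
      finally show ?thesis .
    qed
    then show "\<exists>C. \<forall>x\<in>c0. norm x \<le> R \<longrightarrow> cmod (\<Sum>i. if i \<in> A then dirder d P (u i) x else 0) \<le> C"
      by blast
  qed
qed

text \<open>If \<open>P (x\<^sub>k)\<close> is not Cauchy, the mean value theorem yields coordinatewise null differences \<open>u\<^sub>k\<close> and
  points \<open>w\<^sub>k\<close> with \<open>D\<^bsub>u\<^sub>k\<^esub> P (w\<^sub>k)\<close> bounded below. All subseries of \<open>\<Sum>\<^sub>k D\<^bsub>u\<^sub>k\<^esub> P\<close> are polynomials of smaller
  degree, so the induction hypothesis makes the matrix \<open>D\<^bsub>u\<^sub>j\<^esub> P (w\<^sub>k)\<close> satisfy the assumptions of the Schur
  property.\<close>

lemma hom_poly_Cauchy: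
  fixes x :: "nat \<Rightarrow> linf"
  assumes "hom_poly d m P" and "\<And>k. x k \<in> c0" and "\<And>k. norm (x k) \<le> B"
    and "\<And>n. (\<lambda>k. x k n) \<longlonglongrightarrow> l n"
  shows "Cauchy (\<lambda>k. P (x k))"
  using assms
proof (induction m arbitrary: P x B)
  case 0
  have lp: "line_poly d P" using "0.prems" by (simp add: hom_poly_def)
  \<comment> \<open>Homogeneity of degree 0 makes \<open>P\<close> constant on each punctured
    complex line through 0; continuity along the line adds the origin.\<close>
  have const: "P y = P 0" if y: "y \<in> c0" for y
  proof -
    have "isCont (\<lambda>s. P (0 + cscale s y)) 0"
      by (rule DERIV_isCont[OF dirder_DERIV_0[OF lp]]) (use y in auto)
    then have "((\<lambda>s. P (cscale s y)) \<longlongrightarrow> P 0) (at 0)" by (simp add: isCont_def)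
    moreover have "((\<lambda>s. P (cscale s y)) \<longlongrightarrow> P y) (at 0)"
      using "0.prems"(1) y
      by (intro tendsto_eventually) (auto simp: hom_poly_def eventually_at_filter)
    ultimately show ?thesis by (intro tendsto_unique[OF trivial_limit_at])
  qed
  have "(\<lambda>k. P (x k)) = (\<lambda>k. P 0)" by (intro ext const "0.prems"(2))
  then show ?case by (simp only: LIMSEQ_imp_Cauchy[OF tendsto_const])
next
  case (Suc m)
  note P = Suc.prems(1) and x = Suc.prems(2) and B = Suc.prems(3) and l = Suc.prems(4)
  have lp: "line_poly d P" using P by (simp add: hom_poly_def)
  show ?case
  proof (rule ccontr)
    assume "\<not> ?thesis"
    then show False
    proof (rule not_Cauchy_subseqs)
      fix e :: real and a b :: "nat \<Rightarrow> nat"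
      assume e: "e > 0" and a: "\<And>k. a k \<ge> k" and b: "\<And>k. b k \<ge> k"
        and ab: "\<And>k. dist (P (x (a k))) (P (x (b k))) \<ge> e"
      define u where "u k = x (a k) - x (b k)" for k
      have la: "(\<lambda>k. x (a k) n) \<longlonglongrightarrow> l n" and lb: "(\<lambda>k. x (b k) n) \<longlonglongrightarrow> l n" for n
        by (rule filterlim_compose[OF l filterlim_at_top_mono[OF filterlim_ident always_eventually]], use a b in auto)+
      have u0: "(\<lambda>k. u k n) \<longlonglongrightarrow> 0" for n
        using tendsto_diff[OF la lb, of n n] by (simp add: u_def)
      have uc: "u k \<in> c0" for k by (simp add: u_def x)
      have uB: "norm (u k) \<le> 2 * B" for k
        unfolding u_def using norm_triangle_ineq4[of "x (a k)" "x (b k)"] B[of "a k"] B[of "b k"] by simp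
      \<comment> \<open>Otherwise the mean value inequality on the segment from
        \<open>x (b k)\<close> to \<open>x (a k)\<close> would bound a difference of modulus at
        least \<open>e\<close> by \<open>e / 2\<close>.\<close>
      have "\<exists>s\<in>{0..1}. cmod (dirder d P (u k) (x (b k) + cscale (complex_of_real s) (u k))) \<ge> e / 2" for k
      proof (rule ccontr)
        assume H: "\<not> ?thesis"
        let ?g = "\<lambda>t. P (x (b k) + cscale t (u k))"
        have "cmod (?g 1 - ?g 0) \<le> e / 2 * cmod (1 - 0)"
        proof (rule field_differentiable_bound[where S = "closed_segment 0 1"])
          show "(?g has_field_derivative dirder d P (u k) (x (b k) + cscale z (u k))) (at z within closed_segment 0 1)"
            for z by (rule has_field_derivative_at_within[OF dirder_DERIV[OF lp x uc]])
          show "cmod (dirder d P (u k) (x (b k) + cscale z (u k))) \<le> e / 2"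
            if "z \<in> closed_segment 0 1" for z
          proof -
            from that obtain s where "z = of_real s" "s \<in> {0..1}"
              by (auto simp: in_segment scaleR_conv_of_real)
            then show ?thesis using H by force
          qed
        qed auto
        then have "cmod (P (x (a k)) - P (x (b k))) \<le> e / 2" by (simp add: u_def)
        with ab[of k] e show False by (simp add: dist_norm)
      qed
      then obtain s where s: "\<And>k. s k \<in> {0..1::real}"
        and se: "\<And>k. cmod (dirder d P (u k) (x (b k) + cscale (complex_of_real (s k)) (u k))) \<ge> e / 2"
        by metis
      define w where "w k = x (b k) + cscale (complex_of_real (s k)) (u k)" for k
      have wc: "w k \<in> c0" for k by (simp add: w_def x uc)
      have wB: "norm (w k) \<le> B + 2 * B" for k
      proof -
        have "norm (w k) \<le> norm (x (b k)) + \<bar>s k\<bar> * norm (u k)"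
          unfolding w_def using norm_triangle_ineq[of "x (b k)" "cscale (complex_of_real (s k)) (u k)"]
          by (simp add: norm_cscale)
        also have "\<dots> \<le> B + 1 * (2 * B)"
          using s[of k] B uB by (intro add_mono mult_mono) auto
        finally show ?thesis by simp
      qed
      \<comment> \<open>The correction \<open>s k * u k\<close> is null in every coordinate, so the
        intermediate points keep the coordinatewise limit that the induction hypothesis asks
        for.\<close>
      have lw: "(\<lambda>k. w k n) \<longlonglongrightarrow> l n" for n
      proof -
        have "(\<lambda>k. complex_of_real (s k) * u k n) \<longlonglongrightarrow> 0"
          by (rule Lim_null_comparison[OF _ tendsto_norm_zero[OF u0[of n]]])
             (use s in \<open>auto simp: norm_mult intro!: always_eventually mult_left_le_one_le\<close>)
        from tendsto_add[OF lb this] show ?thesis by (simp add: w_def)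
      qed
      obtain r :: "nat \<Rightarrow> nat" where r: "strict_mono r" and K: "\<And>n N. (\<Sum>k<N. cmod (u (r k) n)) \<le> 2 * B + 1"
        using weakly_null_subseq_bounded_sums[OF uc uB u0] by blast
      obtain C where C: "\<And>x N. x \<in> c0 \<Longrightarrow> norm x \<le> B + 2 * B \<Longrightarrow> (\<Sum>i<N. cmod (dirder d P (u (r i)) x)) \<le> C"
        using dirder_sum_bounded[OF P uc K] by blast
      have "(\<lambda>k. dirder d P (u (r k)) (w (r k))) \<longlonglongrightarrow> 0"
      proof (rule Schur_diagonal_null[where a = "\<lambda>k j. dirder d P (u (r j)) (w (r k))"])
        show "(\<Sum>j<N. cmod (dirder d P (u (r j)) (w (r k)))) \<le> C" for k N
          by (rule C[OF wc wB])
        show "Cauchy (\<lambda>k. \<Sum>j. if j \<in> A then dirder d P (u (r j)) (w (r k)) else 0)" for A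
        proof (rule Suc.IH[of "\<lambda>x. \<Sum>j. if j \<in> A then dirder d P (u (r j)) x else 0" "\<lambda>k. w (r k)" "B + 2 * B"])
          show "hom_poly d m (\<lambda>x. \<Sum>j. if j \<in> A then dirder d P (u (r j)) x else 0)"
            by (rule hom_poly_dirder_series[OF P uc K])
          show "norm (w (r k)) \<le> B + 2 * B" for k by (rule wB)
          show "(\<lambda>k. w (r k) n) \<longlonglongrightarrow> l n" for n
            using LIMSEQ_subseq_LIMSEQ[OF lw r] by (simp add: o_def)
        qed (rule wc)
      qed
      then have lim: "(\<lambda>k. cmod (dirder d P (u (r k)) (w (r k)))) \<longlonglongrightarrow> 0" by (rule tendsto_norm_zero)
      have ge: "cmod (dirder d P (u (r k)) (w (r k))) \<ge> e / 2" for k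
        using se unfolding w_def .
      have "0 \<ge> e / 2" by (rule LIMSEQ_le_const[OF lim]) (use ge in blast)
      then show False using e by simp
    qed
  qed
qed

subsection \<open>Approximation by polynomials in finitely many coordinates\<close>

text \<open>A compactness argument by contradiction: a sequence of counterexamples has a
  coordinatewise convergent subsequence, and truncating its terms later and later does not change
  the limit.\<close>

lemma hom_poly_trunc_approx:
  assumes P: "hom_poly d m P" and e: "e > 0"
  shows "\<exists>n. \<forall>x\<in>c0. norm x \<le> 1 \<longrightarrow> cmod (P x - P (trunc n x)) < e"
proof (rule ccontr)
  assume "\<not> ?thesis"
  then obtain x where x: "\<And>n. x n \<in> c0" "\<And>n. norm (x n) \<le> 1"
    and xe: "\<And>n. cmod (P (x n) - P (trunc n (x n))) \<ge> e"
    by (metis not_less)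
  have "cmod (x k n) \<le> 1" for k n
    using norm_bounded[of "x k" n] x(2)[of k] by linarith
  then obtain r where r: "strict_mono (r :: nat \<Rightarrow> nat)"
    and "\<And>n. n \<in> UNIV \<Longrightarrow> \<exists>l. (\<lambda>k. x (r k) n) \<longlonglongrightarrow> l"
    using function_convergent_subsequence[of UNIV "\<lambda>k n. x k n" 1] by (metis UNIV_I countableI_type)
  then obtain l where l: "\<And>n. (\<lambda>k. x (r k) n) \<longlonglongrightarrow> l n"
    by (metis UNIV_I)
  \<comment> \<open>Points at even places, their truncations at odd places. Both kinds converge
    coordinatewise to \<open>l\<close>, and the neighbours \<open>2 * M\<close> and
    \<open>2 * M + 1\<close> are one counterexample and its own truncation.\<close>
  define y where "y k = (let j = r (k div 2) in if even k then x j else trunc j (x j))" for k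
  have "Cauchy (\<lambda>k. P (y k))"
  proof (rule hom_poly_Cauchy[OF P])
    show "y k \<in> c0" "norm (y k) \<le> 1" for k
      using x norm_trunc_le order_trans by (auto simp: y_def Let_def) blast
    show "(\<lambda>k. y k n) \<longlonglongrightarrow> l n" for n
    proof (rule Lim_transform_eventually)
      have "filterlim (\<lambda>k::nat. k div 2) at_top at_top"
        unfolding filterlim_at_top
      proof
        show "\<forall>\<^sub>F k in sequentially. Z \<le> k div 2" for Z :: nat
          by (rule eventually_at_top_linorderI[of "2 * Z"]) auto
      qed
      then show "(\<lambda>k. x (r (k div 2)) n) \<longlonglongrightarrow> l n"
        by (rule filterlim_compose[OF l])
      show "\<forall>\<^sub>F k in sequentially. x (r (k div 2)) n = y k n"
      proof (rule eventually_at_top_linorderI)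
        fix k assume "2 * Suc n \<le> k"
        then have "n < k div 2" by simp
        also have "k div 2 \<le> r (k div 2)" by (rule strict_mono_imp_increasing[OF r])
        finally show "x (r (k div 2)) n = y k n" by (simp add: y_def Let_def)
      qed
    qed
  qed
  then obtain M where M: "\<And>i j. i \<ge> M \<Longrightarrow> j \<ge> M \<Longrightarrow> dist (P (y i)) (P (y j)) < e"
    using e unfolding Cauchy_def by metis
  have "dist (P (y (2 * M))) (P (y (2 * M + 1))) < e" by (rule M) auto
  then have "cmod (P (x (r M)) - P (trunc (r M) (x (r M)))) < e"
    by (simp add: y_def Let_def dist_norm)
  with xe[of "r M"] show False by simp
qed

text \<open>Polynomials in finitely many coordinates, defined on all of \<open>linf\<close> so that
  the same function can be used on the ball of \<open>c0\<close>, on the closed ball of the bidual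
  and on polydiscs.\<close>

inductive_set cpoly :: "(linf \<Rightarrow> complex) set" where
  const: "(\<lambda>x. c) \<in> cpoly"
| coord: "(\<lambda>x. apply_bcontfun x n) \<in> cpoly"
| add: "p \<in> cpoly \<Longrightarrow> q \<in> cpoly \<Longrightarrow> (\<lambda>x. p x + q x) \<in> cpoly"
| mult: "p \<in> cpoly \<Longrightarrow> q \<in> cpoly \<Longrightarrow> (\<lambda>x. p x * q x) \<in> cpoly"

lemma cpoly_sum: "(\<And>i. i \<in> A \<Longrightarrow> p i \<in> cpoly) \<Longrightarrow> (\<lambda>x. \<Sum>i\<in>A. p i x) \<in> cpoly"
  by (induction A rule: infinite_finite_induct) (auto intro: cpoly.intros)

lemma cpoly_prod: "(\<And>i. i \<in> A \<Longrightarrow> p i \<in> cpoly) \<Longrightarrow> (\<lambda>x. \<Prod>i\<in>A. p i x) \<in> cpoly"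
  by (induction A rule: infinite_finite_induct) (auto intro: cpoly.intros)

lemma cpoly_diff:
  assumes "p \<in> cpoly" "q \<in> cpoly"
  shows "(\<lambda>x. p x - q x) \<in> cpoly"
  using cpoly.add[OF assms(1) cpoly.mult[OF cpoly.const[of "-1"] assms(2)]] by simp

lemma cpoly_lag: "(\<lambda>x. lag d j (apply_bcontfun x n)) \<in> cpoly"
proof -
  have "(\<lambda>x. (apply_bcontfun x n - of_nat i) * (1 / (of_nat j - of_nat i))) \<in> cpoly" for i
    by (intro cpoly.mult cpoly_diff cpoly.const cpoly.coord)
  then have "(\<lambda>x. \<Prod>i\<in>{..d} - {j}. (apply_bcontfun x n - of_nat i) * (1 / (of_nat j - of_nat i))) \<in> cpoly"
    by (rule cpoly_prod)
  then show ?thesis by (simp add: lag_def)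
qed

text \<open>Interpolation in the direction of the last basis vector splits off one coordinate at a
  time. The base point \<open>y\<close> is arbitrary because each node shifts it.\<close>

lemma line_poly_trunc_cpoly:
  assumes P: "line_poly d P"
  shows "y \<in> c0 \<Longrightarrow> (\<lambda>x. P (y + trunc n x)) \<in> cpoly"
proof (induction n arbitrary: y)
  case 0
  then show ?case by (simp add: cpoly.const)
next
  case (Suc n)
  have "P (y + trunc (Suc n) x) =
      (\<Sum>j\<le>d. lag d j (x n) * P ((y + cscale (of_nat j) (basis_vec n)) + trunc n x))" for x
    using line_polyD[OF P, of "y + trunc n x" "basis_vec n" "x n"] Suc.prems
    by (simp add: trunc_Suc algebra_simps)
  then show ?case
    using Suc.prems by (auto intro!: cpoly_sum cpoly.mult cpoly_lag Suc.IH)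
qed

section \<open>Taylor expansion on the ball of \<open>c0\<close> and its homogeneous terms\<close>

lemma unit_ball_iff: "x \<in> unit_ball V \<longleftrightarrow> x \<in> V \<and> norm x < 1"
  by (simp add: unit_ball_def)

text \<open>The bridge to one complex variable: Cauchy estimates and Taylor expansions are applied
  only on such slices.\<close>

lemma holomorphic_on_ball_line:
  assumes f: "holomorphic_on_ball c0 f" and xy: "x \<in> c0" "y \<in> c0"
  shows "(\<lambda>s. f (x + cscale s y)) holomorphic_on {s. norm (x + cscale s y) < 1}"
  unfolding holomorphic_on_def
proof (intro ballI, rule field_differentiable_at_within)
  fix s assume s: "s \<in> {s. norm (x + cscale s y) < 1}"
  let ?p = "x + cscale s y"
  from s xy have "?p \<in> unit_ball c0" by (simp add: unit_ball_iff)
  from bspec[OF f[unfolded holomorphic_on_ball_def] this]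
  obtain L :: "linf \<Rightarrow> complex" where H: "(\<forall>u\<in>c0. \<forall>v\<in>c0. L (u + v) = L u + L v) \<and>
      (\<forall>c. \<forall>u\<in>c0. L (cscale c u) = c * L u) \<and> (\<exists>K. \<forall>u\<in>c0. cmod (L u) \<le> K * norm u) \<and>
      ((\<lambda>q. (f q - f ?p - L (q - ?p)) /\<^sub>R norm (q - ?p)) \<longlongrightarrow> 0) (at ?p within c0)"
    by (rule exE)
  note L = H[THEN conjunct2, THEN conjunct1, rule_format]
    and lim = H[THEN conjunct2, THEN conjunct2, THEN conjunct2]
  show "(\<lambda>s. f (x + cscale s y)) field_differentiable (at s)"
  proof (cases "y = 0")
    case False
    have diff: "x + cscale t y - ?p = cscale (t - s) y" for t
      by (auto intro!: bcontfun_eqI simp: algebra_simps)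
    have "((\<lambda>t. x + cscale t y) \<longlongrightarrow> ?p) (at s)"
    proof (rule LIM_zero_cancel)
      have "((\<lambda>t. cmod (t - s) * norm y) \<longlongrightarrow> 0) (at s)"
        by (auto intro!: tendsto_eq_intros)
      then have "((\<lambda>t. norm ((x + cscale t y) - ?p)) \<longlongrightarrow> 0) (at s)"
        by (simp only: diff norm_cscale)
      then show "((\<lambda>t. x + cscale t y - ?p) \<longlongrightarrow> 0) (at s)"
        by (rule tendsto_norm_zero_cancel)
    qed
    moreover have "x + cscale t y \<noteq> ?p" if "t \<noteq> s" for t
    proof
      assume "x + cscale t y = ?p"
      then have "norm (cscale (t - s) y) = 0" using diff[of t] by simp
      with that False show False by (simp add: norm_cscale)
    qed
    ultimately have "filterlim (\<lambda>t. x + cscale t y) (at ?p within c0) (at s)"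
      using xy by (auto simp: filterlim_at eventually_at_filter)
    from filterlim_compose[OF lim this]
    have "((\<lambda>t. (f (x + cscale t y) - f ?p - (t - s) * L y) /\<^sub>R (cmod (t - s) * norm y)) \<longlongrightarrow> 0) (at s)"
      by (simp only: diff L[OF xy(2)] norm_cscale)
    then have "((\<lambda>t. norm y * norm ((f (x + cscale t y) - f ?p - (t - s) * L y) /\<^sub>R (cmod (t - s) * norm y))) \<longlongrightarrow> 0) (at s)"
      by (intro tendsto_mult_right_zero tendsto_norm_zero)
    then have "((\<lambda>t. norm ((f (x + cscale t y) - f ?p) - L y * (t - s)) / norm (t - s)) \<longlongrightarrow> 0) (at s)"
    proof (rule Lim_transform_eventually)
      show "\<forall>\<^sub>F t in at s. norm y * norm ((f (x + cscale t y) - f ?p - (t - s) * L y) /\<^sub>R (cmod (t - s) * norm y))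
          = norm ((f (x + cscale t y) - f ?p) - L y * (t - s)) / norm (t - s)"
        using False by (auto simp: eventually_at_filter divide_inverse mult.commute)
    qed
    then have "((\<lambda>s. f (x + cscale s y)) has_field_derivative L y) (at s)"
      unfolding has_field_derivative_def has_derivative_iff_norm
      by (simp add: bounded_linear_mult_right)
    then show ?thesis unfolding field_differentiable_def by blast
  qed simp
qed

lemma Taylor_coeff_le:
  assumes f: "f holomorphic_on ball 0 \<rho>" "\<And>s. cmod s < \<rho> \<Longrightarrow> cmod (f s) \<le> M"
    and r: "0 < r" "r < \<rho>"
  shows "cmod ((deriv ^^ j) f 0 / fact j) \<le> M / r ^ j"
proof -
  have "norm ((deriv ^^ j) f 0) \<le> fact j * M / r ^ j"
  proof (rule Cauchy_inequality)
    show "f holomorphic_on ball 0 r" "continuous_on (cball 0 r) f"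
      using f(1) r by (auto intro!: holomorphic_on_imp_continuous_on elim!: holomorphic_on_subset)
  qed (use f(2) r in auto)
  then show ?thesis
    using divide_right_mono[of "cmod ((deriv ^^ j) f 0)" "fact j * M / r ^ j" "fact j"]
    by (simp add: norm_divide)
qed

text \<open>The Cauchy estimate on the circle of radius \<open>r\<close>, combined with
  \<open>|t| \<le> q r\<close>, bounds the \<open>j\<close>-th term by \<open>M q ^ j\<close>, so a
  geometric tail dominates the remainder.\<close>

lemma Taylor_remainder_le:
  assumes f: "f holomorphic_on ball 0 \<rho>" "\<And>s. cmod s < \<rho> \<Longrightarrow> cmod (f s) \<le> M"
    and r: "0 < r" "r < \<rho>" and q: "0 \<le> q" "q < 1" and t: "cmod t \<le> q * r"
  shows "cmod (f t - (\<Sum>j<m. (deriv ^^ j) f 0 / fact j * t ^ j)) \<le> M * q ^ m / (1 - q)"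
proof -
  define c where "c j = (deriv ^^ j) f 0 / fact j" for j
  have "q * r \<le> r" using q r by (simp add: mult_left_le_one_le)
  with t r have "cmod t < \<rho>" by linarith
  then have "t \<in> ball 0 \<rho>" by simp
  from holomorphic_power_series[OF f(1) this] have S: "(\<lambda>j. c j * t ^ j) sums f t"
    by (simp add: c_def)
  have ct: "cmod (c j * t ^ j) \<le> M * q ^ j" for j
  proof -
    have "cmod (c j * t ^ j) \<le> M / r ^ j * (q * r) ^ j"
      unfolding norm_mult norm_power
      using Taylor_coeff_le[OF f r, of j] t order_trans[OF norm_ge_zero Taylor_coeff_le[OF f r, of j]]
      by (intro mult_mono power_mono) (auto simp: c_def)
    then show ?thesis using r by (simp add: power_mult_distrib)
  qed
  have G: "(\<lambda>j. M * q ^ (j + m)) sums (M * q ^ m / (1 - q))"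
    using sums_mult[OF geometric_sums[of q], of "M * q ^ m"] q by (simp add: power_add mult_ac)
  have "(\<lambda>j. c (j + m) * t ^ (j + m)) sums (f t - (\<Sum>j<m. c j * t ^ j))"
    by (rule sums_split_initial_segment[OF S])
  then have "cmod (f t - (\<Sum>j<m. c j * t ^ j)) = cmod (\<Sum>j. c (j + m) * t ^ (j + m))"
    by (simp add: sums_iff)
  also have "\<dots> \<le> (\<Sum>j. M * q ^ (j + m))"
    by (rule norm_suminf_le[OF ct sums_summable[OF G]])
  also have "\<dots> = M * q ^ m / (1 - q)" using G by (simp add: sums_iff)
  finally show ?thesis by (simp add: c_def)
qed

text \<open>Any point of the ball is reached from 0 in \<open>N\<close> equal steps shorter than
  \<open>d\<close>, each changing \<open>f\<close> by less than 1, and \<open>N\<close> is the same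
  for all points.\<close>

lemma uniformly_continuous_on_unit_ball_bounded:
  assumes V: "\<And>c x. x \<in> V \<Longrightarrow> cscale c x \<in> V"
    and f: "uniformly_continuous_on (unit_ball V) f"
  shows "\<exists>M. \<forall>x\<in>unit_ball V. cmod (f x) \<le> M"
proof -
  obtain d where d0: "d > 0" and "\<forall>x\<in>unit_ball V. \<forall>y\<in>unit_ball V. dist y x < d \<longrightarrow> dist (f y) (f x) < 1"
    using f zero_less_one unfolding uniformly_continuous_on_def by blast
  then have d: "d > 0" "\<And>x y. x \<in> unit_ball V \<Longrightarrow> y \<in> unit_ball V \<Longrightarrow> dist y x < d \<Longrightarrow> dist (f y) (f x) < 1"
    by blast+
  obtain n where "inverse (real (Suc n)) < d" using reals_Archimedean[OF d(1)] by blast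
  then have "\<exists>N>0. 1 / real N < d" by (intro exI[of _ "Suc n"]) (simp add: inverse_eq_divide)
  then obtain N :: nat where N: "N > 0" "1 / real N < d" by blast
  have "cmod (f x) \<le> cmod (f 0) + real N" if x: "x \<in> unit_ball V" for x
  proof -
    define y where "y j = cscale (of_real (real j / real N)) x" for j
    have "cmod (f (y j)) \<le> cmod (f 0) + real j" if "j \<le> N" for j
      using that
    proof (induction j)
      case (Suc j)
      have mem: "y i \<in> unit_ball V" if "i \<le> N" for i
      proof -
        have "real i / real N * norm x \<le> 1 * norm x"
          using that N by (intro mult_right_mono) auto
        then have "norm (y i) \<le> norm x"
          unfolding y_def norm_cscale norm_of_real by simp
        then show ?thesis using x by (auto simp: y_def unit_ball_iff V)
      qed
      have "y (Suc j) - y j = cscale (of_real (1 / real N)) x"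
        using N by (auto intro!: bcontfun_eqI simp: y_def field_simps)
      then have "norm (y (Suc j) - y j) = 1 / real N * norm x"
        using N by (simp only: norm_cscale norm_of_real) simp
      also have "\<dots> \<le> 1 / real N * 1" using x by (intro mult_left_mono) (auto simp: unit_ball_iff)
      finally have "dist (f (y (Suc j))) (f (y j)) < 1"
        using Suc.prems N by (intro d(2) mem) (auto simp: dist_norm)
      then show ?case using Suc norm_triangle_ineq2[of "f (y (Suc j))" "f (y j)"] by (simp add: dist_norm)
    qed (simp add: y_def)
    from this[of N] show ?thesis using N by (simp add: y_def)
  qed
  then show ?thesis by (intro exI ballI)
qed

text \<open>The term of degree \<open>m\<close> in the Taylor expansion of \<open>f\<close> at 0,
  read off on the slice through \<open>x\<close>.\<close>

definition hom_part :: "(linf \<Rightarrow> complex) \<Rightarrow> nat \<Rightarrow> linf \<Rightarrow> complex" where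
  "hom_part f m x = (deriv ^^ m) (\<lambda>s. f (cscale s x)) 0 / fact m"

context
  fixes f :: "linf \<Rightarrow> complex" and M :: real
  assumes hol: "holomorphic_on_ball c0 f"
    and M: "\<And>x. x \<in> unit_ball c0 \<Longrightarrow> cmod (f x) \<le> M"
begin

lemma slice_holomorphic:
  assumes x: "x \<in> c0" "norm x \<le> R" and R: "R > 0"
  shows "(\<lambda>s. f (cscale s x)) holomorphic_on ball 0 (1 / R)"
    and "cmod s < 1 / R \<Longrightarrow> cmod (f (cscale s x)) \<le> M"
proof -
  have *: "norm (cscale s x) < 1" if "cmod s < 1 / R" for s
  proof -
    have "cmod s * norm x \<le> cmod s * R" using x by (intro mult_left_mono) auto
    also have "\<dots> < 1" using that R by (simp add: field_simps)
    finally show ?thesis by (simp add: norm_cscale)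
  qed
  show "(\<lambda>s. f (cscale s x)) holomorphic_on ball 0 (1 / R)"
    using holomorphic_on_subset[OF holomorphic_on_ball_line[OF hol c0_zero x(1)], of "ball 0 (1 / R)"] *
    by force
  show "cmod s < 1 / R \<Longrightarrow> cmod (f (cscale s x)) \<le> M"
    using * x by (intro M) (auto simp: unit_ball_iff)
qed

lemma hom_part_remainder:
  assumes x: "x \<in> c0" "norm x \<le> R" and R: "R > 0"
    and r: "0 < r" "r < 1 / R" and q: "0 \<le> q" "q < 1" and t: "cmod t \<le> q * r"
  shows "cmod (f (cscale t x) - (\<Sum>j<m. hom_part f j x * t ^ j)) \<le> M * q ^ m / (1 - q)"
  unfolding hom_part_def
  using Taylor_remainder_le[OF slice_holomorphic[OF x R] r q t] .

lemma hom_part_scale: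
  assumes x: "x \<in> c0" and s: "s \<noteq> 0"
  shows "hom_part f m (cscale s x) = s ^ m * hom_part f m x"
proof -
  let ?R = "norm x + 1"
  have R: "?R > 0" "norm x \<le> ?R" by (auto simp: add_nonneg_pos)
  have "(deriv ^^ m) (\<lambda>w. f (cscale (s * w) x)) 0 = s ^ m * (deriv ^^ m) (\<lambda>s. f (cscale s x)) (s * 0)"
  proof (rule higher_deriv_compose_linear[OF slice_holomorphic(1)[OF x R(2,1)]])
    show "(0::complex) \<in> ball 0 (1 / ?R / cmod s)" using R s by (simp del: divide_divide_eq_left)
    show "s * w \<in> ball 0 (1 / ?R)" if "w \<in> ball 0 (1 / ?R / cmod s)" for w
    proof -
      have "cmod w < 1 / ?R / cmod s" using that by simp
      then have "cmod s * cmod w < 1 / ?R"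
        using s pos_less_divide_eq[of "cmod s" "cmod w" "1 / ?R"] by (simp add: mult.commute)
      then show ?thesis by (simp add: norm_mult)
    qed
  qed auto
  then show ?thesis by (simp add: hom_part_def mult.commute)
qed

lemma hom_part_bound:
  assumes x: "x \<in> c0" "norm x \<le> R" and R: "R > 0"
  shows "cmod (hom_part f m x) \<le> M / (1 / (2 * R)) ^ m"
  unfolding hom_part_def
  by (rule Taylor_coeff_le[OF slice_holomorphic[OF x R]]) (use R in \<open>auto simp: field_simps\<close>)

text \<open>The definition of \<open>hom_part\<close> only looks at lines through 0, so other lines
  need an argument. At a point \<open>z\<close>, the term of degree \<open>m\<close> is the limit,
  as \<open>t\<close> tends to 0, of \<open>f (t z)\<close> minus the terms of lower degree, divided
  by \<open>t ^ m\<close>. By induction these quotients are holomorphic in \<open>s\<close>, and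
  they converge uniformly on the disc.\<close>

lemma hom_part_line_holomorphic:
  assumes xy: "x \<in> c0" "y \<in> c0"
  shows "(\<lambda>s. hom_part f m (x + cscale s y)) holomorphic_on ball 0 \<rho>"
proof (induction m rule: less_induct)
  case (less m)
  define R where "R = norm x + \<bar>\<rho>\<bar> * norm y + 1"
  have R: "R > 0" by (simp add: R_def add_nonneg_pos)
  have nR: "norm (x + cscale s y) \<le> R" if "s \<in> ball 0 \<rho>" for s :: complex
  proof -
    have "norm (x + cscale s y) \<le> norm x + cmod s * norm y"
      using norm_triangle_ineq[of x "cscale s y"] by (simp add: norm_cscale)
    also have "\<dots> \<le> norm x + \<bar>\<rho>\<bar> * norm y" using that by (intro add_mono mult_right_mono) auto
    finally show ?thesis by (simp add: R_def)
  qed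
  \<comment> \<open>\<open>r\<close> is half the radius of the disc on which all slices in question
    are defined. The ratios \<open>q k\<close> tend to 0, and being at most \<open>1 / 2\<close>
    they keep the factor \<open>1 / (1 - q k)\<close> of the remainder at most 2.\<close>
  define r where "r = 1 / (2 * R)"
  have r: "0 < r" "r < 1 / R" using R by (auto simp: r_def field_simps)
  define q :: "nat \<Rightarrow> real" where "q k = 1 / real (k + 2)" for k
  have q: "0 < q k" "q k \<le> 1 / 2" "q k < 1" for k by (auto simp: q_def field_simps)
  define t where "t k = complex_of_real (q k * r)" for k
  have t: "cmod (t k) = q k * r" "t k \<noteq> 0" for k
    using q(1)[of k] r unfolding t_def norm_of_real by (auto simp: abs_mult)
  define F where "F k s = (f (cscale (t k) (x + cscale s y)) -
      (\<Sum>i<m. hom_part f i (x + cscale s y) * t k ^ i)) / t k ^ m" for k and s :: complex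
  show ?case
  proof (rule holomorphic_uniform_sequence[where f = F])
    fix k
    have "(\<lambda>s. f (cscale (t k) (x + cscale s y))) holomorphic_on ball 0 \<rho>"
    proof -
      have eq: "cscale (t k) (x + cscale s y) = cscale (t k) x + cscale s (cscale (t k) y)" for s :: complex
        by (simp add: cscale_add_right mult.commute)
      have "norm (cscale (t k) (x + cscale s y)) < 1" if "s \<in> ball 0 \<rho>" for s :: complex
      proof -
        have "norm (cscale (t k) (x + cscale s y)) \<le> (q k * r) * R"
          unfolding norm_cscale t(1) using nR[OF that] q(1)[of k] r by (intro mult_left_mono) auto
        also have "\<dots> = q k / 2" using R by (simp add: r_def)
        also have "\<dots> < 1" using q(3)[of k] by simp
        finally show ?thesis .
      qed
      then have "ball 0 \<rho> \<subseteq> {s. norm (cscale (t k) x + cscale s (cscale (t k) y)) < 1}"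
        by (auto simp: eq)
      with holomorphic_on_ball_line[OF hol c0_cscale[OF xy(1), of "t k"] c0_cscale[OF xy(2), of "t k"]]
      show ?thesis unfolding eq by (rule holomorphic_on_subset)
    qed
    then show "F k holomorphic_on ball 0 \<rho>"
      unfolding F_def using less.IH t by (intro holomorphic_intros) auto
  next
    fix s0 :: complex assume s0: "s0 \<in> ball 0 \<rho>"
    obtain d where d: "d > 0" "cball s0 d \<subseteq> ball 0 \<rho>"
      using open_contains_cball[of "ball (0::complex) \<rho>"] s0 by blast
    have "uniform_limit (ball 0 \<rho>) F (\<lambda>s. hom_part f m (x + cscale s y)) sequentially"
    proof (rule uniform_limitI)
      fix e :: real assume e: "e > 0"
      have "(\<lambda>k. 2 * M / r ^ m * q k) \<longlonglongrightarrow> 2 * M / r ^ m * 0"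
        unfolding q_def by (intro tendsto_intros LIMSEQ_ignore_initial_segment[OF lim_inverse_n'])
      then have "\<forall>\<^sub>F k in sequentially. 2 * M / r ^ m * q k < e"
        by (rule order_tendstoD) (use e in auto)
      then show "\<forall>\<^sub>F k in sequentially. \<forall>s\<in>ball 0 \<rho>. dist (F k s) (hom_part f m (x + cscale s y)) < e"
      proof eventually_elim
        case (elim k)
        show ?case
        proof
          fix s :: complex assume s: "s \<in> ball 0 \<rho>"
          let ?z = "x + cscale s y"
          have z: "?z \<in> c0" using xy by simp
          have M0: "M \<ge> 0" using order_trans[OF norm_ge_zero M[of 0]] by (simp add: unit_ball_iff)
          have "cmod (f (cscale (t k) ?z) - (\<Sum>j<Suc m. hom_part f j ?z * t k ^ j)) \<le> M * q k ^ Suc m / (1 - q k)"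
            using q[of k] t[of k] by (intro hom_part_remainder[OF z nR[OF s] R r]) auto
          also have "\<dots> \<le> M * q k ^ Suc m / (1 / 2)"
            using q[of k] M0 by (intro divide_left_mono) auto
          finally have "cmod (f (cscale (t k) ?z) - (\<Sum>j<Suc m. hom_part f j ?z * t k ^ j)) \<le> 2 * M * q k ^ Suc m"
            by simp
          moreover have "F k s - hom_part f m ?z =
              (f (cscale (t k) ?z) - (\<Sum>j<Suc m. hom_part f j ?z * t k ^ j)) / t k ^ m"
            using t(2)[of k] by (simp add: F_def diff_divide_distrib add_divide_distrib diff_diff_eq)
          ultimately have "cmod (F k s - hom_part f m ?z) \<le> 2 * M * q k ^ Suc m / (q k * r) ^ m"
            using t(1)[of k] q(1)[of k] r by (simp add: norm_divide norm_power divide_right_mono del: power_Suc)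
          also have "\<dots> = 2 * M / r ^ m * q k"
            using q(1)[of k] by (simp add: power_mult_distrib)
          also have "\<dots> < e" by (rule elim)
          finally show "dist (F k s) (hom_part f m ?z) < e" by (simp add: dist_norm)
        qed
      qed
    qed
    then have "uniform_limit (cball s0 d) F (\<lambda>s. hom_part f m (x + cscale s y)) sequentially"
      by (rule uniform_limit_on_subset) (rule d(2))
    with d show "\<exists>d>0. cball s0 d \<subseteq> ball 0 \<rho> \<and>
        uniform_limit (cball s0 d) F (\<lambda>s. hom_part f m (x + cscale s y)) sequentially" by blast
  qed auto
qed

text \<open>By homogeneity the value at \<open>x + s y\<close> is \<open>s ^ m\<close> times the
  value at \<open>x / s + y\<close>, which is bounded for \<open>|s| \<ge> 1\<close>. An entire
  function of such growth is a polynomial of degree at most \<open>m\<close>, by Liouville.\<close>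

lemma hom_poly_hom_part: "hom_poly m m (hom_part f m)"
  unfolding hom_poly_def
proof (intro conjI allI ballI impI)
  show "hom_part f m (cscale s x) = s ^ m * hom_part f m x" if "x \<in> c0" "s \<noteq> 0" for x s
    using that by (rule hom_part_scale)
  show "\<exists>C. \<forall>x\<in>c0. norm x \<le> R \<longrightarrow> cmod (hom_part f m x) \<le> C" for R
    using hom_part_bound[of _ "max R 1" m]
    by (intro exI[of _ "M / (1 / (2 * max R 1)) ^ m"]) auto
  show "line_poly m (hom_part f m)"
    unfolding line_poly_def
  proof (intro ballI allI)
    fix x y s assume xy: "x \<in> c0" "y \<in> c0"
    let ?g = "\<lambda>s. hom_part f m (x + cscale s y)"
    have "?g holomorphic_on UNIV"
      unfolding holomorphic_on_def
    proof
      fix s :: complex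
      have "?g holomorphic_on ball 0 (cmod s + 1)" by (rule hom_part_line_holomorphic[OF xy])
      then show "?g field_differentiable at s within UNIV"
        using holomorphic_on_imp_differentiable_at[of ?g "ball 0 (cmod s + 1)" s] by auto
    qed
    moreover have "cmod (?g s) \<le> M / (1 / (2 * (norm x + norm y + 1))) ^ m * cmod s ^ m" if "1 \<le> cmod s" for s
    proof -
      have s: "s \<noteq> 0" using that by auto
      have eq: "x + cscale s y = cscale s (cscale (1 / s) x + y)"
        using s by (simp add: cscale_add_right)
      have "norm (cscale (1 / s) x + y) \<le> norm (cscale (1 / s) x) + norm y"
        by (rule norm_triangle_ineq)
      also have "norm (cscale (1 / s) x) \<le> norm x"
        using that s by (simp add: norm_cscale norm_divide divide_le_eq mult_left_le mult_le_cancel_left1)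
      finally have "cmod (hom_part f m (cscale (1 / s) x + y)) \<le> M / (1 / (2 * (norm x + norm y + 1))) ^ m"
        using xy by (intro hom_part_bound) (auto simp: add_nonneg_pos)
      then show ?thesis
        unfolding eq hom_part_scale[OF c0_add[OF c0_cscale[OF xy(1)] xy(2)] s]
          norm_mult norm_power mult.commute[of "cmod s ^ m"]
        by (rule mult_right_mono) simp
    qed
    ultimately have "?g \<xi> = (\<Sum>k\<le>m. (deriv ^^ k) ?g 0 / fact k * \<xi> ^ k)" for \<xi>
      by (rule Liouville_polynomial)
    then show "?g s = (\<Sum>j\<le>m. lag m j s * hom_part f m (x + cscale (of_nat j) y))"
      by (rule Lagrange_interpolation)
  qed
qed

end

theorem Au_cpoly_approx:
  assumes f: "f \<in> Au c0" and e: "e > 0"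
  shows "\<exists>p\<in>cpoly. \<forall>x\<in>unit_ball c0. cmod (f x - p x) < e"
proof -
  have hol: "holomorphic_on_ball c0 f" and uc: "uniformly_continuous_on (unit_ball c0) f"
    using f by (auto simp: Au_def)
  obtain M where M: "\<And>x. x \<in> unit_ball c0 \<Longrightarrow> cmod (f x) \<le> M"
    using uniformly_continuous_on_unit_ball_bounded[OF c0_cscale uc] by blast
  have e3: "e / 3 > 0" using e by simp
  obtain d where d0: "d > 0" and "\<forall>x\<in>unit_ball c0. \<forall>y\<in>unit_ball c0. dist y x < d \<longrightarrow> dist (f y) (f x) < e / 3"
    using uc e3 unfolding uniformly_continuous_on_def by blast
  then have d: "d > 0" "\<And>x y. x \<in> unit_ball c0 \<Longrightarrow> y \<in> unit_ball c0 \<Longrightarrow> dist y x < d \<Longrightarrow> dist (f y) (f x) < e / 3"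
    by blast+
  \<comment> \<open>The dilation factor will be \<open>r\<^sup>2\<close>: one factor
    \<open>r\<close> is the radius for the Cauchy estimates, the other the ratio of the geometric
    remainder. It is so close to 1 that uniform continuity absorbs the dilation.\<close>
  obtain r :: real where r: "0 < r" "r < 1" "1 - r\<^sup>2 < d"
  proof -
    have "((\<lambda>r::real. 1 - r\<^sup>2) \<longlongrightarrow> 1 - 1\<^sup>2) (at_left 1)" by (intro tendsto_intros)
    then have "eventually (\<lambda>r::real. 1 - r\<^sup>2 < d) (at_left 1)"
      by (rule order_tendstoD) (use d in auto)
    moreover have "eventually (\<lambda>r::real. r \<in> {0<..<1}) (at_left 1)"
      by (rule eventually_at_left_real) simp
    ultimately have "eventually (\<lambda>r::real. 1 - r\<^sup>2 < d \<and> r \<in> {0<..<1}) (at_left 1)"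
      by (rule eventually_conj)
    then obtain r :: real where "1 - r\<^sup>2 < d \<and> r \<in> {0<..<1}"
      using eventually_happens trivial_limit_at_left_real by blast
    then show thesis using that[of r] by simp
  qed
  have "(\<lambda>m. M * r ^ m / (1 - r)) \<longlonglongrightarrow> M * 0 / (1 - r)"
    using r by (intro tendsto_intros LIMSEQ_power_zero) auto
  then have "eventually (\<lambda>m. M * r ^ m / (1 - r) < e / 3) sequentially"
    by (rule order_tendstoD) (use e in auto)
  then obtain m where m: "M * r ^ m / (1 - r) < e / 3" by (auto dest!: eventually_happens)
  \<comment> \<open>There will be \<open>m\<close> such errors, and \<open>real m + 1\<close> keeps
    their sum at most \<open>e / 3\<close> without dividing by 0 when \<open>m = 0\<close>.\<close>
  have "\<exists>n. \<forall>x\<in>c0. norm x \<le> 1 \<longrightarrow> cmod (hom_part f j x - hom_part f j (trunc n x)) < e / 3 / (real m + 1)" for j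
    using e by (intro hom_poly_trunc_approx[OF hom_poly_hom_part[OF hol M]]) auto
  then obtain n where n: "\<And>j x. x \<in> c0 \<Longrightarrow> norm x \<le> 1 \<Longrightarrow>
      cmod (hom_part f j x - hom_part f j (trunc (n j) x)) < e / 3 / (real m + 1)" by metis
  \<comment> \<open>The summand \<open>0 +\<close> gives the shape of
    \<open>line_poly_trunc_cpoly\<close> with base point 0.\<close>
  define p where "p x = (\<Sum>j<m. hom_part f j (0 + trunc (n j) x) * of_real (r\<^sup>2) ^ j)" for x
  have "p \<in> cpoly"
    unfolding p_def using hom_poly_hom_part[OF hol M]
    by (intro cpoly_sum cpoly.mult cpoly.const line_poly_trunc_cpoly) (auto simp: hom_poly_def)
  moreover have "cmod (f x - p x) < e" if x: "x \<in> unit_ball c0" for x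
  proof -
    define t where "t = complex_of_real (r\<^sup>2)"
    have ct: "cmod t = r\<^sup>2" unfolding t_def norm_of_real by simp
    have xc: "x \<in> c0" and nx: "norm x \<le> 1" and nx': "norm x < 1" using x by (auto simp: unit_ball_iff)
    have r2: "r\<^sup>2 < 1" "0 \<le> r\<^sup>2" using r by (auto simp: power_less_one_iff)
    have tx: "cscale t x \<in> unit_ball c0"
    proof -
      have "r\<^sup>2 * norm x \<le> 1 * norm x" using r2 by (intro mult_right_mono) auto
      then show ?thesis using xc nx' by (simp add: unit_ball_iff norm_cscale ct)
    qed
    have "x - cscale t x = cscale (of_real (1 - r\<^sup>2)) x"
      by (auto intro!: bcontfun_eqI simp: t_def algebra_simps)
    then have "norm (x - cscale t x) = (1 - r\<^sup>2) * norm x"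
      using r2 by (simp only: norm_cscale norm_of_real abs_of_nonneg diff_ge_0_iff_ge less_imp_le)
    also have "\<dots> \<le> (1 - r\<^sup>2) * 1" using r2 nx by (intro mult_left_mono) auto
    finally have "cmod (f x - f (cscale t x)) < e / 3"
      using d(2)[OF tx x] r by (simp add: dist_norm)
    moreover have "cmod (f (cscale t x) - (\<Sum>j<m. hom_part f j x * t ^ j)) \<le> M * r ^ m / (1 - r)"
      by (rule hom_part_remainder[OF hol M xc nx zero_less_one r(1)])
         (use r in \<open>auto simp: ct power2_eq_square\<close>)
    moreover have "cmod ((\<Sum>j<m. hom_part f j x * t ^ j) - p x) \<le> real m * (e / 3 / (real m + 1))"
    proof -
      have "(\<Sum>j<m. hom_part f j x * t ^ j) - p x =
          (\<Sum>j<m. (hom_part f j x - hom_part f j (trunc (n j) x)) * t ^ j)"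
        by (simp add: p_def t_def sum_subtractf left_diff_distrib)
      also have "cmod \<dots> \<le> (\<Sum>j<m. e / 3 / (real m + 1))"
      proof (rule order_trans[OF norm_sum sum_mono])
        fix j
        have "cmod ((hom_part f j x - hom_part f j (trunc (n j) x)) * t ^ j) \<le> e / 3 / (real m + 1) * 1"
          unfolding norm_mult norm_power ct
          using n[OF xc nx, of j] r2 e r by (intro mult_mono power_le_one) auto
        then show "cmod ((hom_part f j x - hom_part f j (trunc (n j) x)) * t ^ j) \<le> e / 3 / (real m + 1)" by simp
      qed
      finally show ?thesis by simp
    qed
    moreover have "real m * (e / 3 / (real m + 1)) \<le> e / 3" using e by (simp add: field_simps)
    moreover have "cmod (f x - p x) \<le> cmod (f x - f (cscale t x)) +
        cmod (f (cscale t x) - (\<Sum>j<m. hom_part f j x * t ^ j)) + cmod ((\<Sum>j<m. hom_part f j x * t ^ j) - p x)"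
      using norm_triangle_ineq[of "f x - f (cscale t x)" "f (cscale t x) - p x"]
        norm_triangle_ineq[of "f (cscale t x) - (\<Sum>j<m. hom_part f j x * t ^ j)" "(\<Sum>j<m. hom_part f j x * t ^ j) - p x"]
      by simp
    ultimately show ?thesis using m by linarith
  qed
  ultimately show ?thesis by blast
qed

subsection \<open>The algebra and the canonical extension\<close>

definition complex_subspace :: "linf set \<Rightarrow> bool" where
  "complex_subspace V \<longleftrightarrow> (\<forall>x\<in>V. \<forall>y\<in>V. x + y \<in> V) \<and> (\<forall>c. \<forall>x\<in>V. cscale c x \<in> V)"

lemma complex_subspace_c0: "complex_subspace c0"
  by (simp add: complex_subspace_def)

lemma complex_subspace_coord_space: "complex_subspace (coord_space k)"
  by (simp add: complex_subspace_def coord_space_def)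

lemma complex_subspaceD:
  assumes "complex_subspace V"
  shows "x \<in> V \<Longrightarrow> y \<in> V \<Longrightarrow> x - y \<in> V" "x \<in> V \<Longrightarrow> cscale c x \<in> V"
proof -
  have eq: "x - y = x + cscale (-1) y" by (auto intro!: bcontfun_eqI)
  show "x \<in> V \<Longrightarrow> y \<in> V \<Longrightarrow> x - y \<in> V" "x \<in> V \<Longrightarrow> cscale c x \<in> V"
    using assms unfolding eq complex_subspace_def by blast+
qed

definition frechet :: "linf set \<Rightarrow> (linf \<Rightarrow> complex) \<Rightarrow> linf \<Rightarrow> (linf \<Rightarrow> complex) \<Rightarrow> bool" where
  "frechet V f x L \<longleftrightarrow>
     (\<forall>u\<in>V. \<forall>v\<in>V. L (u + v) = L u + L v) \<and> (\<forall>c. \<forall>u\<in>V. L (cscale c u) = c * L u) \<and>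
     (\<exists>K. \<forall>u\<in>V. cmod (L u) \<le> K * norm u) \<and>
     (\<forall>e>0. \<exists>d>0. \<forall>y\<in>V. norm (y - x) < d \<longrightarrow> cmod (f y - f x - L (y - x)) \<le> e * norm (y - x))"

lemma frechetD:
  assumes "frechet V f x L"
  shows "\<And>u v. u \<in> V \<Longrightarrow> v \<in> V \<Longrightarrow> L (u + v) = L u + L v"
    and "\<And>u c. u \<in> V \<Longrightarrow> L (cscale c u) = c * L u"
    and "\<And>e. e > 0 \<Longrightarrow> \<exists>d>0. \<forall>y\<in>V. norm (y - x) < d \<longrightarrow> cmod (f y - f x - L (y - x)) \<le> e * norm (y - x)"
    and "\<exists>K\<ge>0. \<forall>u\<in>V. cmod (L u) \<le> K * norm u"
proof -
  obtain K where K: "\<forall>u\<in>V. cmod (L u) \<le> K * norm u"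
    using assms unfolding frechet_def by blast
  have "\<bar>K\<bar> \<ge> 0 \<and> (\<forall>u\<in>V. cmod (L u) \<le> \<bar>K\<bar> * norm u)"
    using K mult_right_mono[OF abs_ge_self[of K] norm_ge_zero] order_trans by fastforce
  then show "\<exists>K\<ge>0. \<forall>u\<in>V. cmod (L u) \<le> K * norm u" by blast
qed (use assms in \<open>simp_all add: frechet_def\<close>)

lemma holomorphic_on_ball_iff_frechet:
  assumes V: "complex_subspace V"
  shows "holomorphic_on_ball V f \<longleftrightarrow> (\<forall>x\<in>unit_ball V. \<exists>L. frechet V f x L)"
proof -
  have "((\<lambda>y. (f y - f x - L (y - x)) /\<^sub>R norm (y - x)) \<longlongrightarrow> 0) (at x within V) \<longleftrightarrow>
     (\<forall>e>0. \<exists>d>0. \<forall>y\<in>V. norm (y - x) < d \<longrightarrow> cmod (f y - f x - L (y - x)) \<le> e * norm (y - x))"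
    (is "?lhs \<longleftrightarrow> ?rhs")
    if x: "x \<in> V" and L: "\<And>c u. u \<in> V \<Longrightarrow> L (cscale c u) = c * L u" for x and L :: "linf \<Rightarrow> complex"
  proof
    have L0: "L (x - x) = 0" using L[OF x, of 0] by simp
    show ?rhs if ?lhs
    proof (intro allI impI)
      fix e :: real assume "e > 0"
      from \<open>?lhs\<close>[unfolded Lim_within, THEN spec, THEN mp, OF this] obtain d where d: "d > 0"
        "\<And>y. y \<in> V \<Longrightarrow> 0 < dist y x \<Longrightarrow> dist y x < d \<Longrightarrow> dist ((f y - f x - L (y - x)) /\<^sub>R norm (y - x)) 0 < e"
        by blast
      have "cmod (f y - f x - L (y - x)) \<le> e * norm (y - x)" if "y \<in> V" "norm (y - x) < d" for y
      proof (cases "y = x")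
        case False
        with d(2)[OF that(1)] that(2) have "cmod (f y - f x - L (y - x)) / norm (y - x) < e"
          by (simp add: dist_norm divide_inverse mult.commute)
        with False show ?thesis by (simp add: divide_less_eq)
      qed (use L0 in simp)
      with d(1) show "\<exists>d>0. \<forall>y\<in>V. norm (y - x) < d \<longrightarrow> cmod (f y - f x - L (y - x)) \<le> e * norm (y - x)"
        by blast
    qed
    show ?lhs if H: ?rhs
      unfolding Lim_within
    proof (intro allI impI)
      fix e :: real assume "e > 0"
      from H[rule_format, OF half_gt_zero[OF this]] obtain d where d: "d > 0"
        "\<And>y. y \<in> V \<Longrightarrow> norm (y - x) < d \<Longrightarrow> cmod (f y - f x - L (y - x)) \<le> e / 2 * norm (y - x)"
        by blast
      have "dist ((f y - f x - L (y - x)) /\<^sub>R norm (y - x)) 0 < e" if "y \<in> V" "0 < dist y x" "dist y x < d" for y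
      proof -
        have "cmod (f y - f x - L (y - x)) / norm (y - x) \<le> e / 2"
          using d(2)[OF that(1)] that by (simp add: dist_norm divide_le_eq)
        moreover have "dist ((f y - f x - L (y - x)) /\<^sub>R norm (y - x)) 0 = cmod (f y - f x - L (y - x)) / norm (y - x)"
          by (simp add: dist_norm divide_inverse mult.commute)
        ultimately show ?thesis using \<open>e > 0\<close> by linarith
      qed
      with d(1) show "\<exists>d>0. \<forall>y\<in>V. 0 < dist y x \<and> dist y x < d \<longrightarrow>
          dist ((f y - f x - L (y - x)) /\<^sub>R norm (y - x)) 0 < e" by blast
    qed
  qed
  then show ?thesis
    unfolding holomorphic_on_ball_def frechet_def
    by (intro ball_cong refl ex_cong1 conj_cong) (auto simp: unit_ball_iff)
qed

lemma frechet_cong: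
  assumes f: "frechet V f x L" and x: "x \<in> unit_ball V" and fg: "\<And>x. x \<in> unit_ball V \<Longrightarrow> f x = g x"
  shows "frechet V g x L"
proof -
  have "\<exists>d>0. \<forall>y\<in>V. norm (y - x) < d \<longrightarrow> cmod (g y - g x - L (y - x)) \<le> e * norm (y - x)"
    if e: "e > 0" for e
  proof -
    obtain d where d: "d > 0" "\<And>y. y \<in> V \<Longrightarrow> norm (y - x) < d \<Longrightarrow> cmod (f y - f x - L (y - x)) \<le> e * norm (y - x)"
      using frechetD(3)[OF f e] by blast
    have "f y = g y" if "y \<in> V" "norm (y - x) < 1 - norm x" for y
      using that norm_triangle_ineq2[of y x] by (intro fg) (auto simp: unit_ball_iff)
    then show ?thesis
      using d x fg[OF x] by (intro exI[of _ "min d (1 - norm x)"]) (simp add: unit_ball_iff, metis)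
  qed
  with f show ?thesis unfolding frechet_def by blast
qed

lemma frechet_add:
  assumes f: "frechet V f x L" and g: "frechet V g x L'"
  shows "frechet V (\<lambda>x. f x + g x) x (\<lambda>u. L u + L' u)"
  unfolding frechet_def
proof (intro conjI ballI allI impI)
  obtain K where "\<forall>u\<in>V. cmod (L u) \<le> K * norm u" using frechetD(4)[OF f] by blast
  moreover obtain K' where "\<forall>u\<in>V. cmod (L' u) \<le> K' * norm u" using frechetD(4)[OF g] by blast
  ultimately have "\<forall>u\<in>V. cmod (L u + L' u) \<le> (K + K') * norm u"
    by (auto intro!: norm_triangle_le add_mono simp: distrib_right)
  then show "\<exists>K. \<forall>u\<in>V. cmod (L u + L' u) \<le> K * norm u" ..
  fix e :: real assume "e > 0"
  then have e: "e / 2 > 0" by simp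
  obtain d where d: "d > 0" "\<And>y. y \<in> V \<Longrightarrow> norm (y - x) < d \<Longrightarrow> cmod (f y - f x - L (y - x)) \<le> e / 2 * norm (y - x)"
    using frechetD(3)[OF f e] by blast
  obtain d' where d': "d' > 0" "\<And>y. y \<in> V \<Longrightarrow> norm (y - x) < d' \<Longrightarrow> cmod (g y - g x - L' (y - x)) \<le> e / 2 * norm (y - x)"
    using frechetD(3)[OF g e] by blast
  have "cmod (f y + g y - (f x + g x) - (L (y - x) + L' (y - x))) \<le> e * norm (y - x)"
    if "y \<in> V" "norm (y - x) < min d d'" for y
  proof -
    have "f y + g y - (f x + g x) - (L (y - x) + L' (y - x)) = (f y - f x - L (y - x)) + (g y - g x - L' (y - x))"
      by simp
    also have "cmod \<dots> \<le> e / 2 * norm (y - x) + e / 2 * norm (y - x)"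
      using d(2)[of y] d'(2)[of y] that by (intro norm_triangle_le add_mono) auto
    finally show ?thesis by simp
  qed
  then show "\<exists>d>0. \<forall>y\<in>V. norm (y - x) < d \<longrightarrow>
      cmod (f y + g y - (f x + g x) - (L (y - x) + L' (y - x))) \<le> e * norm (y - x)"
    using d(1) d'(1) by (intro exI[of _ "min d d'"]) auto
qed (simp_all add: frechetD(1,2)[OF f] frechetD(1,2)[OF g] algebra_simps)

lemma frechet_compose:
  assumes V: "complex_subspace V" and x: "x \<in> V" and f: "frechet V f x L"
    and h: "(h has_field_derivative D) (at (f x))"
  shows "frechet V (\<lambda>x. h (f x)) x (\<lambda>u. D * L u)"
  unfolding frechet_def
proof (intro conjI ballI allI impI)
  obtain K where K: "K \<ge> 0" "\<And>u. u \<in> V \<Longrightarrow> cmod (L u) \<le> K * norm u" using frechetD(4)[OF f] by blast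
  have "\<forall>u\<in>V. cmod (D * L u) \<le> (cmod D * K) * norm u"
    using K(2) by (auto simp: norm_mult mult.assoc intro!: mult_left_mono)
  then show "\<exists>K. \<forall>u\<in>V. cmod (D * L u) \<le> K * norm u" ..
  fix e :: real assume e: "e > 0"
  \<comment> \<open>Each of the two errors gets \<open>e / 2\<close>: the outer one is at most
    \<open>e1 * (K + 1)\<close> and the inner one at most \<open>cmod D * e2\<close>, relative to
    \<open>norm (y - x)\<close>. The bound \<open>e2 \<le> 1\<close> makes \<open>K + 1\<close> a
    Lipschitz constant of \<open>f\<close> at \<open>x\<close>.\<close>
  define e1 where "e1 = e / (2 * (K + 1))"
  define e2 where "e2 = min 1 (e / (2 * (cmod D + 1)))"
  have e1: "e1 > 0" and e2: "e2 > 0" "e2 \<le> 1" using e K(1) by (auto simp: e1_def e2_def add_nonneg_pos)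
  obtain d1 where d1: "d1 > 0" "\<And>y. cmod (y - f x) < d1 \<Longrightarrow> cmod (h y - h (f x) - D * (y - f x)) \<le> e1 * cmod (y - f x)"
    using h e1 unfolding has_field_derivative_def has_derivative_at_alt by blast
  obtain d2 where d2: "d2 > 0" "\<And>y. y \<in> V \<Longrightarrow> norm (y - x) < d2 \<Longrightarrow> cmod (f y - f x - L (y - x)) \<le> e2 * norm (y - x)"
    using frechetD(3)[OF f e2(1)] by blast
  have "cmod (h (f y) - h (f x) - D * L (y - x)) \<le> e * norm (y - x)"
    if y: "y \<in> V" "norm (y - x) < min d2 (d1 / (K + 1))" for y
  proof -
    have a: "cmod (f y - f x - L (y - x)) \<le> e2 * norm (y - x)" using y by (intro d2(2)) auto
    have "cmod (f y - f x) \<le> cmod (f y - f x - L (y - x)) + cmod (L (y - x))"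
      using norm_triangle_ineq[of "f y - f x - L (y - x)" "L (y - x)"] by simp
    also have "\<dots> \<le> 1 * norm (y - x) + K * norm (y - x)"
      using a e2(2) K(2)[OF complex_subspaceD(1)[OF V y(1) x]]
      by (intro add_mono order_trans[OF a] mult_right_mono) auto
    finally have b: "cmod (f y - f x) \<le> (K + 1) * norm (y - x)" by (simp add: algebra_simps)
    have "(K + 1) * norm (y - x) < d1" using y(2) K(1) by (simp add: field_simps)
    with b have "cmod (h (f y) - h (f x) - D * (f y - f x)) \<le> e1 * cmod (f y - f x)" by (intro d1(2)) simp
    also have "\<dots> \<le> e1 * ((K + 1) * norm (y - x))" using e1 b by (intro mult_left_mono) auto
    also have "\<dots> = e / 2 * norm (y - x)" using K(1) by (simp add: e1_def field_simps)
    finally have c: "cmod (h (f y) - h (f x) - D * (f y - f x)) \<le> e / 2 * norm (y - x)" .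
    have "cmod (D * (f y - f x - L (y - x))) \<le> cmod D * (e / (2 * (cmod D + 1)) * norm (y - x))"
      unfolding norm_mult
      by (intro mult_left_mono order_trans[OF a] mult_right_mono) (auto simp: e2_def)
    also have "\<dots> = (cmod D / (cmod D + 1)) * (e / 2 * norm (y - x))" by simp
    also have "\<dots> \<le> 1 * (e / 2 * norm (y - x))"
      using e by (intro mult_right_mono) (auto simp: divide_le_eq add_nonneg_pos)
    finally have "cmod (D * (f y - f x - L (y - x))) \<le> e / 2 * norm (y - x)" by simp
    with c have "cmod ((h (f y) - h (f x) - D * (f y - f x)) + D * (f y - f x - L (y - x))) \<le>
        e / 2 * norm (y - x) + e / 2 * norm (y - x)"
      by (intro norm_triangle_le add_mono)
    then show ?thesis by (simp add: algebra_simps)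
  qed
  moreover have "min d2 (d1 / (K + 1)) > 0" using d1(1) d2(1) K(1) by simp
  ultimately show "\<exists>d>0. \<forall>y\<in>V. norm (y - x) < d \<longrightarrow> cmod (h (f y) - h (f x) - D * L (y - x)) \<le> e * norm (y - x)"
    by blast
qed (simp_all add: frechetD(1,2)[OF f] algebra_simps)

lemma frechet_coord: "frechet V (\<lambda>x. x n) x (\<lambda>u. u n)"
  unfolding frechet_def
proof (intro conjI allI impI)
  show "\<exists>K. \<forall>u\<in>V. cmod (apply_bcontfun u n) \<le> K * norm u"
    by (intro exI[of _ 1]) (auto intro: norm_bounded)
next
  fix e :: real assume "e > 0"
  then show "\<exists>d>0. \<forall>y\<in>V. norm (y - x) < d \<longrightarrow>
      cmod (apply_bcontfun y n - apply_bcontfun x n - apply_bcontfun (y - x) n) \<le> e * norm (y - x)"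
    by (intro exI[of _ 1]) simp
qed simp_all

lemma AuI:
  assumes V: "complex_subspace V"
    and "\<And>x. x \<in> unit_ball V \<Longrightarrow> \<exists>L. frechet V f x L" and uc: "uniformly_continuous_on (unit_ball V) f"
  shows "restrict f (unit_ball V) \<in> Au V"
proof -
  have "holomorphic_on_ball V (restrict f (unit_ball V))"
    unfolding holomorphic_on_ball_iff_frechet[OF V]
  proof
    fix x assume x: "x \<in> unit_ball V"
    with assms(2) obtain L where "frechet V f x L" by blast
    then have "frechet V (restrict f (unit_ball V)) x L" by (rule frechet_cong) (use x in auto)
    then show "\<exists>L. frechet V (restrict f (unit_ball V)) x L" by blast
  qed
  moreover have "uniformly_continuous_on (unit_ball V) (restrict f (unit_ball V))"
    using uc by (simp add: uniformly_continuous_on_def)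
  ultimately show ?thesis by (simp add: Au_def)
qed

lemma AuD:
  assumes "f \<in> Au V"
  shows "complex_subspace V \<Longrightarrow> x \<in> unit_ball V \<Longrightarrow> \<exists>L. frechet V f x L"
    and "uniformly_continuous_on (unit_ball V) f"
    and "restrict f (unit_ball V) = f"
    and "complex_subspace V \<Longrightarrow> \<exists>M. \<forall>x\<in>unit_ball V. cmod (f x) \<le> M"
proof -
  show uc: "uniformly_continuous_on (unit_ball V) f" and "restrict f (unit_ball V) = f"
    using assms by (auto simp: Au_def extensional_restrict)
  show "complex_subspace V \<Longrightarrow> x \<in> unit_ball V \<Longrightarrow> \<exists>L. frechet V f x L"
    using assms holomorphic_on_ball_iff_frechet[of V f] unfolding Au_def by blast
  show "\<exists>M. \<forall>x\<in>unit_ball V. cmod (f x) \<le> M" if W: "complex_subspace V"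
    by (rule uniformly_continuous_on_unit_ball_bounded[OF complex_subspaceD(2)[OF W] uc])
qed

lemma Au_add:
  assumes V: "complex_subspace V" and f: "f \<in> Au V" and g: "g \<in> Au V"
  shows "(\<lambda>x\<in>unit_ball V. f x + g x) \<in> Au V"
proof (rule AuI[OF V])
  show "\<exists>L. frechet V (\<lambda>x. f x + g x) x L" if "x \<in> unit_ball V" for x
    using AuD(1)[OF f V that] AuD(1)[OF g V that] frechet_add by blast
  show "uniformly_continuous_on (unit_ball V) (\<lambda>x. f x + g x)"
    by (intro uniformly_continuous_on_add AuD(2)[OF f] AuD(2)[OF g])
qed

lemma uniformly_continuous_on_mono:
  fixes f :: "'a::metric_space \<Rightarrow> 'b::metric_space"
  assumes "uniformly_continuous_on S f" "T \<subseteq> S"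
  shows "uniformly_continuous_on T f"
  using assms unfolding uniformly_continuous_on_def by (meson subsetD)

text \<open>The compact set \<open>K\<close> makes \<open>h\<close> uniformly continuous on the
  range of \<open>f\<close>, which holomorphy on the open set \<open>S\<close> alone would not
  give.\<close>

lemma Au_compose:
  assumes V: "complex_subspace V" and f: "f \<in> Au V"
    and K: "compact K" "\<And>x. x \<in> unit_ball V \<Longrightarrow> f x \<in> K"
    and h: "h holomorphic_on S" "open S" "K \<subseteq> S"
  shows "(\<lambda>x\<in>unit_ball V. h (f x)) \<in> Au V"
proof (rule AuI[OF V])
  fix x assume x: "x \<in> unit_ball V"
  then obtain L where L: "frechet V f x L" using AuD(1)[OF f V] by blast
  have "f x \<in> S" using K(2)[OF x] h(3) by blast
  then have "(h has_field_derivative deriv h (f x)) (at (f x))"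
    by (rule holomorphic_derivI[OF h(1,2)])
  then show "\<exists>L. frechet V (\<lambda>x. h (f x)) x L"
    using frechet_compose[OF V _ L] x by (auto simp: unit_ball_iff)
next
  have "uniformly_continuous_on K h"
    using h K(1) by (intro compact_uniformly_continuous) (auto intro: holomorphic_on_imp_continuous_on holomorphic_on_subset)
  then have "uniformly_continuous_on (f ` unit_ball V) h"
    by (rule uniformly_continuous_on_mono) (use K(2) in auto)
  from uniformly_continuous_on_compose[OF AuD(2)[OF f] this]
  show "uniformly_continuous_on (unit_ball V) (\<lambda>x. h (f x))" by (simp add: o_def)
qed

lemma Au_compose_entire:
  assumes V: "complex_subspace V" and f: "f \<in> Au V" and h: "h holomorphic_on UNIV"
  shows "(\<lambda>x\<in>unit_ball V. h (f x)) \<in> Au V"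
proof -
  obtain M where "\<forall>x\<in>unit_ball V. cmod (f x) \<le> M" using AuD(4)[OF f V] by blast
  then show ?thesis by (intro Au_compose[OF V f compact_cball[of 0 M] _ h]) auto
qed

lemma Au_cmult:
  assumes V: "complex_subspace V" and f: "f \<in> Au V"
  shows "(\<lambda>x\<in>unit_ball V. c * f x) \<in> Au V"
  by (rule Au_compose_entire[OF V f, of "\<lambda>s. c * s"]) (intro holomorphic_intros)

text \<open>Polarisation, \<open>f g = ((f + g)\<^sup>2 - (f - g)\<^sup>2) / 4\<close>, reduces
  products to sums and compositions with entire functions.\<close>

lemma Au_mult:
  assumes V: "complex_subspace V" and f: "f \<in> Au V" and g: "g \<in> Au V"
  shows "(\<lambda>x\<in>unit_ball V. f x * g x) \<in> Au V"
proof -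
  let ?U = "unit_ball V"
  let ?q = "\<lambda>s::complex. s\<^sup>2 / 4"
  have q: "?q holomorphic_on UNIV" "(\<lambda>s. - ?q s) holomorphic_on UNIV" by (intro holomorphic_intros; simp)+
  from Au_add[OF V Au_compose_entire[OF V Au_add[OF V f g] q(1)]
      Au_compose_entire[OF V Au_add[OF V f Au_cmult[OF V g, of "-1"]] q(2)]]
  have "(\<lambda>x\<in>?U. (\<lambda>x\<in>?U. ?q ((\<lambda>x\<in>?U. f x + g x) x)) x +
      (\<lambda>x\<in>?U. - ?q ((\<lambda>x\<in>?U. f x + (\<lambda>x\<in>?U. (-1) * g x) x) x)) x) \<in> Au V" .
  also have "(\<lambda>x\<in>?U. (\<lambda>x\<in>?U. ?q ((\<lambda>x\<in>?U. f x + g x) x)) x +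
      (\<lambda>x\<in>?U. - ?q ((\<lambda>x\<in>?U. f x + (\<lambda>x\<in>?U. (-1) * g x) x) x)) x) = (\<lambda>x\<in>?U. f x * g x)"
    by (rule restrict_ext) (simp add: power2_eq_square field_simps)
  finally show ?thesis .
qed

lemma Au_coord:
  assumes V: "complex_subspace V"
  shows "(\<lambda>x\<in>unit_ball V. apply_bcontfun x n) \<in> Au V"
proof (rule AuI[OF V])
  show "uniformly_continuous_on (unit_ball V) (\<lambda>x. apply_bcontfun x n)"
    unfolding uniformly_continuous_on_def
  proof (intro allI impI)
    fix e :: real assume "e > 0"
    then show "\<exists>d>0. \<forall>x\<in>unit_ball V. \<forall>y\<in>unit_ball V. dist y x < d \<longrightarrow>
        dist (apply_bcontfun y n) (apply_bcontfun x n) < e"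
      using order.strict_trans1[OF dist_bounded] by (intro exI[of _ e]) auto
  qed
qed (intro exI, rule frechet_coord)

lemma Au_const:
  assumes V: "complex_subspace V"
  shows "(\<lambda>x\<in>unit_ball V. c) \<in> Au V"
  using Au_compose_entire[OF V Au_coord[OF V, of 0], of "\<lambda>_. c"] by simp

lemma cpoly_in_Au:
  assumes V: "complex_subspace V" and p: "p \<in> cpoly"
  shows "restrict p (unit_ball V) \<in> Au V"
  using p
proof induction
  case (add p q)
  have "(\<lambda>x\<in>unit_ball V. restrict p (unit_ball V) x + restrict q (unit_ball V) x) =
      (\<lambda>x\<in>unit_ball V. p x + q x)" by (rule restrict_ext) simp
  with Au_add[OF V add.IH] show ?case by (simp only:)
next
  case (mult p q)
  have "(\<lambda>x\<in>unit_ball V. restrict p (unit_ball V) x * restrict q (unit_ball V) x) =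
      (\<lambda>x\<in>unit_ball V. p x * q x)" by (rule restrict_ext) simp
  with Au_mult[OF V mult.IH] show ?case by (simp only:)
qed (rule Au_const[OF V] Au_coord[OF V])+

lemma trunc_coord_space [simp]: "trunc k x \<in> coord_space k"
  by (simp add: coord_space_def)

lemma trunc_in_polydisc: "norm x < 1 \<Longrightarrow> trunc k x \<in> polydisc k"
  using norm_trunc_le[of k x] by (simp add: unit_ball_iff)

lemma trunc_id: "x \<in> coord_space k \<Longrightarrow> trunc k x = x"
  by (auto simp: coord_space_def intro!: bcontfun_eqI)

lemma trunc_diff: "trunc k (x - y) = trunc k x - trunc k y"
  by (auto intro!: bcontfun_eqI)

text \<open>Carries the algebra of the polydisc into the one over \<open>c0\<close>, so that the
  approximation theorem for \<open>c0\<close> serves both.\<close>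

lemma Au_coord_space_lift:
  assumes f: "f \<in> Au (coord_space k)"
  shows "(\<lambda>x\<in>unit_ball c0. f (trunc k x)) \<in> Au c0"
proof (rule AuI[OF complex_subspace_c0])
  fix x assume x: "x \<in> unit_ball c0"
  then have "trunc k x \<in> polydisc k" by (intro trunc_in_polydisc) (simp add: unit_ball_iff)
  then obtain L where L: "frechet (coord_space k) f (trunc k x) L"
    using AuD(1)[OF f complex_subspace_coord_space] by blast
  have "frechet c0 (\<lambda>x. f (trunc k x)) x (\<lambda>u. L (trunc k u))"
    unfolding frechet_def
  proof (intro conjI ballI allI impI)
    fix u v c
    have "trunc k (u + v) = trunc k u + trunc k v" "trunc k (cscale c u) = cscale c (trunc k u)"
      by (auto intro!: bcontfun_eqI)
    then show "L (trunc k (u + v)) = L (trunc k u) + L (trunc k v)" "L (trunc k (cscale c u)) = c * L (trunc k u)"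
      using frechetD(1,2)[OF L] by simp_all
  next
    obtain K where K: "K \<ge> 0" "\<And>u. u \<in> coord_space k \<Longrightarrow> cmod (L u) \<le> K * norm u" using frechetD(4)[OF L] by blast
    have "cmod (L (trunc k u)) \<le> K * norm u" for u
      by (rule order_trans[OF K(2) mult_left_mono[OF norm_trunc_le]]) (use K(1) in auto)
    then show "\<exists>K. \<forall>u\<in>c0. cmod (L (trunc k u)) \<le> K * norm u" by blast
  next
    fix e :: real assume e: "e > 0"
    from frechetD(3)[OF L e] obtain d where d: "d > 0"
      "\<And>y. y \<in> coord_space k \<Longrightarrow> norm (y - trunc k x) < d \<Longrightarrow>
         cmod (f y - f (trunc k x) - L (y - trunc k x)) \<le> e * norm (y - trunc k x)" by blast
    have "cmod (f (trunc k y) - f (trunc k x) - L (trunc k (y - x))) \<le> e * norm (y - x)"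
      if "norm (y - x) < d" for y
    proof -
      have le: "norm (trunc k y - trunc k x) \<le> norm (y - x)"
        using norm_trunc_le[of k "y - x"] by (simp only: trunc_diff)
      with that have "cmod (f (trunc k y) - f (trunc k x) - L (trunc k y - trunc k x)) \<le> e * norm (trunc k y - trunc k x)"
        by (intro d(2)) auto
      also have "\<dots> \<le> e * norm (y - x)" using le e by (intro mult_left_mono) auto
      finally show ?thesis by (simp only: trunc_diff)
    qed
    then show "\<exists>d>0. \<forall>y\<in>c0. norm (y - x) < d \<longrightarrow>
        cmod (f (trunc k y) - f (trunc k x) - L (trunc k (y - x))) \<le> e * norm (y - x)"
      using d(1) by blast
  qed
  then show "\<exists>L. frechet c0 (\<lambda>x. f (trunc k x)) x L" by blast
next
  have "uniformly_continuous_on (unit_ball c0) (trunc k)"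
    unfolding uniformly_continuous_on_def
  proof (intro allI impI)
    fix e :: real assume "e > 0"
    moreover have "dist (trunc k x) (trunc k y) \<le> dist x y" for x y
      using norm_trunc_le[of k "x - y"] by (simp only: trunc_diff dist_norm)
    ultimately show "\<exists>d>0. \<forall>x\<in>unit_ball c0. \<forall>y\<in>unit_ball c0. dist y x < d \<longrightarrow> dist (trunc k y) (trunc k x) < e"
      by (intro exI[of _ e]) (auto intro: order.strict_trans1)
  qed
  moreover have "uniformly_continuous_on (trunc k ` unit_ball c0) f"
    by (rule uniformly_continuous_on_mono[OF AuD(2)[OF f]])
       (auto intro!: trunc_in_polydisc simp: unit_ball_iff simp del: trunc_coord_space)
  ultimately show "uniformly_continuous_on (unit_ball c0) (\<lambda>x. f (trunc k x))"
    using uniformly_continuous_on_compose by (fastforce simp: o_def)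
qed

text \<open>Truncation moves a point of the closed bidual ball into \<open>c0\<close>; the factor
  tending to 1 moves it into the open ball, since truncation alone may leave the norm equal to
  1.\<close>

definition approx :: "nat \<Rightarrow> linf \<Rightarrow> linf" where
  "approx n z = cscale (of_real (1 - 1 / real (Suc n))) (trunc n z)"

lemma approx_in_unit_ball:
  assumes "z \<in> cball 0 1"
  shows "approx n z \<in> unit_ball c0"
proof -
  have "norm (approx n z) = (1 - 1 / real (Suc n)) * norm (trunc n z)"
    unfolding approx_def norm_cscale norm_of_real by simp
  also have "\<dots> \<le> (1 - 1 / real (Suc n)) * 1"
    using assms norm_trunc_le[of n z] by (intro mult_left_mono) auto
  also have "\<dots> < 1" by simp
  finally have "norm (approx n z) < 1" .
  moreover have "approx n z \<in> c0" by (simp add: approx_def)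
  ultimately show ?thesis by (simp add: unit_ball_iff)
qed

lemma approx_coeff_tendsto: "(\<lambda>n. complex_of_real (1 - 1 / real (Suc n))) \<longlonglongrightarrow> 1"
proof -
  have "(\<lambda>n. 1 - 1 / real (Suc n)) \<longlonglongrightarrow> 1 - 0"
    by (intro tendsto_intros LIMSEQ_Suc[OF lim_inverse_n'])
  from tendsto_of_real[OF this] show ?thesis unfolding diff_0_right of_real_1 .
qed

lemma cpoly_approx_tendsto: "p \<in> cpoly \<Longrightarrow> (\<lambda>n. p (approx n z)) \<longlonglongrightarrow> p z"
proof (induction rule: cpoly.induct)
  case (coord k)
  have "(\<lambda>n. trunc n z k) \<longlonglongrightarrow> z k"
    by (intro tendsto_eventually eventually_at_top_linorderI[of "Suc k"]) auto
  from tendsto_mult[OF approx_coeff_tendsto this] show ?case by (simp add: approx_def)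
qed (intro tendsto_intros; assumption)+

lemma cpoly_bound_cball:
  assumes "p \<in> cpoly" "\<And>x. x \<in> unit_ball c0 \<Longrightarrow> cmod (p x) \<le> M" "z \<in> cball 0 1"
  shows "cmod (p z) \<le> M"
  by (rule LIMSEQ_le_const2[OF tendsto_norm[OF cpoly_approx_tendsto[OF assms(1)]]])
     (use assms(2,3) approx_in_unit_ball in blast)

lemma Au_approx_convergent:
  assumes f: "f \<in> Au c0" and z: "z \<in> cball 0 1"
  shows "convergent (\<lambda>n. f (approx n z))"
  unfolding Cauchy_convergent_iff[symmetric]
proof (rule metric_CauchyI)
  fix e :: real assume e: "e > 0"
  then obtain p where p: "p \<in> cpoly" "\<And>x. x \<in> unit_ball c0 \<Longrightarrow> cmod (f x - p x) < e / 3"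
    using Au_cpoly_approx[OF f, of "e / 3"] by auto
  obtain N where N: "\<And>m n. m \<ge> N \<Longrightarrow> n \<ge> N \<Longrightarrow> dist (p (approx m z)) (p (approx n z)) < e / 3"
    using metric_CauchyD[OF LIMSEQ_imp_Cauchy[OF cpoly_approx_tendsto[OF p(1), of z]], of "e / 3"] e by auto
  have "dist (f (approx m z)) (f (approx n z)) < e" if "m \<ge> N" "n \<ge> N" for m n
    using N[OF that] p(2)[OF approx_in_unit_ball[OF z], of m] p(2)[OF approx_in_unit_ball[OF z], of n]
      norm_triangle_ineq[of "f (approx m z) - p (approx m z)" "p (approx m z) - p (approx n z)"]
      norm_triangle_ineq4[of "f (approx m z) - p (approx n z)" "f (approx n z) - p (approx n z)"]
    by (simp add: dist_norm)
  then show "\<exists>M. \<forall>m\<ge>M. \<forall>n\<ge>M. dist (f (approx m z)) (f (approx n z)) < e" by blast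
qed

text \<open>A limit along one explicit sequence, which makes the algebraic rules immediate.
  Weak-star continuity, and with it agreement with \<open>canonical_ext\<close>, is established
  afterwards.\<close>

definition ext :: "(linf \<Rightarrow> complex) \<Rightarrow> linf \<Rightarrow> complex" where
  "ext f z = lim (\<lambda>n. f (approx n z))"

lemma ext_tendsto: "f \<in> Au c0 \<Longrightarrow> z \<in> cball 0 1 \<Longrightarrow> (\<lambda>n. f (approx n z)) \<longlonglongrightarrow> ext f z"
  unfolding ext_def using Au_approx_convergent convergent_LIMSEQ_iff by blast

text \<open>Transfers approximation from the ball of \<open>c0\<close> to the closed bidual ball,
  where polynomials are known explicitly.\<close>

lemma ext_minus_cpoly_le:
  assumes f: "f \<in> Au c0" and p: "p \<in> cpoly" and le: "\<And>x. x \<in> unit_ball c0 \<Longrightarrow> cmod (f x - p x) \<le> e"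
    and z: "z \<in> cball 0 1"
  shows "cmod (ext f z - p z) \<le> e"
  by (rule LIMSEQ_le_const2[OF tendsto_norm[OF tendsto_diff[OF ext_tendsto[OF f z] cpoly_approx_tendsto[OF p]]]])
     (use le approx_in_unit_ball[OF z] in blast)

lemma ext_eq_on_unit_ball:
  assumes f: "f \<in> Au c0" and x: "x \<in> unit_ball c0"
  shows "ext f x = f x"
proof -
  have "cmod (ext f x - f x) \<le> 0 + e" if e: "e > 0" for e
  proof -
    obtain p where p: "p \<in> cpoly" "\<And>x. x \<in> unit_ball c0 \<Longrightarrow> cmod (f x - p x) < e / 2"
      using Au_cpoly_approx[OF f, of "e / 2"] half_gt_zero[OF e] by blast
    have "cmod (ext f x - p x) \<le> e / 2"
      by (rule ext_minus_cpoly_le[OF f p(1)]) (use p(2) x in \<open>auto simp: unit_ball_iff intro: less_imp_le\<close>)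
    then show ?thesis
      using p(2)[OF x] norm_triangle_ineq4[of "ext f x - p x" "f x - p x"] by simp
  qed
  then have "cmod (ext f x - f x) \<le> 0" by (rule field_le_epsilon)
  then show ?thesis by simp
qed

section \<open>Weak-star continuity and uniqueness of the extension\<close>

lemma topspace_weak_star [simp]: "topspace weak_star = UNIV"
proof -
  have "x \<in> topspace weak_star" for x
    unfolding weak_star_def topology_generated_by_topspace
    by (rule UnionI[of UNIV]) (auto intro!: exI[of _ "\<lambda>_. 0"] exI[of _ UNIV])
  then show ?thesis by blast
qed

lemma continuous_map_euclidean_iff:
  "continuous_map X euclidean f \<longleftrightarrow> (\<forall>x\<in>topspace X. (f \<longlongrightarrow> f x) (atin X x))"
  by (simp add: continuous_map_atin)

lemma continuous_map_coord: "continuous_map weak_star euclidean (\<lambda>x. apply_bcontfun x n)"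
proof -
  have "openin weak_star {x :: linf. x n \<in> U}" if "open U" for U
  proof -
    let ?y = "\<lambda>k. if k = n then 1 else 0 :: complex"
    have "(\<Sum>k. x k * ?y k) = x n" for x :: linf
      by (subst suminf_finite[of "{n}"]) auto
    then have "{x :: linf. x n \<in> U} = {x :: linf. (\<Sum>k. x k * ?y k) \<in> U}" by simp
    moreover have "summable (\<lambda>k. cmod (?y k))" by (rule summable_finite[of "{n}"]) auto
    ultimately have "{x :: linf. x n \<in> U} \<in>
        {{x :: linf. (\<Sum>n. x n * y n) \<in> U} | y U. summable (\<lambda>n. cmod (y n)) \<and> open U}"
      using that by (intro CollectI exI[of _ ?y] exI[of _ U]) simp
    then show ?thesis
      unfolding weak_star_def by (rule topology_generated_by_Basis)
  qed
  then show ?thesis by (auto simp: continuous_map_def)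
qed

lemma continuous_map_cpoly: "p \<in> cpoly \<Longrightarrow> continuous_map weak_star euclidean p"
proof (induction rule: cpoly.induct)
  case (coord n)
  show ?case by (rule continuous_map_coord)
qed (auto simp: continuous_map_euclidean_iff intro: tendsto_intros)

lemma continuous_map_ext:
  assumes f: "f \<in> Au c0"
  shows "continuous_map (subtopology weak_star (cball 0 1)) euclidean (ext f)"
  unfolding continuous_map_euclidean_iff
proof
  fix z assume "z \<in> topspace (subtopology weak_star (cball 0 1))"
  then have z: "z \<in> cball 0 1" by simp
  let ?F = "atin (subtopology weak_star (cball 0 1)) z"
  show "(ext f \<longlongrightarrow> ext f z) ?F"
    unfolding tendsto_iff
  proof (intro allI impI)
    fix e :: real assume e: "e > 0"
    then obtain p where p: "p \<in> cpoly" "\<And>x. x \<in> unit_ball c0 \<Longrightarrow> cmod (f x - p x) < e / 3"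
      using Au_cpoly_approx[OF f, of "e / 3"] by auto
    have le: "cmod (ext f x - p x) \<le> e / 3" if "x \<in> cball 0 1" for x
      by (rule ext_minus_cpoly_le[OF f p(1)]) (use p(2) that in \<open>auto intro: less_imp_le\<close>)
    have "(p \<longlongrightarrow> p z) ?F"
      using continuous_map_from_subtopology[OF continuous_map_cpoly[OF p(1)], of "cball 0 1"] z
      by (simp add: continuous_map_euclidean_iff)
    then have "\<forall>\<^sub>F x in ?F. dist (p x) (p z) < e / 3"
      using e by (intro tendstoD) auto
    moreover have "\<forall>\<^sub>F x in ?F. x \<in> cball 0 1"
      unfolding eventually_atin using z
      by (intro disjI2 exI[of _ "cball 0 1"]) (auto simp: openin_subtopology_refl)
    ultimately show "\<forall>\<^sub>F x in ?F. dist (ext f x) (ext f z) < e"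
    proof eventually_elim
      case (elim x)
      then show ?case
        using le[OF elim(2)] le[OF z] norm_triangle_ineq[of "ext f x - p x" "p x - p z"]
          norm_triangle_ineq4[of "ext f x - p z" "ext f z - p z"]
        by (simp add: dist_norm)
    qed
  qed
qed

lemma approx_weak_star_tendsto:
  assumes y: "summable (\<lambda>k. cmod (y k))"
  shows "(\<lambda>n. \<Sum>k. approx n z k * y k) \<longlonglongrightarrow> (\<Sum>k. z k * y k)"
proof -
  have s: "summable (\<lambda>k. z k * y k)"
    by (rule summable_norm_cancel, rule summable_comparison_test[OF _ summable_mult[OF y, of "norm z"]])
       (auto simp: norm_mult intro!: exI[of _ 0] mult_right_mono norm_bounded)
  have "(\<lambda>n. complex_of_real (1 - 1 / real (Suc n)) * (\<Sum>k<n. z k * y k)) \<longlonglongrightarrow> 1 * (\<Sum>k. z k * y k)"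
    by (intro tendsto_mult approx_coeff_tendsto summable_LIMSEQ[OF s])
  moreover have "(\<Sum>k. approx n z k * y k) = complex_of_real (1 - 1 / real (Suc n)) * (\<Sum>k<n. z k * y k)" for n
    by (subst suminf_finite[of "{..<n}"]) (auto simp: approx_def sum_distrib_left mult.assoc)
  ultimately show ?thesis by simp
qed

text \<open>This density makes the extension unique. The induction follows the generation of the
  open sets and shows that each one around \<open>z\<close> eventually contains
  \<open>approx n z\<close>.\<close>

lemma unit_ball_weak_star_dense:
  assumes z: "z \<in> cball 0 1"
  shows "z \<in> (subtopology weak_star (cball 0 1)) closure_of (unit_ball c0)"
proof -
  have ev: "\<forall>\<^sub>F n in sequentially. approx n z \<in> U" if "openin weak_star U" "z \<in> U" for U
  proof -
    from that(1) have "generate_topology_on {{x :: linf. (\<Sum>n. x n * y n) \<in> U} | y U. summable (\<lambda>n. cmod (y n)) \<and> open U} U"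
      unfolding weak_star_def by (rule openin_topology_generated_by)
    then have "z \<in> U \<longrightarrow> (\<forall>\<^sub>F n in sequentially. approx n z \<in> U)"
    proof induction
      case (Int a b)
      then show ?case by (auto intro: eventually_conj)
    next
      case (UN K)
      show ?case
      proof
        assume "z \<in> \<Union>K"
        then obtain k where k: "k \<in> K" "z \<in> k" by blast
        with UN have "\<forall>\<^sub>F n in sequentially. approx n z \<in> k" by blast
        then show "\<forall>\<^sub>F n in sequentially. approx n z \<in> \<Union>K" by eventually_elim (use k in blast)
      qed
    next
      case (Basis s)
      then obtain y U where s: "s = {x :: linf. (\<Sum>n. x n * y n) \<in> U}" "summable (\<lambda>n. cmod (y n))" "open U" by blast
      show ?case
        using topological_tendstoD[OF approx_weak_star_tendsto[OF s(2), of z] s(3)] by (auto simp: s(1))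
    qed auto
    with that(2) show ?thesis by blast
  qed
  show ?thesis
    unfolding in_closure_of
  proof (intro conjI allI impI)
    show "z \<in> topspace (subtopology weak_star (cball 0 1))" using z by simp
    fix T assume T: "z \<in> T \<and> openin (subtopology weak_star (cball 0 1)) T"
    then obtain U where U: "openin weak_star U" "T = U \<inter> cball 0 1" by (auto simp: openin_subtopology)
    obtain n where "approx n z \<in> U"
      using ev[OF U(1)] T U(2) by (auto dest: eventually_happens)
    moreover have "approx n z \<in> unit_ball c0" by (rule approx_in_unit_ball[OF z])
    ultimately show "\<exists>y. y \<in> unit_ball c0 \<and> y \<in> T"
      using U(2) by (auto simp: unit_ball_iff intro!: exI[of _ "approx n z"])
  qed
qed

lemma canonical_ext_eq:
  assumes f: "f \<in> Au c0" and z: "z \<in> cball 0 1"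
  shows "canonical_ext f z = ext f z"
proof -
  let ?X = "subtopology weak_star (cball 0 1)"
  define P where "P g \<longleftrightarrow> g \<in> extensional (cball 0 1) \<and> (\<forall>x\<in>unit_ball c0. g x = f x) \<and>
     continuous_map ?X euclidean g" for g
  have "P (restrict (ext f) (cball 0 1))"
    unfolding P_def
    using ext_eq_on_unit_ball[OF f] continuous_map_eq[OF continuous_map_ext[OF f], of "restrict (ext f) (cball 0 1)"]
    by (auto simp: unit_ball_iff)
  moreover have "g = restrict (ext f) (cball 0 1)" if "P g" for g
  proof (rule extensionalityI[of _ "cball 0 1"])
    fix x :: linf assume x: "x \<in> cball 0 1"
    have "g x = ext f x"
    proof (rule forall_in_closure_of_eq[OF unit_ball_weak_star_dense[OF x]])
      show "continuous_map ?X euclidean g" using that by (simp add: P_def)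
      show "continuous_map ?X euclidean (ext f)" by (rule continuous_map_ext[OF f])
      show "g y = ext f y" if "y \<in> unit_ball c0" for y
        using \<open>P g\<close> that ext_eq_on_unit_ball[OF f that] by (simp add: P_def)
    qed (rule Hausdorff_space_euclidean)
    with x show "g x = restrict (ext f) (cball 0 1) x" by simp
  qed (use that in \<open>auto simp: P_def\<close>)
  ultimately have "(THE g. P g) = restrict (ext f) (cball 0 1)" by (rule the_equality)
  then have "canonical_ext f = restrict (ext f) (cball 0 1)"
    unfolding canonical_ext_def P_def .
  with z show ?thesis by simp
qed

subsection \<open>Characters and Gleason parts\<close>

lemma delta_apply:
  assumes "f \<in> Au c0" "z \<in> cball 0 1"
  shows "delta z f = ext f z"
  using assms by (simp add: delta_def canonical_ext_eq)

lemma ext_eqI: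
  assumes f: "f \<in> Au c0" and z: "z \<in> cball 0 1" and lim: "(\<lambda>n. f (approx n z)) \<longlonglongrightarrow> l"
  shows "ext f z = l"
  using LIMSEQ_unique[OF ext_tendsto[OF f z] lim] .

lemma ext_add:
  assumes f: "f \<in> Au c0" and g: "g \<in> Au c0" and z: "z \<in> cball 0 1"
  shows "ext (\<lambda>x\<in>unit_ball c0. f x + g x) z = ext f z + ext g z"
  by (rule ext_eqI[OF Au_add[OF complex_subspace_c0 f g] z])
     (simp add: approx_in_unit_ball[OF z] tendsto_add[OF ext_tendsto[OF f z] ext_tendsto[OF g z]])

lemma ext_mult:
  assumes f: "f \<in> Au c0" and g: "g \<in> Au c0" and z: "z \<in> cball 0 1"
  shows "ext (\<lambda>x\<in>unit_ball c0. f x * g x) z = ext f z * ext g z"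
  by (rule ext_eqI[OF Au_mult[OF complex_subspace_c0 f g] z])
     (simp add: approx_in_unit_ball[OF z] tendsto_mult[OF ext_tendsto[OF f z] ext_tendsto[OF g z]])

lemma ext_cmult:
  assumes f: "f \<in> Au c0" and z: "z \<in> cball 0 1"
  shows "ext (\<lambda>x\<in>unit_ball c0. c * f x) z = c * ext f z"
  by (rule ext_eqI[OF Au_cmult[OF complex_subspace_c0 f] z])
     (simp add: approx_in_unit_ball[OF z] tendsto_mult[OF tendsto_const ext_tendsto[OF f z]])

lemma ext_cpoly:
  assumes p: "p \<in> cpoly" and z: "z \<in> cball 0 1"
  shows "ext (restrict p (unit_ball c0)) z = p z"
  by (rule ext_eqI[OF cpoly_in_Au[OF complex_subspace_c0 p] z])
     (simp add: approx_in_unit_ball[OF z] cpoly_approx_tendsto[OF p])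

lemma ext_norm_le:
  assumes f: "f \<in> Au c0" and z: "z \<in> cball 0 1" and le: "\<And>x. x \<in> unit_ball c0 \<Longrightarrow> cmod (f x) \<le> M"
  shows "cmod (ext f z) \<le> M"
  by (rule LIMSEQ_le_const2[OF tendsto_norm[OF ext_tendsto[OF f z]]])
     (use le approx_in_unit_ball[OF z] in blast)

text \<open>The source of test functions for lower bounds on \<open>gleason_rho\<close>. Holomorphy
  on a neighbourhood of the closed disc allows evaluation also where
  \<open>|z n| = 1\<close>.\<close>

lemma coord_holomorphic_in_Au:
  fixes z :: linf
  assumes h: "h holomorphic_on S" "open S" "cball 0 1 \<subseteq> S"
  shows "(\<lambda>x\<in>unit_ball c0. h (apply_bcontfun x n)) \<in> Au c0"
    and "z \<in> cball 0 1 \<Longrightarrow> ext (\<lambda>x\<in>unit_ball c0. h (apply_bcontfun x n)) z = h (z n)"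
proof -
  have "(\<lambda>x\<in>unit_ball c0. h ((\<lambda>x\<in>unit_ball c0. apply_bcontfun x n) x)) \<in> Au c0"
  proof (rule Au_compose[OF complex_subspace_c0 Au_coord[OF complex_subspace_c0] compact_cball[of 0 1] _ h])
    fix x assume "x \<in> unit_ball c0"
    then show "(\<lambda>x\<in>unit_ball c0. apply_bcontfun x n) x \<in> cball 0 1"
      using norm_bounded[of x n] by (simp add: unit_ball_iff)
  qed
  moreover have "(\<lambda>x\<in>unit_ball c0. h ((\<lambda>x\<in>unit_ball c0. apply_bcontfun x n) x)) =
      (\<lambda>x\<in>unit_ball c0. h (apply_bcontfun x n))"
    by (rule restrict_ext) simp
  ultimately show A: "(\<lambda>x\<in>unit_ball c0. h (apply_bcontfun x n)) \<in> Au c0" by (simp only:)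
  show "ext (\<lambda>x\<in>unit_ball c0. h (apply_bcontfun x n)) z = h (z n)" if z: "z \<in> cball 0 1"
  proof (rule ext_eqI[OF A z])
    have "cmod (z n) \<le> 1" using norm_bounded[of z n] z by simp
    then have "z n \<in> S" using h(3) by auto
    then have "isCont h (z n)"
      using h(1,2) holomorphic_on_imp_continuous_on continuous_on_eq_continuous_at by blast
    then have "(\<lambda>k. h (approx k z n)) \<longlonglongrightarrow> h (z n)"
      by (rule isCont_tendsto_compose[OF _ cpoly_approx_tendsto[OF cpoly.coord]])
    then show "(\<lambda>k. (\<lambda>x\<in>unit_ball c0. h (apply_bcontfun x n)) (approx k z)) \<longlonglongrightarrow> h (z n)"
      by (simp add: approx_in_unit_ball[OF z])
  qed
qed

lemma delta_inj:
  fixes z w :: linf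
  assumes "z \<in> cball 0 1" "w \<in> cball 0 1" "delta z = delta w"
  shows "z = w"
proof (rule bcontfun_eqI)
  fix n
  have "restrict (\<lambda>x. apply_bcontfun x n) (unit_ball c0) \<in> Au c0"
    by (rule cpoly_in_Au[OF complex_subspace_c0 cpoly.coord])
  from delta_apply[OF this assms(1)] delta_apply[OF this assms(2)]
  show "z n = w n" using assms ext_cpoly[OF cpoly.coord, of _ n] by simp
qed

lemma delta_in_characters:
  assumes z: "z \<in> cball 0 1"
  shows "delta z \<in> characters (unit_ball c0) (Au c0)"
  unfolding characters_def
proof (intro CollectI conjI ballI allI)
  show "delta z \<in> extensional (Au c0)" by (simp add: delta_def)
  have "delta z (\<lambda>x\<in>unit_ball c0. 1) = 1"
    using delta_apply[OF cpoly_in_Au[OF complex_subspace_c0 cpoly.const] z, of 1] ext_cpoly[OF cpoly.const z, of 1]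
    by simp
  then show "\<exists>f\<in>Au c0. delta z f \<noteq> 0"
    by (intro bexI[of _ "\<lambda>x\<in>unit_ball c0. 1"] Au_const[OF complex_subspace_c0]) simp
  fix f g c assume f: "f \<in> Au c0"
  show "delta z (\<lambda>x\<in>unit_ball c0. c * f x) = c * delta z f"
    by (simp add: delta_apply[OF Au_cmult[OF complex_subspace_c0 f] z] delta_apply[OF f z] ext_cmult[OF f z]
        del: restrict_apply)
  assume g: "g \<in> Au c0"
  show "delta z (\<lambda>x\<in>unit_ball c0. f x + g x) = delta z f + delta z g"
    by (simp add: delta_apply[OF Au_add[OF complex_subspace_c0 f g] z] delta_apply[OF f z] delta_apply[OF g z]
        ext_add[OF f g z] del: restrict_apply)
  show "delta z (\<lambda>x\<in>unit_ball c0. f x * g x) = delta z f * delta z g"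
    by (simp add: delta_apply[OF Au_mult[OF complex_subspace_c0 f g] z] delta_apply[OF f z] delta_apply[OF g z]
        ext_mult[OF f g z] del: restrict_apply)
qed

lemma characterD:
  assumes "\<psi> \<in> characters (unit_ball V) (Au V)"
  shows "\<And>f g. f \<in> Au V \<Longrightarrow> g \<in> Au V \<Longrightarrow> \<psi> (\<lambda>x\<in>unit_ball V. f x + g x) = \<psi> f + \<psi> g"
    and "\<And>c f. f \<in> Au V \<Longrightarrow> \<psi> (\<lambda>x\<in>unit_ball V. c * f x) = c * \<psi> f"
    and "\<And>f g. f \<in> Au V \<Longrightarrow> g \<in> Au V \<Longrightarrow> \<psi> (\<lambda>x\<in>unit_ball V. f x * g x) = \<psi> f * \<psi> g"
    and "complex_subspace V \<Longrightarrow> \<psi> (\<lambda>x\<in>unit_ball V. c) = c"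
proof -
  show mult: "\<And>f g. f \<in> Au V \<Longrightarrow> g \<in> Au V \<Longrightarrow> \<psi> (\<lambda>x\<in>unit_ball V. f x * g x) = \<psi> f * \<psi> g"
    and cmult: "\<And>c f. f \<in> Au V \<Longrightarrow> \<psi> (\<lambda>x\<in>unit_ball V. c * f x) = c * \<psi> f"
    and "\<And>f g. f \<in> Au V \<Longrightarrow> g \<in> Au V \<Longrightarrow> \<psi> (\<lambda>x\<in>unit_ball V. f x + g x) = \<psi> f + \<psi> g"
    using assms unfolding characters_def by blast+
  assume V: "complex_subspace V"
  obtain f where f: "f \<in> Au V" "\<psi> f \<noteq> 0" using assms unfolding characters_def by blast
  have "(\<lambda>x\<in>unit_ball V. (\<lambda>x\<in>unit_ball V. 1) x * f x) = restrict f (unit_ball V)"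
    by (rule restrict_ext) simp
  also have "\<dots> = f" by (rule AuD(3)[OF f(1)])
  finally have "\<psi> (\<lambda>x\<in>unit_ball V. 1) * \<psi> f = \<psi> f"
    using mult[OF Au_const[OF V] f(1), of 1] by (simp only:)
  with f(2) have one: "\<psi> (\<lambda>x\<in>unit_ball V. 1) = 1" by simp
  have "(\<lambda>x\<in>unit_ball V. c * (\<lambda>x\<in>unit_ball V. 1) x) = (\<lambda>x\<in>unit_ball V. c)"
    by (rule restrict_ext) simp
  then show "\<psi> (\<lambda>x\<in>unit_ball V. c) = c"
    using cmult[OF Au_const[OF V], of c 1] one by (simp only: mult_1_right)
qed

text \<open>If \<open>|\<psi> f| > M\<close>, then \<open>1 - f / \<psi> f\<close> has an inverse in
  the algebra, namely \<open>h\<close> composed with \<open>f\<close>, while \<open>\<psi>\<close>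
  sends it to 0.\<close>

lemma character_contractive:
  assumes V: "complex_subspace V" and \<psi>: "\<psi> \<in> characters (unit_ball V) (Au V)"
    and f: "f \<in> Au V" and le: "\<And>x. x \<in> unit_ball V \<Longrightarrow> cmod (f x) \<le> M" and M: "M \<ge> 0"
  shows "cmod (\<psi> f) \<le> M"
proof (rule ccontr)
  assume "\<not> ?thesis"
  then have c: "cmod (\<psi> f) > M" by simp
  define h where "h s = 1 / (1 - s / \<psi> f)" for s
  have c0: "\<psi> f \<noteq> 0" using c M by auto
  have ne: "1 - s / \<psi> f \<noteq> 0" if "cmod s < cmod (\<psi> f)" for s
    using that c0 by (auto simp: divide_eq_1_iff)
  have A: "(\<lambda>x\<in>unit_ball V. h (f x)) \<in> Au V"
  proof (rule Au_compose[OF V f compact_cball[of 0 M]])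
    show "h holomorphic_on ball 0 (cmod (\<psi> f))"
      unfolding h_def using ne c0 by (intro holomorphic_intros) auto
  qed (use le c in auto)
  have B: "(\<lambda>x\<in>unit_ball V. 1 + (\<lambda>x\<in>unit_ball V. (- 1 / \<psi> f) * f x) x) \<in> Au V"
    using Au_add[OF V Au_const[OF V, of 1] Au_cmult[OF V f, of "- 1 / \<psi> f"]]
    by (simp cong: restrict_cong)
  have Bv: "\<psi> (\<lambda>x\<in>unit_ball V. (\<lambda>x\<in>unit_ball V. 1) x + (\<lambda>x\<in>unit_ball V. (- 1 / \<psi> f) * f x) x) = 0"
    unfolding characterD(1)[OF \<psi> Au_const[OF V] Au_cmult[OF V f]]
      characterD(2)[OF \<psi> f] characterD(4)[OF \<psi> V] using c0 by simp
  have "(\<lambda>x\<in>unit_ball V. (\<lambda>x\<in>unit_ball V. h (f x)) x *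
      (\<lambda>x\<in>unit_ball V. (\<lambda>x\<in>unit_ball V. 1) x + (\<lambda>x\<in>unit_ball V. (- 1 / \<psi> f) * f x) x) x)
      = (\<lambda>x\<in>unit_ball V. 1)"
  proof (rule restrict_ext)
    fix x assume x: "x \<in> unit_ball V"
    have "1 - f x / \<psi> f \<noteq> 0" using ne[of "f x"] le[OF x] c by simp
    with x show "(\<lambda>x\<in>unit_ball V. h (f x)) x *
      (\<lambda>x\<in>unit_ball V. (\<lambda>x\<in>unit_ball V. 1) x + (\<lambda>x\<in>unit_ball V. (- 1 / \<psi> f) * f x) x) x = 1"
      by (simp add: h_def)
  qed
  from arg_cong[OF this, of \<psi>]
  have "\<psi> (\<lambda>x\<in>unit_ball V. h (f x)) * 0 = 1"
    unfolding characterD(3)[OF \<psi> A Au_add[OF V Au_const[OF V] Au_cmult[OF V f]]] Bv characterD(4)[OF \<psi> V] .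
  then show False by simp
qed

text \<open>Contractivity makes the values of a character on the coordinates a point
  \<open>w\<close> of the closed ball. These values determine it on polynomials, and contractivity
  with polynomial approximation extends the agreement with \<open>delta w\<close> to the whole
  algebra.\<close>

lemma characters_c0_eq: "characters (unit_ball c0) (Au c0) = {delta z | z. z \<in> cball 0 1}"
proof (intro equalityI subsetI)
  fix \<psi> assume \<psi>: "\<psi> \<in> characters (unit_ball c0) (Au c0)"
  note V = complex_subspace_c0
  let ?c = "\<lambda>n. \<lambda>x\<in>unit_ball c0. apply_bcontfun x n"
  have le: "cmod (\<psi> (?c n)) \<le> 1" for n
  proof (rule character_contractive[OF V \<psi> Au_coord[OF V]])
    fix x assume "x \<in> unit_ball c0"
    then show "cmod (?c n x) \<le> 1" using norm_bounded[of x n] by (simp add: unit_ball_iff)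
  qed simp
  define w where "w = linf_of (\<lambda>n. \<psi> (?c n))"
  have w: "w n = \<psi> (?c n)" for n unfolding w_def by (rule apply_linf_of[OF le])
  have wB: "w \<in> cball 0 1" by (simp add: linf_norm_le_iff w le)
  have poly: "\<psi> (restrict p (unit_ball c0)) = p w" if "p \<in> cpoly" for p
    using that
  proof induction
    case (const c)
    show ?case by (rule characterD(4)[OF \<psi> V])
  next
    case (coord n)
    show ?case by (rule w[symmetric])
  next
    case (add p q)
    have eq: "(\<lambda>x\<in>unit_ball c0. p x + q x) =
        (\<lambda>x\<in>unit_ball c0. restrict p (unit_ball c0) x + restrict q (unit_ball c0) x)"
      by (rule restrict_ext) simp
    show ?case
      unfolding eq using characterD(1)[OF \<psi> cpoly_in_Au[OF V add.hyps(1)] cpoly_in_Au[OF V add.hyps(2)]] add.IH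
      by (simp only:)
  next
    case (mult p q)
    have eq: "(\<lambda>x\<in>unit_ball c0. p x * q x) =
        (\<lambda>x\<in>unit_ball c0. restrict p (unit_ball c0) x * restrict q (unit_ball c0) x)"
      by (rule restrict_ext) simp
    show ?case
      unfolding eq using characterD(3)[OF \<psi> cpoly_in_Au[OF V mult.hyps(1)] cpoly_in_Au[OF V mult.hyps(2)]] mult.IH
      by (simp only:)
  qed
  have "\<psi> f = delta w f" if f: "f \<in> Au c0" for f
  proof -
    have "cmod (\<psi> f - ext f w) \<le> 0 + e" if e: "e > 0" for e
    proof -
      obtain p where p: "p \<in> cpoly" "\<And>x. x \<in> unit_ball c0 \<Longrightarrow> cmod (f x - p x) < e / 2"
        using Au_cpoly_approx[OF f half_gt_zero[OF e]] by blast
      let ?p = "restrict p (unit_ball c0)"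
      have pA: "?p \<in> Au c0" by (rule cpoly_in_Au[OF V p(1)])
      have "cmod (\<psi> (\<lambda>x\<in>unit_ball c0. f x + (\<lambda>x\<in>unit_ball c0. (-1) * ?p x) x)) \<le> e / 2"
      proof (rule character_contractive[OF V \<psi> Au_add[OF V f Au_cmult[OF V pA]]])
        fix x assume x: "x \<in> unit_ball c0"
        then show "cmod ((\<lambda>x\<in>unit_ball c0. f x + (\<lambda>x\<in>unit_ball c0. (-1) * ?p x) x) x) \<le> e / 2"
          using p(2)[OF x] by simp
      qed (use e in simp)
      then have "cmod (\<psi> f - p w) \<le> e / 2"
        unfolding characterD(1)[OF \<psi> f Au_cmult[OF V pA]] characterD(2)[OF \<psi> pA] poly[OF p(1)] by simp
      moreover have "cmod (ext f w - p w) \<le> e / 2"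
        by (rule ext_minus_cpoly_le[OF f p(1) _ wB]) (use p(2) in \<open>blast intro: less_imp_le\<close>)
      ultimately show ?thesis
        using norm_triangle_ineq4[of "\<psi> f - p w" "ext f w - p w"] by simp
    qed
    then have "cmod (\<psi> f - ext f w) \<le> 0" by (rule field_le_epsilon)
    then show ?thesis by (simp add: delta_apply[OF f wB])
  qed
  then have "\<psi> = delta w"
    using \<psi> delta_in_characters[OF wB] by (intro extensionalityI[of _ "Au c0"]) (auto simp: characters_def)
  with wB show "\<psi> \<in> {delta z | z. z \<in> cball 0 1}" by blast
qed (use delta_in_characters in blast)

lemma unorm_le_iff:
  assumes V: "complex_subspace V" "V \<noteq> {}" and f: "f \<in> Au V"
  shows "unorm (unit_ball V) f \<le> M \<longleftrightarrow> (\<forall>x\<in>unit_ball V. cmod (f x) \<le> M)"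
proof -
  obtain x where "x \<in> V" using V(2) by blast
  then have "0 \<in> unit_ball V" using complex_subspaceD(2)[OF V(1), of x 0] by (simp add: unit_ball_iff)
  moreover obtain B where "\<forall>x\<in>unit_ball V. cmod (f x) \<le> B" using AuD(4)[OF f V(1)] by blast
  ultimately show ?thesis
    unfolding unorm_def by (intro cSUP_le_iff) (auto intro!: bdd_aboveI2)
qed

lemma unorm_c0_le_iff:
  "f \<in> Au c0 \<Longrightarrow> unorm (unit_ball c0) f \<le> M \<longleftrightarrow> (\<forall>x\<in>unit_ball c0. cmod (f x) \<le> M)"
  using unorm_le_iff[OF complex_subspace_c0] c0_zero by blast

section \<open>Pseudohyperbolic distance and the Schwarz estimate\<close>

definition ph_dist :: "complex \<Rightarrow> complex \<Rightarrow> real" where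
  "ph_dist a b = cmod (a - b) / cmod (1 - cnj b * a)"

text \<open>Divided by the squared denominator of \<open>ph_dist a b\<close>, when that is nonzero,
  this expresses \<open>1 - (ph_dist a b)\<^sup>2\<close>; most pseudohyperbolic estimates below are
  read off from it.\<close>

lemma Moebius_norm_identity:
  "(cmod (1 - cnj b * a))\<^sup>2 - (cmod (a - b))\<^sup>2 = (1 - (cmod a)\<^sup>2) * (1 - (cmod b)\<^sup>2)"
  unfolding cmod_power2 by (simp add: power2_eq_square algebra_simps)

lemma Moebius_norm_le:
  assumes "cmod a \<le> 1" "cmod b \<le> 1"
  shows "cmod (a - b) \<le> cmod (1 - cnj b * a)"
proof -
  have "(1 - (cmod a)\<^sup>2) * (1 - (cmod b)\<^sup>2) \<ge> 0"
    using assms by (intro mult_nonneg_nonneg) (auto simp: power_le_one)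
  then have "(cmod (a - b))\<^sup>2 \<le> (cmod (1 - cnj b * a))\<^sup>2"
    using Moebius_norm_identity[of b a] by linarith
  then show ?thesis by (rule power2_le_imp_le) simp
qed

lemma Moebius_denom_nonzero:
  assumes "cmod a \<le> 1" "cmod b < 1"
  shows "1 - cnj b * a \<noteq> 0"
proof
  assume "1 - cnj b * a = 0"
  then have "cmod b * cmod a = 1" by (metis complex_mod_cnj eq_iff_diff_eq_0 norm_mult norm_one)
  moreover have "cmod b * cmod a \<le> cmod b" using assms by (simp add: mult_left_le)
  ultimately show False using assms by simp
qed

lemma ph_dist_nonneg: "ph_dist a b \<ge> 0"
  by (simp add: ph_dist_def)

lemma ph_dist_unimodular:
  assumes "cmod b = 1" "a \<noteq> b"
  shows "ph_dist a b = 1"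
proof -
  have "(cmod (1 - cnj b * a))\<^sup>2 = (cmod (a - b))\<^sup>2"
    using Moebius_norm_identity[of b a] assms by simp
  then have "cmod (1 - cnj b * a) = cmod (a - b)" by (simp add: power2_eq_iff_nonneg)
  with assms show ?thesis by (simp add: ph_dist_def)
qed

text \<open>The classical lemma needs a strict bound, whereas \<open>M\<close> may be attained or be
  0; dividing by \<open>M + e\<close> and letting \<open>e\<close> tend to 0 covers both
  situations.\<close>

lemma Schwarz_le:
  assumes g: "g holomorphic_on ball 0 1" "g 0 = 0" and M: "\<And>s. cmod s < 1 \<Longrightarrow> cmod (g s) \<le> M"
    and \<xi>: "cmod \<xi> < 1"
  shows "cmod (g \<xi>) \<le> M * cmod \<xi>"
proof (rule field_le_epsilon)
  fix e :: real assume e: "e > 0"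
  have Me: "M + e > 0" using M[of 0] g(2) e by simp
  have "cmod (g \<xi> / of_real (M + e)) \<le> cmod \<xi>"
  proof (rule Schwarz_Lemma(1)[where f = "\<lambda>s. g s / of_real (M + e)"])
    show "(\<lambda>s. g s / of_real (M + e)) holomorphic_on ball 0 1"
      using Me by (intro holomorphic_intros g) (simp flip: of_real_add)
    show "cmod (g s / of_real (M + e)) < 1" if "cmod s < 1" for s
      using M[OF that] Me e unfolding norm_divide norm_of_real by simp
  qed (use g \<xi> in auto)
  then have "cmod (g \<xi>) \<le> cmod \<xi> * (M + e)"
    using Me unfolding norm_divide norm_of_real by (simp add: divide_le_eq)
  also have "\<dots> = M * cmod \<xi> + cmod \<xi> * e" by (simp add: algebra_simps)
  also have "\<dots> \<le> M * cmod \<xi> + e" using \<xi> e by (simp add: mult_left_le_one_le)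
  finally show "cmod (g \<xi>) \<le> M * cmod \<xi> + e" .
qed

text \<open>Coordinatewise Moebius maps give an analytic disc through \<open>w\<close> and \<open>z\<close>; the Schwarz lemma is
  applied along it. Coordinates with \<open>\<bar>w\<^sub>n\<bar> = 1\<close> are constant on the disc.\<close>

lemma cpoly_Schwarz:
  fixes z w :: linf
  assumes p: "p \<in> cpoly" and M: "\<And>x. x \<in> cball 0 1 \<Longrightarrow> cmod (p x - p w) \<le> M"
    and z: "z \<in> cball 0 1" and w: "w \<in> cball 0 1"
    and s: "s < 1" "\<And>n. ph_dist (z n) (w n) \<le> s"
  shows "cmod (p z - p w) \<le> M * s"
proof -
  have s0: "s \<ge> 0" using s(2)[of 0] ph_dist_nonneg[of "z 0" "w 0"] by linarith
  have zn: "cmod (z n) \<le> 1" and wn: "cmod (w n) \<le> 1" for n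
    using norm_bounded[of z n] norm_bounded[of w n] z w by auto
  \<comment> \<open>\<open>m n\<close> is the image of \<open>z n\<close> under the Moebius map that
    sends \<open>w n\<close> to 0, and \<open>D n\<close> below applies the inverse map to
    \<open>c n * l\<close>. The disc is thus at \<open>w\<close> for \<open>l = 0\<close> and at
    \<open>z\<close> for \<open>l = s\<close>. If \<open>s = 0\<close>, then \<open>m n = 0\<close>
    and division by zero gives \<open>c n = 0\<close>, which is still consistent.\<close>
  define m where "m n = (z n - w n) / (1 - cnj (w n) * z n)" for n
  define c where "c n = m n / of_real s" for n
  have m: "cmod (m n) \<le> s" for n using s(2)[of n] by (simp add: m_def ph_dist_def norm_divide)
  have c: "cmod (c n) \<le> 1" for n
    using m[of n] s0 by (cases "s = 0") (auto simp: c_def norm_divide divide_le_eq)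
  have cs: "c n * of_real s = m n" for n
    using m[of n] by (cases "s = 0") (auto simp: c_def)
  have cl: "cmod (c n * l) < 1" if "cmod l < 1" for n l
    using c[of n] that mult_right_mono[OF c[of n] norm_ge_zero[of l]] by (simp add: norm_mult)
  define D where "D n l = (c n * l + w n) / (1 + cnj (w n) * (c n * l))" for n l
  have Dne: "1 + cnj (w n) * (c n * l) \<noteq> 0" if "cmod l < 1" for n l
    using Moebius_denom_nonzero[of "- cnj (w n)" "cnj (c n * l)"] wn[of n] cl[OF that, of n]
    by (simp add: mult.commute del: complex_cnj_mult)
  have D1: "cmod (D n l) \<le> 1" if "cmod l < 1" for n l
    using Moebius_norm_le[of "c n * l" "- w n"] wn[of n] cl[OF that, of n] Dne[OF that, of n]
    by (simp add: D_def norm_divide divide_le_eq)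
  define \<Lambda> where "\<Lambda> l = linf_of (\<lambda>n. D n l)" for l
  have \<Lambda>: "\<Lambda> l n = D n l" if "cmod l < 1" for l n
    unfolding \<Lambda>_def by (rule apply_linf_of[OF D1[OF that]])
  have \<Lambda>B: "\<Lambda> l \<in> cball 0 1" if "cmod l < 1" for l
    using D1[OF that] by (simp add: linf_norm_le_iff \<Lambda>[OF that])
  have \<Lambda>0: "\<Lambda> 0 = w" by (rule bcontfun_eqI) (simp add: \<Lambda> D_def)
  have \<Lambda>s: "\<Lambda> (of_real s) = z"
  proof (rule bcontfun_eqI)
    fix n
    have "D n (of_real s) = z n"
    proof (cases "cmod (w n) = 1")
      case True
      then have "z n = w n" using ph_dist_unimodular[of "w n" "z n"] s(1) s(2)[of n] by force
      then show ?thesis by (simp add: D_def cs m_def)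
    next
      case False
      then have w1: "cmod (w n) < 1" using wn[of n] by simp
      have d: "1 - cnj (w n) * z n \<noteq> 0" by (rule Moebius_denom_nonzero[OF zn w1])
      have e: "1 + cnj (w n) * m n \<noteq> 0"
        using Dne[of "of_real s" n] s(1) s0 by (simp add: cs)
      have md: "m n * (1 - cnj (w n) * z n) = z n - w n" using d by (simp add: m_def)
      have "m n + w n = z n * (1 + cnj (w n) * m n)"
        using md by (simp add: algebra_simps)
      with e show ?thesis by (simp add: D_def cs)
    qed
    then show "\<Lambda> (of_real s) n = z n" using s(1) s0 by (simp add: \<Lambda>)
  qed
  have hol: "(\<lambda>l. p (\<Lambda> l)) holomorphic_on ball 0 1"
    using p
  proof induction
    case (coord n)
    have "(\<lambda>l. D n l) holomorphic_on ball 0 1"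
      unfolding D_def using Dne by (intro holomorphic_intros) auto
    then show ?case by (rule holomorphic_transform) (simp add: \<Lambda>)
  qed (intro holomorphic_intros; assumption)+
  have "cmod (p (\<Lambda> (of_real s)) - p w) \<le> M * cmod (of_real s)"
    by (rule Schwarz_le[where g = "\<lambda>l. p (\<Lambda> l) - p w"])
       (use hol M \<Lambda>B \<Lambda>0 s(1) s0 in \<open>auto intro!: holomorphic_intros\<close>)
  then show ?thesis using s0 by (simp add: \<Lambda>s)
qed

lemma ext_Schwarz:
  fixes z w :: linf
  assumes f: "f \<in> Au c0" and M: "\<And>x. x \<in> unit_ball c0 \<Longrightarrow> cmod (f x - ext f w) \<le> M"
    and z: "z \<in> cball 0 1" and w: "w \<in> cball 0 1"
    and s: "s < 1" "\<And>n. ph_dist (z n) (w n) \<le> s"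
  shows "cmod (ext f z - ext f w) \<le> M * s"
proof (rule field_le_epsilon)
  fix e :: real assume e: "e > 0"
  \<comment> \<open>Passing from \<open>f\<close> to \<open>p\<close> costs \<open>d\<close> at each
    of \<open>z\<close> and \<open>w\<close> and raises the bound \<open>M\<close> by
    \<open>2 * d\<close>.\<close>
  define d where "d = e / 4"
  have d: "d > 0" using e by (simp add: d_def)
  obtain p where p: "p \<in> cpoly" "\<And>x. x \<in> unit_ball c0 \<Longrightarrow> cmod (f x - p x) < d"
    using Au_cpoly_approx[OF f d] by blast
  have le: "cmod (ext f x - p x) \<le> d" if "x \<in> cball 0 1" for x
    by (rule ext_minus_cpoly_le[OF f p(1) _ that]) (use p(2) in \<open>blast intro: less_imp_le\<close>)
  have "cmod (p x - p w) \<le> M + 2 * d" if x: "x \<in> cball 0 1" for x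
  proof (rule cpoly_bound_cball[OF cpoly_diff[OF p(1) cpoly.const] _ x])
    fix y assume y: "y \<in> unit_ball c0"
    have "p y - p w = (f y - ext f w) - (f y - p y) + (ext f w - p w)" by simp
    also have "cmod \<dots> \<le> cmod (f y - ext f w) + cmod (f y - p y) + cmod (ext f w - p w)"
      by (intro norm_triangle_mono norm_triangle_ineq4) simp
    finally show "cmod (p y - p w) \<le> M + 2 * d" using M[OF y] p(2)[OF y] le[OF w] by linarith
  qed
  then have "cmod (p z - p w) \<le> (M + 2 * d) * s" by (rule cpoly_Schwarz[OF p(1) _ z w s])
  also have "\<dots> \<le> M * s + 2 * d"
    using s(1) d by (simp add: distrib_right)
  finally have "cmod (p z - p w) \<le> M * s + 2 * d" .
  moreover have "ext f z - ext f w = (ext f z - p z) + (p z - p w) - (ext f w - p w)" by simp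
  then have "cmod (ext f z - ext f w) \<le> cmod (ext f z - p z) + cmod (p z - p w) + cmod (ext f w - p w)"
    by (metis norm_triangle_ineq norm_triangle_ineq4 add_right_mono order_trans)
  ultimately show "cmod (ext f z - ext f w) \<le> M * s + e"
    using le[OF z] le[OF w] by (simp add: d_def)
qed

abbreviation rho_c0 :: "linf \<Rightarrow> linf \<Rightarrow> real" where
  "rho_c0 z w \<equiv> gleason_rho (unit_ball c0) (Au c0) (delta z) (delta w)"

lemma gleason_rho_delta:
  assumes z: "z \<in> cball 0 1" and w: "w \<in> cball 0 1"
  shows "rho_c0 z w =
    (SUP f\<in>{f \<in> Au c0. (\<forall>x\<in>unit_ball c0. cmod (f x) \<le> 1) \<and> ext f w = 0}. cmod (ext f z))"
proof -
  have "{f \<in> Au c0. unorm (unit_ball c0) f \<le> 1 \<and> delta w f = 0} =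
      {f \<in> Au c0. (\<forall>x\<in>unit_ball c0. cmod (f x) \<le> 1) \<and> ext f w = 0}"
    using unorm_c0_le_iff delta_apply[OF _ w] by auto
  then show ?thesis
    unfolding gleason_rho_def by (intro SUP_cong) (auto simp: delta_apply[OF _ z])
qed

lemma gleason_rho_upper:
  assumes z: "z \<in> cball 0 1" and w: "w \<in> cball 0 1"
    and f: "f \<in> Au c0" "\<And>x. x \<in> unit_ball c0 \<Longrightarrow> cmod (f x) \<le> 1" "ext f w = 0"
  shows "cmod (ext f z) \<le> rho_c0 z w"
  unfolding gleason_rho_delta[OF z w]
proof (rule cSUP_upper)
  show "bdd_above ((\<lambda>f. cmod (ext f z)) ` {f \<in> Au c0. (\<forall>x\<in>unit_ball c0. cmod (f x) \<le> 1) \<and> ext f w = 0})"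
    by (rule bdd_aboveI2[where M = 1]) (use ext_norm_le[OF _ z] in blast)
qed (use f in blast)

lemma gleason_rho_coord_upper:
  fixes z w :: linf
  assumes z: "z \<in> cball 0 1" and w: "w \<in> cball 0 1"
    and h: "h holomorphic_on S" "open S" "cball 0 1 \<subseteq> S"
    and h1: "\<And>s. cmod s \<le> 1 \<Longrightarrow> cmod (h s) \<le> 1" and h0: "h (w n) = 0"
  shows "cmod (h (z n)) \<le> rho_c0 z w"
proof -
  let ?f = "\<lambda>x\<in>unit_ball c0. h (apply_bcontfun x n)"
  have "cmod (ext ?f z) \<le> rho_c0 z w"
  proof (rule gleason_rho_upper[OF z w coord_holomorphic_in_Au(1)[OF h]])
    fix x assume x: "x \<in> unit_ball c0"
    then have "cmod (x n) \<le> 1" using norm_bounded[of x n] by (simp add: unit_ball_iff)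
    with x h1 show "cmod (?f x) \<le> 1" by simp
  next
    show "ext ?f w = 0" using coord_holomorphic_in_Au(2)[OF h w] h0 by (simp only:)
  qed
  then show ?thesis using coord_holomorphic_in_Au(2)[OF h z] by (simp only:)
qed

lemma Moebius_holomorphic:
  assumes b: "cmod b < 1"
  shows "(\<lambda>s. (s - b) / (1 - cnj b * s)) holomorphic_on {s. 1 - cnj b * s \<noteq> 0}"
    and "open {s. 1 - cnj b * s \<noteq> 0}" and "cball 0 1 \<subseteq> {s. 1 - cnj b * s \<noteq> 0}"
    and "\<And>s. cmod s \<le> 1 \<Longrightarrow> cmod ((s - b) / (1 - cnj b * s)) \<le> 1"
proof -
  show "(\<lambda>s. (s - b) / (1 - cnj b * s)) holomorphic_on {s. 1 - cnj b * s \<noteq> 0}"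
    by (intro holomorphic_intros) auto
  show "open {s. 1 - cnj b * s \<noteq> 0}"
    by (intro open_Collect_neq continuous_intros)
  show "cball 0 1 \<subseteq> {s. 1 - cnj b * s \<noteq> 0}"
    using Moebius_denom_nonzero[OF _ b] by auto
  show "cmod ((s - b) / (1 - cnj b * s)) \<le> 1" if "cmod s \<le> 1" for s
    using Moebius_norm_le[OF that, of b] b Moebius_denom_nonzero[OF that b]
    by (simp add: norm_divide divide_le_eq)
qed

text \<open>When \<open>|w n| < 1\<close>, the Moebius map vanishing at \<open>w n\<close>, applied
  to the single coordinate \<open>n\<close>, is a test function. On the circle one needs a limit of
  test functions instead.\<close>

lemma ph_dist_le_gleason_rho:
  fixes z w :: linf
  assumes z: "z \<in> cball 0 1" and w: "w \<in> cball 0 1"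
  shows "ph_dist (z n) (w n) \<le> rho_c0 z w"
proof (cases "cmod (w n) < 1")
  case True
  from gleason_rho_coord_upper[OF z w Moebius_holomorphic[OF True], of n]
  show ?thesis by (simp add: ph_dist_def norm_divide)
next
  case False
  then have w1: "cmod (w n) = 1" using norm_bounded[of w n] w by simp
  let ?a = "w n"
  show ?thesis
  proof (cases "z n = ?a")
    case True
    have "cmod ((\<lambda>s. 0) (z n)) \<le> rho_c0 z w"
      by (rule gleason_rho_coord_upper[OF z w, of _ UNIV]) auto
    with True show ?thesis by (simp add: ph_dist_def)
  next
    case False
    \<comment> \<open>The Moebius maps centred at \<open>r ?a\<close> fix the boundary point
      \<open>?a\<close> and, as \<open>r\<close> tends to 1, send \<open>z n\<close> to values
      tending to \<open>- ?a\<close>. Subtracting the value at \<open>?a\<close> and halving gives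
      functions that are bounded by 1 and vanish at \<open>?a\<close>, with modulus at
      \<open>z n\<close> tending to 1.\<close>
    define m where "m r s = (s - of_real r * ?a) / (1 - cnj (of_real r * ?a) * s)" for r s
    have le: "cmod ((m r (z n) - m r ?a) / 2) \<le> rho_c0 z w"
      if r: "r \<in> {0<..<1}" for r
    proof -
      have b: "cmod (of_real r * ?a) < 1" using r w1 by (simp add: norm_mult)
      show ?thesis
      proof (rule gleason_rho_coord_upper[OF z w _ Moebius_holomorphic(2,3)[OF b],
            where h = "\<lambda>s. (m r s - m r ?a) / 2"])
        show "(\<lambda>s. (m r s - m r ?a) / 2) holomorphic_on {s. 1 - cnj (of_real r * ?a) * s \<noteq> 0}"
          using Moebius_holomorphic(1)[OF b] unfolding m_def by (intro holomorphic_intros) auto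
        fix s assume "cmod s \<le> 1"
        then have "cmod (m r s - m r ?a) \<le> 1 + 1"
          unfolding m_def using Moebius_holomorphic(4)[OF b] w1
          by (intro norm_triangle_le_diff add_mono) auto
        then show "cmod ((m r s - m r ?a) / 2) \<le> 1" by (simp add: norm_divide)
      qed simp
    qed
    have aa: "cnj ?a * ?a = 1" using w1 complex_norm_square[of ?a] by (simp add: mult.commute)
    have ne: "1 - cnj ?a * z n \<noteq> 0"
    proof
      assume "1 - cnj ?a * z n = 0"
      then have "?a * (cnj ?a * z n) = ?a * 1" by simp
      then have "(cnj ?a * ?a) * z n = ?a" by (simp add: mult_ac)
      with aa False show False by simp
    qed
    have m1: "m r ?a = ?a" if r: "r \<in> {0<..<1}" for r
    proof -
      have "m r ?a = (?a - of_real r * ?a) / (1 - of_real r)" by (simp add: m_def aa mult.assoc)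
      also have "\<dots> = ?a" using r by (simp add: field_simps)
      finally show ?thesis .
    qed
    have "((\<lambda>r. m r (z n)) \<longlongrightarrow> m 1 (z n)) (at_left 1)"
      unfolding m_def by (intro tendsto_intros) (use ne in simp)
    moreover have "m 1 (z n) = - ?a"
    proof -
      have "z n - ?a = - ?a * (1 - cnj ?a * z n)" using aa by (simp add: algebra_simps)
      with ne show ?thesis by (simp add: m_def divide_eq_eq)
    qed
    ultimately have "((\<lambda>r. cmod ((m r (z n) - ?a) / 2)) \<longlongrightarrow> cmod ((- ?a - ?a) / 2)) (at_left 1)"
      by (intro tendsto_intros) auto
    moreover have "cmod ((- ?a - ?a) / 2) = 1" using w1 by (simp add: norm_divide)
    moreover have "\<forall>\<^sub>F r in at_left 1. cmod ((m r (z n) - ?a) / 2) \<le>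
        rho_c0 z w"
      using eventually_at_left_real[of 0 "1::real"] le m1 by (auto elim!: eventually_mono)
    ultimately have "1 \<le> rho_c0 z w"
      using tendsto_upperbound[of _ 1 "at_left (1::real)"] trivial_limit_at_left_real by force
    then show ?thesis using ph_dist_unimodular[OF w1 False] by simp
  qed
qed

theorem GP_delta_eq:
  fixes z :: linf
  assumes z: "z \<in> cball 0 1"
  shows "GP (delta z) = {delta w | w. w \<in> cball 0 1 \<and> (\<exists>s<1. \<forall>n. ph_dist (z n) (w n) \<le> s)}"
proof -
  have "rho_c0 z w < 1 \<longleftrightarrow> (\<exists>s<1. \<forall>n. ph_dist (z n) (w n) \<le> s)"
    if w: "w \<in> cball 0 1" for w
  proof
    assume "\<exists>s<1. \<forall>n. ph_dist (z n) (w n) \<le> s"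
    then obtain s where s: "s < 1" "\<And>n. ph_dist (z n) (w n) \<le> s" by blast
    have "rho_c0 z w \<le> s"
      unfolding gleason_rho_delta[OF z w]
    proof (rule cSUP_least)
      have "(\<lambda>x\<in>unit_ball c0. 0) \<in> Au c0" by (rule Au_const[OF complex_subspace_c0])
      moreover have "ext (\<lambda>x\<in>unit_ball c0. 0) w = 0" by (rule ext_cpoly[OF cpoly.const w])
      ultimately have "(\<lambda>x\<in>unit_ball c0. 0) \<in> {f \<in> Au c0. (\<forall>x\<in>unit_ball c0. cmod (f x) \<le> 1) \<and> ext f w = 0}"
        by (intro CollectI conjI ballI) simp_all
      then show "{f \<in> Au c0. (\<forall>x\<in>unit_ball c0. cmod (f x) \<le> 1) \<and> ext f w = 0} \<noteq> {}" by blast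
      fix f assume "f \<in> {f \<in> Au c0. (\<forall>x\<in>unit_ball c0. cmod (f x) \<le> 1) \<and> ext f w = 0}"
      then show "cmod (ext f z) \<le> s"
        using ext_Schwarz[OF _ _ z w s, of f 1] by simp
    qed
    with s(1) show "rho_c0 z w < 1" by linarith
  qed (use ph_dist_le_gleason_rho[OF z w] in blast)
  then show ?thesis
    unfolding gleason_part_def characters_c0_eq by blast
qed

subsection \<open>Isometric embeddings\<close>

text \<open>Both Gleason metrics of the theorem are computed by the same supremum over polynomials in finitely
  many coordinates. Such polynomials can be composed with coordinate substitutions, which yields the isometries.\<close>

definition poly_dist :: "linf \<Rightarrow> linf \<Rightarrow> real" where
  "poly_dist a b = (SUP p\<in>{p \<in> cpoly. \<forall>x\<in>cball 0 1. cmod (p x) \<le> 1}. cmod (p a - p b))"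

lemma poly_dist_upper:
  assumes "p \<in> cpoly" "\<And>x. x \<in> cball 0 1 \<Longrightarrow> cmod (p x) \<le> 1" "a \<in> cball 0 1" "b \<in> cball 0 1"
  shows "cmod (p a - p b) \<le> poly_dist a b"
  unfolding poly_dist_def
proof (rule cSUP_upper)
  show "bdd_above ((\<lambda>p. cmod (p a - p b)) ` {p \<in> cpoly. \<forall>x\<in>cball 0 1. cmod (p x) \<le> 1})"
  proof (rule bdd_aboveI2)
    fix p assume "p \<in> {p \<in> cpoly. \<forall>x\<in>cball 0 1. cmod (p x) \<le> 1}"
    then have "cmod (p a) \<le> 1" "cmod (p b) \<le> 1" using assms(3,4) by blast+
    then show "cmod (p a - p b) \<le> 1 + 1" by (intro norm_triangle_le_diff add_mono)
  qed
qed (use assms in blast)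

lemma poly_dist_least:
  assumes "\<And>p. p \<in> cpoly \<Longrightarrow> (\<And>x. x \<in> cball 0 1 \<Longrightarrow> cmod (p x) \<le> 1) \<Longrightarrow> cmod (p a - p b) \<le> M"
  shows "poly_dist a b \<le> M"
  unfolding poly_dist_def
proof (rule cSUP_least)
  have "(\<lambda>x. 0) \<in> {p \<in> cpoly. \<forall>x\<in>cball 0 1. cmod (p x) \<le> 1}" by (simp add: cpoly.const)
  then show "{p \<in> cpoly. \<forall>x\<in>cball 0 1. cmod (p x) \<le> 1} \<noteq> {}" by blast
qed (use assms in blast)

lemma poly_dist_nonneg:
  "a \<in> cball 0 1 \<Longrightarrow> b \<in> cball 0 1 \<Longrightarrow> poly_dist a b \<ge> 0"
  using poly_dist_upper[OF cpoly.const[of 0], of a b] by simp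

text \<open>The factor 2 bounds the deviation of a polynomial of modulus at most 1 from its value at
  \<open>b\<close>.\<close>

lemma poly_dist_le_ph_dist:
  assumes "a \<in> cball 0 1" "b \<in> cball 0 1" "s < 1" "\<And>n. ph_dist (apply_bcontfun a n) (apply_bcontfun b n) \<le> s"
  shows "poly_dist a b \<le> 2 * s"
proof (rule poly_dist_least)
  fix p assume p: "p \<in> cpoly" "\<And>x. x \<in> cball 0 1 \<Longrightarrow> cmod (p x) \<le> 1"
  have "cmod (p x - p b) \<le> 1 + 1" if "x \<in> cball 0 1" for x
    using p(2)[OF that] p(2)[OF assms(2)] by (intro norm_triangle_le_diff add_mono)
  then have "cmod (p a - p b) \<le> (1 + 1) * s"
    by (rule cpoly_Schwarz[OF p(1) _ assms])
  then show "cmod (p a - p b) \<le> 2 * s" by simp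
qed

lemma ext_diff_le_poly_dist:
  assumes f: "f \<in> Au c0" "\<And>x. x \<in> unit_ball c0 \<Longrightarrow> cmod (f x) \<le> 1"
    and a: "a \<in> cball 0 1" and b: "b \<in> cball 0 1"
  shows "cmod (ext f a - ext f b) \<le> poly_dist a b"
proof (rule field_le_epsilon)
  fix e :: real assume e: "e > 0"
  define d where "d = e / 4"
  have d: "d > 0" using e by (simp add: d_def)
  obtain p where p: "p \<in> cpoly" "\<And>x. x \<in> unit_ball c0 \<Longrightarrow> cmod (f x - p x) < d"
    using Au_cpoly_approx[OF f(1) d] by blast
  have le: "cmod (ext f x - p x) \<le> d" if "x \<in> cball 0 1" for x
    by (rule ext_minus_cpoly_le[OF f(1) p(1) _ that]) (use p(2) in \<open>blast intro: less_imp_le\<close>)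
  \<comment> \<open>\<open>p\<close> is only bounded by \<open>1 + d\<close>, so it must be rescaled
    before it can compete in the supremum. The correction is at most \<open>2 * d\<close> because
    \<open>poly_dist\<close> never exceeds 2.\<close>
  define q where "q x = of_real (1 / (1 + d)) * p x" for x
  have q: "q \<in> cpoly" unfolding q_def by (intro cpoly.mult cpoly.const p(1))
  have nq: "cmod (q x - q y) = cmod (p x - p y) / (1 + d)" and nq1: "cmod (q x) = cmod (p x) / (1 + d)" for x y
  proof -
    have "q x - q y = of_real (1 / (1 + d)) * (p x - p y)" by (simp add: q_def right_diff_distrib)
    then show "cmod (q x - q y) = cmod (p x - p y) / (1 + d)"
      using d by (simp only: norm_mult norm_of_real) simp
    show "cmod (q x) = cmod (p x) / (1 + d)"
      unfolding q_def norm_mult norm_of_real using d by simp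
  qed
  have "cmod (q x) \<le> 1" if x: "x \<in> cball 0 1" for x
  proof -
    have "cmod (p x) \<le> 1 + d"
    proof (rule cpoly_bound_cball[OF p(1) _ x])
      fix y assume y: "y \<in> unit_ball c0"
      show "cmod (p y) \<le> 1 + d"
        using f(2)[OF y] p(2)[OF y] norm_triangle_ineq4[of "f y" "f y - p y"] by simp
    qed
    then show ?thesis using d by (simp add: nq1)
  qed
  then have "cmod (q a - q b) \<le> poly_dist a b" by (intro poly_dist_upper q a b)
  then have "cmod (p a - p b) \<le> poly_dist a b * (1 + d)" using d by (simp add: nq divide_le_eq)
  moreover have "poly_dist a b \<le> 2"
  proof (rule poly_dist_least)
    fix p :: "linf \<Rightarrow> complex" assume "\<And>x. x \<in> cball 0 1 \<Longrightarrow> cmod (p x) \<le> 1"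
    then have "cmod (p a - p b) \<le> 1 + 1" using a b by (intro norm_triangle_le_diff add_mono)
    then show "cmod (p a - p b) \<le> 2" by simp
  qed
  then have "poly_dist a b * d \<le> 2 * d" using d by (intro mult_right_mono) auto
  ultimately have "cmod (p a - p b) \<le> poly_dist a b + 2 * d" by (simp add: distrib_left)
  moreover have "cmod (ext f a - ext f b) \<le> cmod (ext f a - p a) + cmod (p a - p b) + cmod (ext f b - p b)"
    using norm_triangle_ineq[of "ext f a - p a" "p a - p b"]
      norm_triangle_ineq4[of "ext f a - p b" "ext f b - p b"] by simp
  ultimately show "cmod (ext f a - ext f b) \<le> poly_dist a b + e"
    using le[OF a] le[OF b] by (simp add: d_def)
qed

lemma gdist_c0_eq:
  assumes a: "a \<in> cball 0 1" and b: "b \<in> cball 0 1"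
  shows "gdist_c0 (delta a) (delta b) = poly_dist a b"
proof -
  let ?A = "{f \<in> Au c0. \<forall>x\<in>unit_ball c0. cmod (f x) \<le> 1}"
  let ?S = "SUP f\<in>?A. cmod (ext f a - ext f b)"
  have eq: "gdist_c0 (delta a) (delta b) =
      ?S"
    unfolding gleason_dist_def using unorm_c0_le_iff
    by (intro SUP_cong) (auto simp: delta_apply[OF _ a] delta_apply[OF _ b])
  show ?thesis
    unfolding eq
  proof (rule antisym)
    show "?S \<le> poly_dist a b"
    proof (rule cSUP_least)
      have "(\<lambda>x\<in>unit_ball c0. 0) \<in> ?A"
        using Au_const[OF complex_subspace_c0, of 0] by (intro CollectI conjI ballI) simp_all
      then show "?A \<noteq> {}" by blast
    qed (use ext_diff_le_poly_dist[OF _ _ a b] in blast)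
    show "poly_dist a b \<le> ?S"
    proof (rule poly_dist_least)
      fix p assume p: "p \<in> cpoly" "\<And>x. x \<in> cball 0 1 \<Longrightarrow> cmod (p x) \<le> 1"
      have "cmod (ext (restrict p (unit_ball c0)) a - ext (restrict p (unit_ball c0)) b)
          \<le> ?S"
      proof (rule cSUP_upper)
        show "restrict p (unit_ball c0) \<in> ?A"
          using cpoly_in_Au[OF complex_subspace_c0 p(1)] p(2)
          by (intro CollectI conjI ballI) (simp_all add: unit_ball_iff)
        show "bdd_above ((\<lambda>f. cmod (ext f a - ext f b)) ` ?A)"
          by (rule bdd_aboveI2[where M = "poly_dist a b"]) (use ext_diff_le_poly_dist[OF _ _ a b] in blast)
      qed
      then show "cmod (p a - p b) \<le> ?S"
        by (simp only: ext_cpoly[OF p(1) a] ext_cpoly[OF p(1) b])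
    qed
  qed
qed

text \<open>Composition with \<open>trunc k\<close> moves functions on the polydisc to
  \<open>c0\<close>, where \<open>ext_diff_le_poly_dist\<close> applies; conversely, polynomials
  restrict to the polydisc.\<close>

lemma gdist_polydisc_eq:
  assumes u: "u \<in> polydisc k" and v: "v \<in> polydisc k"
  shows "gdist_polydisc k u v = poly_dist u v"
proof -
  note V = complex_subspace_coord_space[of k]
  have ne: "coord_space k \<noteq> {}" using u by (auto simp: unit_ball_iff)
  have uB: "u \<in> cball 0 1" and vB: "v \<in> cball 0 1" and uk: "u \<in> coord_space k" and vk: "v \<in> coord_space k"
    using u v by (auto simp: unit_ball_iff)
  let ?A = "{f \<in> Au (coord_space k). \<forall>x\<in>polydisc k. cmod (f x) \<le> 1}"
  have eq: "gdist_polydisc k u v = (SUP f\<in>?A. cmod (f u - f v))"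
    unfolding gdist_polydisc_def gleason_dist_def using unorm_le_iff[OF V ne]
    by (intro SUP_cong) (auto simp: delta_poly_def)
  have upper: "cmod (f u - f v) \<le> poly_dist u v" if f: "f \<in> ?A" for f
  proof -
    let ?F = "\<lambda>x\<in>unit_ball c0. f (trunc k x)"
    have F: "?F \<in> Au c0" by (rule Au_coord_space_lift) (use f in blast)
    have "cmod (ext ?F u - ext ?F v) \<le> poly_dist u v"
    proof (rule ext_diff_le_poly_dist[OF F _ uB vB])
      fix x assume x: "x \<in> unit_ball c0"
      then have "trunc k x \<in> polydisc k" by (intro trunc_in_polydisc) (simp add: unit_ball_iff)
      with f x show "cmod (?F x) \<le> 1" by simp
    qed
    moreover have "ext ?F w = f w" if "w \<in> polydisc k" for w
    proof -
      have w: "trunc k w = w" using that by (intro trunc_id) (simp add: unit_ball_iff)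
      have "trunc k w \<in> c0" by (rule trunc_in_c0)
      then have "w \<in> unit_ball c0" using that by (simp add: unit_ball_iff w)
      then show ?thesis using ext_eq_on_unit_ball[OF F] w by simp
    qed
    ultimately show ?thesis using u v by simp
  qed
  show ?thesis
    unfolding eq
  proof (rule antisym)
    show "(SUP f\<in>?A. cmod (f u - f v)) \<le> poly_dist u v"
    proof (rule cSUP_least)
      have "(\<lambda>x\<in>polydisc k. 0) \<in> ?A"
        using Au_const[OF V, of 0] by (intro CollectI conjI ballI) simp_all
      then show "?A \<noteq> {}" by blast
    qed (rule upper)
    show "poly_dist u v \<le> (SUP f\<in>?A. cmod (f u - f v))"
    proof (rule poly_dist_least)
      fix p assume p: "p \<in> cpoly" "\<And>x. x \<in> cball 0 1 \<Longrightarrow> cmod (p x) \<le> 1"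
      have "cmod (restrict p (polydisc k) u - restrict p (polydisc k) v) \<le> (SUP f\<in>?A. cmod (f u - f v))"
      proof (rule cSUP_upper)
        show "restrict p (polydisc k) \<in> ?A"
          using cpoly_in_Au[OF V p(1)] p(2)
          by (intro CollectI conjI ballI) (simp_all add: unit_ball_iff)
        show "bdd_above ((\<lambda>f. cmod (f u - f v)) ` ?A)"
          by (rule bdd_aboveI2[OF upper])
      qed
      then show "cmod (p u - p v) \<le> (SUP f\<in>?A. cmod (f u - f v))" using u v by simp
    qed
  qed
qed

text \<open>Composition with such a map turns competitors in the supremum into competitors, so the
  map cannot increase the distance.\<close>

lemma poly_dist_subst:
  fixes W :: "linf \<Rightarrow> linf"
  assumes W: "\<And>n. (\<lambda>x. apply_bcontfun (W x) n) \<in> cpoly" "\<And>x. x \<in> cball 0 1 \<Longrightarrow> W x \<in> cball 0 1"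
    and u: "u \<in> cball 0 1" and v: "v \<in> cball 0 1"
  shows "poly_dist (W u) (W v) \<le> poly_dist u v"
proof (rule poly_dist_least)
  fix p assume p: "p \<in> cpoly" "\<And>x. x \<in> cball 0 1 \<Longrightarrow> cmod (p x) \<le> 1"
  have "(\<lambda>x. p (W x)) \<in> cpoly"
    using p(1) by induction (auto intro: cpoly.intros W(1))
  from poly_dist_upper[OF this _ u v] p(2) W(2)
  show "cmod (p (W u) - p (W v)) \<le> poly_dist u v" by blast
qed

section \<open>Substituting variables for coordinates\<close>

definition emb :: "linf \<Rightarrow> nat set \<Rightarrow> (nat \<Rightarrow> nat) \<Rightarrow> linf \<Rightarrow> linf" where
  "emb z J e u = linf_of (\<lambda>n. if n \<in> e ` J then u (inv_into J e n) else z n)"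

definition pull :: "nat set \<Rightarrow> (nat \<Rightarrow> nat) \<Rightarrow> linf \<Rightarrow> linf" where
  "pull J e x = linf_of (\<lambda>j. if j \<in> J then x (e j) else 0)"

lemma apply_emb: "emb z J e u n = (if n \<in> e ` J then u (inv_into J e n) else z n)"
  unfolding emb_def
  by (rule apply_linf_of[where b = "norm u + norm z"])
     (auto intro: order_trans[OF norm_bounded])

lemma apply_emb_inj: "inj_on e J \<Longrightarrow> j \<in> J \<Longrightarrow> emb z J e u (e j) = u j"
  by (simp add: apply_emb)

lemma apply_pull: "pull J e x j = (if j \<in> J then x (e j) else 0)"
  unfolding pull_def by (rule apply_linf_of[where b = "norm x"]) (auto intro: norm_bounded)

lemma emb_in_cball: "z \<in> cball 0 1 \<Longrightarrow> u \<in> cball 0 1 \<Longrightarrow> emb z J e u \<in> cball 0 1"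
  by (simp add: linf_norm_le_iff apply_emb)

lemma pull_in_cball: "x \<in> cball 0 1 \<Longrightarrow> pull J e x \<in> cball 0 1"
  by (simp add: linf_norm_le_iff apply_pull)

lemma pull_emb:
  fixes u :: linf
  assumes "inj_on e J" "\<And>j. j \<notin> J \<Longrightarrow> u j = 0"
  shows "pull J e (emb z J e u) = u"
  by (rule bcontfun_eqI) (use assms in \<open>auto simp: apply_pull apply_emb_inj\<close>)

text \<open>\<open>emb\<close> and \<open>pull\<close> only insert coordinates or constants and
  preserve the closed ball, so neither increases the distance. Since \<open>pull\<close> undoes
  \<open>emb\<close>, equality follows.\<close>

lemma poly_dist_emb:
  fixes z u v :: linf
  assumes e: "inj_on e J" and z: "z \<in> cball 0 1"
    and u: "u \<in> cball 0 1" "\<And>j. j \<notin> J \<Longrightarrow> u j = 0" and v: "v \<in> cball 0 1" "\<And>j. j \<notin> J \<Longrightarrow> v j = 0"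
  shows "poly_dist (emb z J e u) (emb z J e v) = poly_dist u v"
proof (rule antisym)
  show "poly_dist (emb z J e u) (emb z J e v) \<le> poly_dist u v"
  proof (rule poly_dist_subst[OF _ _ u(1) v(1)])
    show "(\<lambda>x. apply_bcontfun (emb z J e x) n) \<in> cpoly" for n
      by (cases "n \<in> e ` J") (simp_all add: apply_emb cpoly.const cpoly.coord)
  qed (rule emb_in_cball[OF z])
  have "poly_dist (pull J e (emb z J e u)) (pull J e (emb z J e v)) \<le> poly_dist (emb z J e u) (emb z J e v)"
  proof (rule poly_dist_subst[OF _ _ emb_in_cball[OF z u(1)] emb_in_cball[OF z v(1)]])
    show "(\<lambda>x. apply_bcontfun (pull J e x) n) \<in> cpoly" for n
      by (cases "n \<in> J") (simp_all add: apply_pull cpoly.const cpoly.coord)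
  qed (rule pull_in_cball)
  then show "poly_dist u v \<le> poly_dist (emb z J e u) (emb z J e v)"
    by (simp add: pull_emb[OF e] u(2) v(2))
qed

section \<open>Pseudohyperbolic distance on discs of radius below 1, and embeddings into a Gleason
  part\<close>

lemma ph_dist_self [simp]: "ph_dist a a = 0"
  by (simp add: ph_dist_def)

lemma ph_dist_commute: "ph_dist a b = ph_dist b a"
proof -
  have "cnj (1 - cnj b * a) = 1 - cnj a * b" by (simp add: mult.commute)
  then have "cmod (1 - cnj a * b) = cmod (1 - cnj b * a)" by (metis complex_mod_cnj)
  then show ?thesis by (simp add: ph_dist_def norm_minus_commute)
qed

text \<open>In the Moebius identity the right-hand side is at least
  \<open>(1 - r\<^sup>2)\<^sup>2\<close> and the denominator of \<open>ph_dist\<close> is at most 2,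
  whence \<open>1 - (ph_dist a b)\<^sup>2 \<ge> t\<close>.\<close>

lemma ph_dist_bounded_away:
  assumes r: "0 \<le> r" "r < 1"
  shows "\<exists>s<1. \<forall>a b. cmod a \<le> r \<longrightarrow> cmod b \<le> r \<longrightarrow> ph_dist a b \<le> s"
proof -
  define t where "t = (1 - r\<^sup>2)\<^sup>2 / 4"
  have r2: "r\<^sup>2 < 1" using r by (simp add: power_less_one_iff)
  then have t0: "t > 0" by (simp add: t_def)
  have t1: "t \<le> 1" using r2 power_le_one[of "1 - r\<^sup>2" 2] by (simp add: t_def)
  have "ph_dist a b \<le> sqrt (1 - t)" if a: "cmod a \<le> r" and b: "cmod b \<le> r" for a b
  proof -
    let ?D = "cmod (1 - cnj b * a)"
    have "cmod (cnj b * a) \<le> 1 * 1" unfolding norm_mult using a b r by (intro mult_mono) auto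
    then have "?D \<le> 1 + 1" by (intro norm_triangle_le_diff add_mono) auto
    then have D2: "?D\<^sup>2 \<le> 2\<^sup>2" by (intro power_mono) auto
    have "(1 - r\<^sup>2) * (1 - r\<^sup>2) \<le> (1 - (cmod a)\<^sup>2) * (1 - (cmod b)\<^sup>2)"
      using a b r2 power_mono[OF a norm_ge_zero, of 2] power_mono[OF b norm_ge_zero, of 2]
      by (intro mult_mono) auto
    moreover have "t * ?D\<^sup>2 \<le> t * 2\<^sup>2" using D2 t0 by (intro mult_left_mono) auto
    moreover have "t * 2\<^sup>2 = (1 - r\<^sup>2) * (1 - r\<^sup>2)" by (simp add: t_def power2_eq_square)
    ultimately have "(cmod (a - b))\<^sup>2 \<le> ?D\<^sup>2 - t * ?D\<^sup>2"
      using Moebius_norm_identity[of b a] by linarith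
    also have "\<dots> = (sqrt (1 - t) * ?D)\<^sup>2" using t1 by (simp add: power_mult_distrib algebra_simps)
    finally have "cmod (a - b) \<le> sqrt (1 - t) * ?D"
      by (rule power2_le_imp_le) (use t1 in simp)
    then show ?thesis
      using Moebius_denom_nonzero[of a b] a b r by (simp add: ph_dist_def divide_le_eq)
  qed
  moreover have "sqrt (1 - t) < 1" using t0 by simp
  ultimately show ?thesis by blast
qed

text \<open>The denominator of \<open>ph_dist\<close> is now bounded below by \<open>1 - r\<close>,
  and the Moebius identity leaves a gap of at least \<open>t\<close> between
  \<open>(cmod b)\<^sup>2\<close> and 1.\<close>

lemma ph_dist_le_imp_norm_le:
  assumes r: "r < 1" and s: "0 \<le> s" "s < 1"
  shows "\<exists>q<1. \<forall>a b. cmod a \<le> r \<longrightarrow> cmod b \<le> 1 \<longrightarrow> ph_dist a b \<le> s \<longrightarrow> cmod b \<le> q"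
proof -
  define t where "t = (1 - s\<^sup>2) * (1 - r)\<^sup>2"
  have s2: "s\<^sup>2 < 1" using s by (simp add: power_less_one_iff)
  then have t0: "t > 0" using r by (simp add: t_def)
  have "cmod b \<le> sqrt (1 - t)" if a: "cmod a \<le> r" and b: "cmod b \<le> 1" and m: "ph_dist a b \<le> s" for a b
  proof -
    let ?D = "cmod (1 - cnj b * a)"
    have "cmod (cnj b * a) \<le> 1 * r" unfolding norm_mult using a b by (intro mult_mono) auto
    then have D: "?D \<ge> 1 - r" using norm_triangle_ineq2[of 1 "cnj b * a"] by simp
    then have D0: "?D > 0" using r by linarith
    have D2: "?D\<^sup>2 \<ge> (1 - r)\<^sup>2" using D r by (intro power_mono) auto
    have "cmod (a - b) \<le> s * ?D" using m D0 by (simp add: ph_dist_def divide_le_eq)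
    then have "(cmod (a - b))\<^sup>2 \<le> s\<^sup>2 * ?D\<^sup>2" using power_mono[of "cmod (a - b)" "s * ?D" 2] by (simp add: power_mult_distrib)
    then have "(1 - s\<^sup>2) * ?D\<^sup>2 \<le> (1 - (cmod a)\<^sup>2) * (1 - (cmod b)\<^sup>2)"
      using Moebius_norm_identity[of b a] by (simp add: algebra_simps)
    also have "\<dots> \<le> 1 * (1 - (cmod b)\<^sup>2)"
      using b by (intro mult_right_mono) (auto simp: power_le_one)
    finally have "(1 - s\<^sup>2) * ?D\<^sup>2 \<le> 1 - (cmod b)\<^sup>2" by simp
    moreover have "t \<le> (1 - s\<^sup>2) * ?D\<^sup>2"
      unfolding t_def using D2 s2 by (intro mult_left_mono) auto
    ultimately have "t \<le> 1 - (cmod b)\<^sup>2" by linarith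
    then show ?thesis by (intro real_le_rsqrt) simp
  qed
  moreover have "sqrt (1 - t) < 1" using t0 by simp
  ultimately show ?thesis by blast
qed

text \<open>A common form for both source spaces: \<open>J = {..<k}\<close> gives the polydisc and
  \<open>J = UNIV\<close> the open ball of the bidual, so each embedding argument is carried out
  once.\<close>

definition supp_ball :: "nat set \<Rightarrow> linf set" where
  "supp_ball J = {u :: linf. norm u < 1 \<and> (\<forall>j. j \<notin> J \<longrightarrow> apply_bcontfun u j = 0)}"

lemma supp_ball_polydisc: "supp_ball {..<k} = polydisc k"
  by (auto simp: supp_ball_def unit_ball_def coord_space_def not_less)

lemma supp_ball_UNIV: "supp_ball UNIV = ball 0 1"
  by (auto simp: supp_ball_def)

lemma emb_in_GP:
  fixes z u :: linf
  assumes z: "z \<in> cball 0 1" and r: "r < 1" "\<And>j. j \<in> J \<Longrightarrow> cmod (z (e j)) \<le> r"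
    and u: "u \<in> supp_ball J" and e: "inj_on e J"
  shows "delta (emb z J e u) \<in> GP (delta z)"
proof -
  \<comment> \<open>One radius below 1 covers the old and the new values of all changed coordinates;
    the unchanged coordinates have distance 0.\<close>
  define q where "q = max 0 (max r (norm u))"
  have q: "0 \<le> q" "q < 1" using r u by (auto simp: q_def supp_ball_def)
  obtain s where s: "s < 1" "\<And>a b. cmod a \<le> q \<Longrightarrow> cmod b \<le> q \<Longrightarrow> ph_dist a b \<le> s"
    using ph_dist_bounded_away[OF q] by blast
  have "ph_dist (z n) (emb z J e u n) \<le> max 0 s" for n
  proof (cases "n \<in> e ` J")
    case True
    then obtain j where j: "j \<in> J" "n = e j" by blast
    have "cmod (u j) \<le> q" using norm_bounded[of u j] by (simp add: q_def)
    moreover have "cmod (z (e j)) \<le> q" using r(2)[OF j(1)] by (simp add: q_def)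
    ultimately have "ph_dist (z n) (emb z J e u n) \<le> s" using s(2) j apply_emb_inj[OF e j(1)] by simp
    then show ?thesis by simp
  qed (simp add: apply_emb)
  moreover have "max 0 s < 1" using s(1) by simp
  moreover have "emb z J e u \<in> cball 0 1" by (rule emb_in_cball[OF z]) (use u in \<open>simp add: supp_ball_def\<close>)
  ultimately show ?thesis unfolding GP_delta_eq[OF z] by blast
qed

text \<open>The metric \<open>d\<close> is left open so that both \<open>gdist_polydisc\<close> and
  \<open>gdist_linf_ball\<close> can be inserted, each being equal to \<open>poly_dist\<close> on
  its ball.\<close>

lemma emb_isometric:
  fixes z :: linf
  assumes z: "z \<in> cball 0 1" and r: "r < 1" "\<And>j. j \<in> J \<Longrightarrow> cmod (z (e j)) \<le> r" and e: "inj_on e J"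
    and d: "\<And>u v. u \<in> supp_ball J \<Longrightarrow> v \<in> supp_ball J \<Longrightarrow> d u v = poly_dist u v"
  shows "isometric_map (supp_ball J) d (GP (delta z)) gdist_c0 (\<lambda>u. delta (emb z J e u))"
  unfolding isometric_map_def
proof (intro conjI ballI)
  have B: "u \<in> cball 0 1" and S: "\<And>j. j \<notin> J \<Longrightarrow> u j = 0" if "u \<in> supp_ball J" for u :: linf
    using that by (auto simp: supp_ball_def)
  show "(\<lambda>u. delta (emb z J e u)) \<in> supp_ball J \<rightarrow> GP (delta z)"
    using emb_in_GP[OF z r _ e] by blast
  show "inj_on (\<lambda>u. delta (emb z J e u)) (supp_ball J)"
  proof (rule inj_onI)
    fix u v assume u: "u \<in> supp_ball J" and v: "v \<in> supp_ball J" and "delta (emb z J e u) = delta (emb z J e v)"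
    then have "emb z J e u = emb z J e v"
      by (intro delta_inj emb_in_cball z B)
    then have "pull J e (emb z J e u) = pull J e (emb z J e v)" by simp
    then show "u = v" by (simp add: pull_emb[OF e] S[OF u] S[OF v])
  qed
  fix u v assume u: "u \<in> supp_ball J" and v: "v \<in> supp_ball J"
  show "gdist_c0 (delta (emb z J e u)) (delta (emb z J e v)) = d u v"
    unfolding gdist_c0_eq[OF emb_in_cball[OF z B[OF u]] emb_in_cball[OF z B[OF v]]] d[OF u v]
    by (rule poly_dist_emb[OF e z B[OF u] S[OF u] B[OF v] S[OF v]])
qed

section \<open>The Gleason parts in the five cases\<close>

lemma cSUP_norm_bdd: "bdd_above ((\<lambda>n. cmod (apply_bcontfun w n)) ` A)"
  by (rule bdd_aboveI2[where M = "norm w"]) (rule norm_bounded)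

text \<open>On \<open>N1\<close> any bound \<open>s < 1\<close> forces equality. On
  \<open>N2\<close>, where \<open>z\<close> stays in a disc of radius below 1,
  \<open>ph_dist_bounded_away\<close> and \<open>ph_dist_le_imp_norm_le\<close> give the two
  directions. A nonempty \<open>N2\<close> makes the suprema meaningful.\<close>

lemma GP_eq_if_no_N3:
  fixes z :: linf
  assumes z: "z \<in> cball 0 1" and N1: "N1 = {n. cmod (z n) = 1}" and N2: "N2 = UNIV - N1" "N2 \<noteq> {}"
    and sup: "(SUP n\<in>N2. cmod (z n)) < 1"
  shows "GP (delta z) = {delta w | w. w \<in> cball 0 1 \<and> (\<forall>n\<in>N1. apply_bcontfun w n = z n) \<and>
    (SUP n\<in>N2. cmod (apply_bcontfun w n)) < 1}"
proof -
  let ?r = "SUP n\<in>N2. cmod (z n)"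
  have zr: "cmod (z n) \<le> ?r" if "n \<in> N2" for n by (rule cSUP_upper[OF that cSUP_norm_bdd])
  have r0: "?r \<ge> 0" using N2(2) zr norm_ge_zero order_trans by blast
  have "(\<exists>s<1. \<forall>n. ph_dist (z n) (w n) \<le> s) \<longleftrightarrow> (\<forall>n\<in>N1. w n = z n) \<and> (SUP n\<in>N2. cmod (w n)) < 1"
    if w: "w \<in> cball 0 1" for w :: linf
  proof (intro iffI conjI)
    assume "\<exists>s<1. \<forall>n. ph_dist (z n) (w n) \<le> s"
    then obtain s where s: "s < 1" "\<And>n. ph_dist (z n) (w n) \<le> s" by blast
    have s0: "0 \<le> s" using s(2)[of 0] ph_dist_nonneg[of "z 0" "w 0"] by linarith
    show "\<forall>n\<in>N1. w n = z n"
    proof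
      fix n assume "n \<in> N1"
      then have "cmod (z n) = 1" by (simp add: N1)
      then show "w n = z n" using ph_dist_unimodular[of "z n" "w n"] s(2)[of n] s(1) ph_dist_commute[of "z n" "w n"] by force
    qed
    obtain q where q: "q < 1" "\<And>a b. cmod a \<le> ?r \<Longrightarrow> cmod b \<le> 1 \<Longrightarrow> ph_dist a b \<le> s \<Longrightarrow> cmod b \<le> q"
      using ph_dist_le_imp_norm_le[OF sup s0 s(1)] by blast
    have w1: "cmod (w n) \<le> 1" for n using norm_bounded[of w n] w by simp
    have "(SUP n\<in>N2. cmod (w n)) \<le> q"
      by (rule cSUP_least[OF N2(2)]) (rule q(2)[OF zr w1 s(2)])
    with q(1) show "(SUP n\<in>N2. cmod (w n)) < 1" by linarith
  next
    assume H: "(\<forall>n\<in>N1. w n = z n) \<and> (SUP n\<in>N2. cmod (w n)) < 1"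
    let ?q = "max ?r (SUP n\<in>N2. cmod (w n))"
    have q: "0 \<le> ?q" "?q < 1" using r0 sup H by auto
    obtain s where s: "s < 1" "\<And>a b. cmod a \<le> ?q \<Longrightarrow> cmod b \<le> ?q \<Longrightarrow> ph_dist a b \<le> s"
      using ph_dist_bounded_away[OF q] by blast
    have "ph_dist (z n) (w n) \<le> max 0 s" for n
    proof (cases "n \<in> N1")
      case True
      then show ?thesis using H by simp
    next
      case False
      then have n: "n \<in> N2" using N2 by blast
      have "cmod (w n) \<le> (SUP n\<in>N2. cmod (w n))" by (rule cSUP_upper[OF n cSUP_norm_bdd])
      then have "ph_dist (z n) (w n) \<le> s" using zr[OF n] by (intro s(2)) auto
      then show ?thesis by simp
    qed
    moreover have "max 0 s < 1" using s(1) by simp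
    ultimately show "\<exists>s<1. \<forall>n. ph_dist (z n) (w n) \<le> s" by blast
  qed
  then show ?thesis unfolding GP_delta_eq[OF z] by blast
qed

text \<open>For surjectivity \<open>pull\<close> recovers a preimage: outside \<open>N2\<close>
  every point of the part coincides with \<open>z\<close>, so nothing is lost.\<close>

lemma emb_image_eq_GP:
  fixes z :: linf
  assumes z: "z \<in> cball 0 1" and N1: "N1 = {n. cmod (z n) = 1}" and N2: "N2 = UNIV - N1" "N2 \<noteq> {}"
    and sup: "(SUP n\<in>N2. cmod (z n)) < 1" and e: "bij_betw e J N2"
  shows "(\<lambda>u. delta (emb z J e u)) ` supp_ball J = GP (delta z)"
proof (intro equalityI subsetI)
  fix \<psi> assume "\<psi> \<in> GP (delta z)"
  then obtain w :: linf where w: "w \<in> cball 0 1" "\<And>n. n \<in> N1 \<Longrightarrow> w n = z n" "(SUP n\<in>N2. cmod (w n)) < 1"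
      "\<psi> = delta w"
    unfolding GP_eq_if_no_N3[OF z N1 N2 sup] by blast
  have le: "cmod (w n) \<le> (SUP n\<in>N2. cmod (w n))" if "n \<in> N2" for n
    by (rule cSUP_upper[OF that cSUP_norm_bdd])
  have s0: "0 \<le> (SUP n\<in>N2. cmod (w n))" using N2(2) le norm_ge_zero order_trans by blast
  have mem: "e j \<in> N2" if "j \<in> J" for j using e that by (auto simp: bij_betw_def)
  have "norm (pull J e w) \<le> (SUP n\<in>N2. cmod (w n))"
    unfolding linf_norm_le_iff using le mem s0 by (simp add: apply_pull)
  then have "pull J e w \<in> supp_ball J" using w(3) by (simp add: supp_ball_def apply_pull)
  moreover have "emb z J e (pull J e w) = w"
  proof (rule bcontfun_eqI)
    fix n
    show "emb z J e (pull J e w) n = w n"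
    proof (cases "n \<in> N2")
      case True
      then obtain j where "j \<in> J" "n = e j" using e by (auto simp: bij_betw_def)
      then show ?thesis using apply_emb_inj[of e J j] e by (simp add: bij_betw_def apply_pull)
    next
      case False
      then have "n \<in> N1" "n \<notin> e ` J" using N2(1) e by (auto simp: bij_betw_def)
      then show ?thesis using w(2) by (simp add: apply_emb)
    qed
  qed
  ultimately show "\<psi> \<in> (\<lambda>u. delta (emb z J e u)) ` supp_ball J"
    by (intro image_eqI[of _ _ "pull J e w"]) (simp_all add: w(4))
next
  fix \<psi> assume "\<psi> \<in> (\<lambda>u. delta (emb z J e u)) ` supp_ball J"
  then obtain u where u: "u \<in> supp_ball J" "\<psi> = delta (emb z J e u)" by blast
  have "cmod (z (e j)) \<le> (SUP n\<in>N2. cmod (z n))" if "j \<in> J" for j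
    using e that by (intro cSUP_upper cSUP_norm_bdd) (auto simp: bij_betw_def)
  then show "\<psi> \<in> GP (delta z)"
    unfolding u(2) using e by (intro emb_in_GP[OF z sup _ u(1)]) (auto simp: bij_betw_def)
qed

text \<open>The moduli of the chosen coordinates may approach 1, so no common radius exists and each
  coordinate gets its own scaled disc. The scaling makes \<open>ph_dist\<close> at most
  \<open>norm (v - u)\<close> in all coordinates and sends 0 to \<open>z\<close>, which yields both
  membership in the part and continuity.\<close>

lemma continuous_injection_into_GP:
  fixes z :: linf and e :: "nat \<Rightarrow> nat"
  assumes z: "z \<in> cball 0 1" and e: "inj e" and ze: "\<And>j::nat. cmod (z (e j)) < 1"
  shows "\<exists>\<Phi>. \<Phi> \<in> ball 0 1 \<rightarrow> GP (delta z) \<and> inj_on \<Phi> (ball (0::linf) 1) \<and>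
     (\<forall>u\<in>ball 0 1. ((\<lambda>v. gdist_c0 (\<Phi> v) (\<Phi> u)) \<longlongrightarrow> 0) (at u within ball 0 1))"
proof -
  \<comment> \<open>Half the distance from \<open>z (e j)\<close> to the unit circle: the disc of
    radius \<open>c j\<close> about \<open>z (e j)\<close> stays \<open>c j\<close> away from the
    circle. There \<open>ph_dist\<close> is at most the Euclidean distance divided by
    \<open>c j\<close>, which cancels the scaling in \<open>f\<close>.\<close>
  define c where "c j = (1 - cmod (z (e j))) / 2" for j
  have c: "c j > 0" "cmod (z (e j)) + c j = 1 - c j" for j using ze[of j] by (auto simp: c_def field_simps)
  define f where "f u j = z (e j) + of_real (c j) * u j" for u :: linf and j :: nat
  have f: "cmod (f u j) \<le> 1 - c j" if "u \<in> ball 0 1" for u :: linf and j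
  proof -
    have "cmod (u j) \<le> 1" using norm_bounded[of u j] that by simp
    then have "c j * cmod (u j) \<le> c j" using c(1)[of j] by (intro mult_left_le) auto
    moreover have "cmod (f u j) \<le> cmod (z (e j)) + c j * cmod (u j)"
      using norm_triangle_ineq[of "z (e j)" "of_real (c j) * u j"] c(1)[of j] by (simp add: f_def norm_mult)
    ultimately show ?thesis using c(2)[of j] by linarith
  qed
  define W where "W u = emb z UNIV e (linf_of (f u))" for u
  have fB: "linf_of (f u) j = f u j" if "u \<in> ball 0 1" for u :: linf and j
  proof (rule apply_linf_of)
    show "cmod (f u n) \<le> 1" for n using f[OF that, of n] c(1)[of n] by linarith
  qed
  have We: "W u (e j) = f u j" if "u \<in> ball 0 1" for u :: linf and j
    unfolding W_def using apply_emb_inj[OF e UNIV_I] fB[OF that] by simp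
  have Wo: "W u n = z n" if "n \<notin> range e" for u :: linf and n
    unfolding W_def using that by (simp add: apply_emb)
  have WB: "W u \<in> cball 0 1" if u: "u \<in> ball 0 1" for u :: linf
  proof -
    have "cmod (f u j) \<le> 1" for j using f[OF u, of j] c(1)[of j] by linarith
    then show ?thesis
      unfolding W_def by (intro emb_in_cball[OF z]) (simp add: linf_norm_le_iff fB[OF u])
  qed
  have md: "ph_dist a b \<le> cmod (a - b) / c j" if "cmod a \<le> 1" "cmod b \<le> 1 - c j" for a b :: complex and j
  proof -
    have "cmod b * cmod a \<le> (1 - c j) * 1" using that order_trans[OF norm_ge_zero that(2)] by (intro mult_mono) auto
    then have "cmod (1 - cnj b * a) \<ge> c j"
      using norm_triangle_ineq2[of 1 "cnj b * a"] by (simp add: norm_mult)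
    then show ?thesis unfolding ph_dist_def using c(1)[of j] by (intro divide_left_mono mult_pos_pos) auto
  qed
  have md_W: "ph_dist (W v n) (W u n) \<le> norm (v - u)" if u: "u \<in> ball 0 1" and v: "v \<in> ball 0 1" for u v :: linf and n
  proof (cases "n \<in> range e")
    case True
    then obtain j where n: "n = e j" by blast
    have "f v j - f u j = of_real (c j) * (v - u) j" by (simp add: f_def algebra_simps)
    then have "cmod (f v j - f u j) / c j = cmod ((v - u) j)" using c(1)[of j] by (simp add: norm_mult)
    moreover have "ph_dist (f v j) (f u j) \<le> cmod (f v j - f u j) / c j"
      using f[OF v, of j] f[OF u, of j] c(1)[of j] by (intro md) auto
    ultimately show ?thesis using norm_bounded[of "v - u" j] by (simp add: n We[OF u] We[OF v])
  qed (simp add: Wo)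
  have "delta (W u) \<in> GP (delta z)" if u: "u \<in> ball 0 1" for u :: linf
  proof -
    have z0: "W 0 = z"
    proof (rule bcontfun_eqI)
      show "W 0 n = z n" for n
        by (cases "n \<in> range e") (auto simp: We Wo f_def)
    qed
    have "\<forall>n. ph_dist (z n) (W u n) \<le> norm u"
      using md_W[OF u, of 0] by (simp add: z0)
    then show ?thesis unfolding GP_delta_eq[OF z] using WB[OF u] u by auto
  qed
  moreover have "inj_on (\<lambda>u. delta (W u)) (ball 0 1)"
  proof (rule inj_onI)
    fix u v :: linf assume u: "u \<in> ball 0 1" and v: "v \<in> ball 0 1" and "delta (W u) = delta (W v)"
    then have eq: "W u = W v" by (intro delta_inj WB)
    show "u = v"
    proof (rule bcontfun_eqI)
      fix j
      have "f u j = f v j" using We[OF u, of j] We[OF v, of j] eq by simp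
      then show "u j = v j" using c(1)[of j] by (simp add: f_def)
    qed
  qed
  moreover have "((\<lambda>v. gdist_c0 (delta (W v)) (delta (W u))) \<longlongrightarrow> 0) (at u within ball 0 1)"
    if u: "u \<in> ball 0 1" for u :: linf
  proof (rule Lim_null_comparison)
    have "((\<lambda>v. 2 * norm (v - u)) \<longlongrightarrow> 2 * norm (u - u)) (at u within ball 0 1)"
      by (intro tendsto_intros)
    then show "((\<lambda>v. 2 * norm (v - u)) \<longlongrightarrow> 0) (at u within ball 0 1)" by simp
    have "norm (gdist_c0 (delta (W v)) (delta (W u))) \<le> 2 * norm (v - u)"
      if v: "v \<in> ball 0 1" and d: "dist v u < 1" for v :: linf
    proof -
      have "poly_dist (W v) (W u) \<le> 2 * norm (v - u)"
        using d by (intro poly_dist_le_ph_dist WB u v md_W) (simp add: dist_norm)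
      then show ?thesis
        using poly_dist_nonneg[OF WB[OF v] WB[OF u]] by (simp add: gdist_c0_eq[OF WB[OF v] WB[OF u]])
    qed
    then show "\<forall>\<^sub>F v in at u within ball 0 1. norm (gdist_c0 (delta (W v)) (delta (W u))) \<le> 2 * norm (v - u)"
      unfolding eventually_at by (intro exI[of _ 1]) auto
  qed
  ultimately show ?thesis by (intro exI[of _ "\<lambda>u. delta (W u)"]) auto
qed

text \<open>Brings the open ball into the form that \<open>GP_eq_if_no_N3\<close> takes when
  \<open>N1\<close> is empty.\<close>

lemma mem_ball_iff_SUP:
  fixes w :: linf
  shows "w \<in> ball 0 1 \<longleftrightarrow> w \<in> cball 0 1 \<and> (SUP n. cmod (w n)) < 1"
proof -
  have "(SUP n. cmod (w n)) \<le> norm w" by (rule cSUP_least) (auto intro: norm_bounded)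
  moreover have "norm w \<le> (SUP n. cmod (w n))"
    unfolding linf_norm_le_iff by (intro allI cSUP_upper UNIV_I cSUP_norm_bdd)
  ultimately show ?thesis by auto
qed

lemma GP_delta_ball:
  assumes z: "z \<in> ball 0 1"
  shows "GP (delta z) = {delta w | w. w \<in> ball 0 1}"
proof -
  have zc: "z \<in> cball 0 1" and sup: "(SUP n\<in>UNIV. cmod (z n)) < 1" using z mem_ball_iff_SUP[of z] by blast+
  have "cmod (z n) < 1" for n using norm_bounded[of z n] z by simp
  then have "{} = {n. cmod (z n) = 1}" by (auto simp: less_le)
  from GP_eq_if_no_N3[OF zc this _ _ sup] show ?thesis unfolding mem_ball_iff_SUP by simp
qed

text \<open>Treated apart from \<open>GP_eq_if_no_N3\<close>, because here \<open>N2\<close> is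
  empty and its supremum would carry no meaning.\<close>

lemma GP_delta_unimodular:
  fixes z :: linf
  assumes z: "z \<in> cball 0 1" and "\<And>n. cmod (z n) = 1"
  shows "GP (delta z) = {delta z}"
proof -
  have "w = z" if "s < 1" "\<And>n. ph_dist (z n) (w n) \<le> s" for w :: linf and s
  proof (rule bcontfun_eqI)
    fix n
    show "w n = z n"
      using ph_dist_unimodular[OF assms(2)[of n], of "w n"] that(2)[of n] that(1) ph_dist_commute[of "z n" "w n"]
      by force
  qed
  moreover have "\<exists>s<1. \<forall>n. ph_dist (z n) (z n) \<le> s" by (intro exI[of _ 0]) simp
  ultimately show ?thesis unfolding GP_delta_eq[OF z] using z by blast
qed

theorem corollary2p6:
  fixes z :: linf and N1 N2 N3 :: "nat set"
  assumes "z \<in> cball 0 1" and "assoc_decomposition z N1 N2 N3"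
  shows
    "(N2 = UNIV \<or> N1 = UNIV \<or> (N3 = {} \<and> N1 \<noteq> {} \<and> N2 \<noteq> {}) \<or>
       (infinite N3 \<and> N2 = {}) \<or> (infinite N2 \<and> infinite N3))
     \<and>
     (N2 = UNIV \<longrightarrow>
        z \<in> ball 0 1 \<and>
        GP (delta z) = GP (delta 0) \<and>
        GP (delta 0) = {delta w | w. w \<in> ball 0 1} \<and>
        bij_betw delta (ball 0 1) (GP (delta z)))
     \<and>
     (N1 = UNIV \<longrightarrow>
        (\<forall>n. cmod (z n) = 1) \<and> GP (delta z) = {delta z})
     \<and>
     (N3 = {} \<and> N1 \<noteq> {} \<and> N2 \<noteq> {} \<longrightarrow>
        GP (delta z) =
          {delta w | w. w \<in> cball 0 1 \<and> (\<forall>n\<in>N1. apply_bcontfun w n = z n) \<and>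
             (SUP n\<in>N2. cmod (apply_bcontfun w n)) < 1} \<and>
        (\<forall>k. finite N2 \<and> card N2 = k \<longrightarrow>
           (\<exists>e \<Phi>.
              bij_betw e {..<k} N2 \<and>
              (\<forall>u\<in>polydisc k. \<exists>w\<in>cball 0 1.
                 \<Phi> u = delta w \<and> (\<forall>n\<in>N1. apply_bcontfun w n = z n) \<and>
                 (\<forall>j<k. apply_bcontfun w (e j) = apply_bcontfun u j)) \<and>
              isometric_map (polydisc k) (gdist_polydisc k) (GP (delta z)) gdist_c0 \<Phi> \<and>
              \<Phi> ` polydisc k = GP (delta z))) \<and>
        (infinite N2 \<longrightarrow>
           (\<exists>e \<Phi>.
              bij_betw e UNIV N2 \<and>
              (\<forall>u\<in>ball 0 1. \<exists>w\<in>cball 0 1.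
                 \<Phi> u = delta w \<and> (\<forall>n\<in>N1. apply_bcontfun w n = z n) \<and>
                 (\<forall>j. apply_bcontfun w (e j) = apply_bcontfun u j)) \<and>
              isometric_map (ball 0 1) gdist_linf_ball (GP (delta z)) gdist_c0 \<Phi> \<and>
              \<Phi> ` ball 0 1 = GP (delta z))))
     \<and>
     (infinite N3 \<and> N2 = {} \<longrightarrow>
        (\<forall>k\<ge>1. \<exists>\<Phi>. isometric_map (polydisc k) (gdist_polydisc k) (GP (delta z)) gdist_c0 \<Phi>) \<and>
        (\<exists>\<Phi>. \<Phi> \<in> ball 0 1 \<rightarrow> GP (delta z) \<and> inj_on \<Phi> (ball (0::linf) 1) \<and>
           (\<forall>u\<in>ball 0 1. ((\<lambda>v. gdist_c0 (\<Phi> v) (\<Phi> u)) \<longlongrightarrow> 0) (at u within ball 0 1))))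
     \<and>
     (infinite N2 \<and> infinite N3 \<longrightarrow>
        (\<exists>\<Phi>. isometric_map (ball 0 1) gdist_linf_ball (GP (delta z)) gdist_c0 \<Phi>))"
proof -
  note z = assms(1)
  have N1: "N1 = {n. cmod (z n) = 1}" and N23: "N2 \<union> N3 = UNIV - N1" "N2 \<inter> N3 = {}"
    and N2: "N2 \<noteq> {} \<Longrightarrow> (SUP n\<in>N2. cmod (z n)) < 1"
    and N3: "N3 \<noteq> {} \<Longrightarrow> (SUP n\<in>N3. cmod (z n)) = 1"
    and conv: "infinite N3 \<Longrightarrow> finite N2 \<Longrightarrow> N2 = {}"
    using assms(2) unfolding assoc_decomposition_def by blast+
  have lt: "cmod (z n) < 1" if "n \<notin> N1" for n
    using norm_bounded[of z n] z that by (simp add: N1 less_le)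
  \<comment> \<open>A finite set would attain its supremum 1, while every modulus outside
    \<open>N1\<close> is below 1.\<close>
  have N3_inf: "infinite N3" if ne: "N3 \<noteq> {}"
  proof
    assume fin: "finite N3"
    then have "(SUP n\<in>N3. cmod (z n)) = Max ((\<lambda>n. cmod (z n)) ` N3)"
      using ne by (intro cSup_eq_Max) auto
    also have "\<dots> < 1" using fin ne lt N23(1) by (subst Max_less_iff) auto
    finally show False using N3[OF ne] by simp
  qed
  have zN2: "cmod (z n) \<le> (SUP n\<in>N2. cmod (z n))" if "n \<in> N2" for n
    by (rule cSUP_upper[OF that cSUP_norm_bdd])
  have part0: "N2 = UNIV \<or> N1 = UNIV \<or> (N3 = {} \<and> N1 \<noteq> {} \<and> N2 \<noteq> {}) \<or>
       (infinite N3 \<and> N2 = {}) \<or> (infinite N2 \<and> infinite N3)"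
    using N3_inf conv N23(1) by blast
  have part1: "z \<in> ball 0 1 \<and> GP (delta z) = GP (delta 0) \<and>
        GP (delta 0) = {delta w | w. w \<in> ball 0 1} \<and> bij_betw delta (ball 0 1) (GP (delta z))"
    if "N2 = UNIV"
  proof -
    have zb: "z \<in> ball 0 1" unfolding mem_ball_iff_SUP using N2 that z by simp
    have z0: "(0::linf) \<in> ball 0 1" by simp
    have "inj_on delta (ball 0 1)" by (rule inj_onI, rule delta_inj) auto
    then have "bij_betw delta (ball 0 1) (GP (delta z))"
      unfolding GP_delta_ball[OF zb] by (auto simp: bij_betw_def)
    with zb show ?thesis by (simp only: GP_delta_ball[OF zb] GP_delta_ball[OF z0])
  qed
  have part2: "(\<forall>n. cmod (z n) = 1) \<and> GP (delta z) = {delta z}" if "N1 = UNIV"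
    using that GP_delta_unimodular[OF z] by (auto simp: N1)
  have part3: "GP (delta z) =
          {delta w | w. w \<in> cball 0 1 \<and> (\<forall>n\<in>N1. apply_bcontfun w n = z n) \<and>
             (SUP n\<in>N2. cmod (apply_bcontfun w n)) < 1} \<and>
        (\<forall>k. finite N2 \<and> card N2 = k \<longrightarrow>
           (\<exists>e \<Phi>.
              bij_betw e {..<k} N2 \<and>
              (\<forall>u\<in>polydisc k. \<exists>w\<in>cball 0 1.
                 \<Phi> u = delta w \<and> (\<forall>n\<in>N1. apply_bcontfun w n = z n) \<and>
                 (\<forall>j<k. apply_bcontfun w (e j) = apply_bcontfun u j)) \<and>
              isometric_map (polydisc k) (gdist_polydisc k) (GP (delta z)) gdist_c0 \<Phi> \<and>
              \<Phi> ` polydisc k = GP (delta z))) \<and>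
        (infinite N2 \<longrightarrow>
           (\<exists>e \<Phi>.
              bij_betw e UNIV N2 \<and>
              (\<forall>u\<in>ball 0 1. \<exists>w\<in>cball 0 1.
                 \<Phi> u = delta w \<and> (\<forall>n\<in>N1. apply_bcontfun w n = z n) \<and>
                 (\<forall>j. apply_bcontfun w (e j) = apply_bcontfun u j)) \<and>
              isometric_map (ball 0 1) gdist_linf_ball (GP (delta z)) gdist_c0 \<Phi> \<and>
              \<Phi> ` ball 0 1 = GP (delta z)))"
    if H: "N3 = {} \<and> N1 \<noteq> {} \<and> N2 \<noteq> {}"
  proof -
    have N2': "N2 = UNIV - N1" "N2 \<noteq> {}" using N23(1) H by auto
    note sup = N2[OF N2'(2)]
    have coords: "\<exists>w\<in>cball 0 1. delta (emb z J e u) = delta w \<and> (\<forall>n\<in>N1. apply_bcontfun w n = z n) \<and>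
        (\<forall>j\<in>J. apply_bcontfun w (e j) = apply_bcontfun u j)"
      if e: "bij_betw e J N2" and u: "u \<in> supp_ball J" for J e u
    proof (intro bexI[of _ "emb z J e u"] conjI ballI)
      show "emb z J e u n = z n" if "n \<in> N1" for n
        using that e N2'(1) by (auto simp: apply_emb bij_betw_def)
      show "emb z J e u (e j) = u j" if "j \<in> J" for j
        using apply_emb_inj[OF bij_betw_imp_inj_on[OF e] that] .
      show "emb z J e u \<in> cball 0 1"
        by (rule emb_in_cball[OF z]) (use u in \<open>simp add: supp_ball_def\<close>)
    qed simp
    have iso: "isometric_map (supp_ball J) d (GP (delta z)) gdist_c0 (\<lambda>u. delta (emb z J e u))"
      if e: "bij_betw e J N2"
        and d: "\<And>u v. u \<in> supp_ball J \<Longrightarrow> v \<in> supp_ball J \<Longrightarrow> d u v = poly_dist u v" for J e d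
    proof (rule emb_isometric[OF z sup _ bij_betw_imp_inj_on[OF e] d])
      show "cmod (z (e j)) \<le> (SUP n\<in>N2. cmod (z n))" if "j \<in> J" for j
        using bij_betw_apply[OF e that] by (rule zN2)
    qed
    have fin: "\<exists>e \<Phi>. bij_betw e {..<k} N2 \<and>
              (\<forall>u\<in>polydisc k. \<exists>w\<in>cball 0 1.
                 \<Phi> u = delta w \<and> (\<forall>n\<in>N1. apply_bcontfun w n = z n) \<and>
                 (\<forall>j<k. apply_bcontfun w (e j) = apply_bcontfun u j)) \<and>
              isometric_map (polydisc k) (gdist_polydisc k) (GP (delta z)) gdist_c0 \<Phi> \<and>
              \<Phi> ` polydisc k = GP (delta z)" if k: "finite N2 \<and> card N2 = k" for k
    proof -
      obtain e where e: "bij_betw e {..<k} N2"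
        using ex_bij_betw_nat_finite[of N2] k by (auto simp: lessThan_atLeast0)
      show ?thesis
      proof (intro exI conjI ballI)
        show "bij_betw e {..<k} N2" by (rule e)
        show "\<exists>w\<in>cball 0 1. delta (emb z {..<k} e u) = delta w \<and> (\<forall>n\<in>N1. apply_bcontfun w n = z n) \<and>
                 (\<forall>j<k. apply_bcontfun w (e j) = apply_bcontfun u j)" if "u \<in> polydisc k" for u
          using coords[OF e, of u] that by (simp only: supp_ball_polydisc lessThan_iff Ball_def)
        show "isometric_map (polydisc k) (gdist_polydisc k) (GP (delta z)) gdist_c0 (\<lambda>u. delta (emb z {..<k} e u))"
          using iso[OF e, of "gdist_polydisc k"] gdist_polydisc_eq by (simp only: supp_ball_polydisc)
        show "(\<lambda>u. delta (emb z {..<k} e u)) ` polydisc k = GP (delta z)"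
          using emb_image_eq_GP[OF z N1 N2' sup e] by (simp only: supp_ball_polydisc)
      qed
    qed
    have inf: "\<exists>e \<Phi>. bij_betw e UNIV N2 \<and>
              (\<forall>u\<in>ball 0 1. \<exists>w\<in>cball 0 1.
                 \<Phi> u = delta w \<and> (\<forall>n\<in>N1. apply_bcontfun w n = z n) \<and>
                 (\<forall>j. apply_bcontfun w (e j) = apply_bcontfun u j)) \<and>
              isometric_map (ball 0 1) gdist_linf_ball (GP (delta z)) gdist_c0 \<Phi> \<and>
              \<Phi> ` ball 0 1 = GP (delta z)" if "infinite N2"
    proof -
      have e: "bij_betw (enumerate N2) UNIV N2" by (rule bij_enumerate[OF that])
      show ?thesis
      proof (intro exI conjI ballI)
        show "bij_betw (enumerate N2) UNIV N2" by (rule e)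
        show "\<exists>w\<in>cball 0 1. delta (emb z UNIV (enumerate N2) u) = delta w \<and> (\<forall>n\<in>N1. apply_bcontfun w n = z n) \<and>
                 (\<forall>j. apply_bcontfun w (enumerate N2 j) = apply_bcontfun u j)" if "u \<in> ball 0 1" for u
          using coords[OF e, of u] that by (simp only: supp_ball_UNIV ball_UNIV)
        show "isometric_map (ball 0 1) gdist_linf_ball (GP (delta z)) gdist_c0 (\<lambda>u. delta (emb z UNIV (enumerate N2) u))"
          using iso[OF e, of gdist_linf_ball] by (simp add: supp_ball_UNIV gdist_linf_ball_def gdist_c0_eq)
        show "(\<lambda>u. delta (emb z UNIV (enumerate N2) u)) ` ball 0 1 = GP (delta z)"
          using emb_image_eq_GP[OF z N1 N2' sup e] by (simp only: supp_ball_UNIV)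
      qed
    qed
    show ?thesis using GP_eq_if_no_N3[OF z N1 N2' sup] fin inf by blast
  qed
  have part4: "(\<forall>k\<ge>1. \<exists>\<Phi>. isometric_map (polydisc k) (gdist_polydisc k) (GP (delta z)) gdist_c0 \<Phi>) \<and>
        (\<exists>\<Phi>. \<Phi> \<in> ball 0 1 \<rightarrow> GP (delta z) \<and> inj_on \<Phi> (ball (0::linf) 1) \<and>
           (\<forall>u\<in>ball 0 1. ((\<lambda>v. gdist_c0 (\<Phi> v) (\<Phi> u)) \<longlongrightarrow> 0) (at u within ball 0 1)))"
    if H: "infinite N3 \<and> N2 = {}"
  proof
    let ?e = "enumerate N3"
    have e: "bij_betw ?e UNIV N3" by (rule bij_enumerate) (use H in blast)
    have ze: "cmod (z (?e j)) < 1" for j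
      by (rule lt) (use bij_betw_apply[OF e, of j] N23(1) in auto)
    show "\<forall>k\<ge>1. \<exists>\<Phi>. isometric_map (polydisc k) (gdist_polydisc k) (GP (delta z)) gdist_c0 \<Phi>"
    proof (intro allI impI)
      fix k :: nat
      \<comment> \<open>Only finitely many coordinates of \<open>N3\<close> are freed, so their
        moduli have a maximum below 1 although the supremum over \<open>N3\<close> is 1.
        \<open>insert 0\<close> makes the maximum range over a nonempty set.\<close>
      let ?r = "Max (insert 0 ((\<lambda>j. cmod (z (?e j))) ` {..<k}))"
      have "isometric_map (supp_ball {..<k}) (gdist_polydisc k) (GP (delta z)) gdist_c0
          (\<lambda>u. delta (emb z {..<k} ?e u))"
      proof (rule emb_isometric[OF z, of ?r])
        show "?r < 1" using ze by (subst Max_less_iff) auto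
        show "cmod (z (?e j)) \<le> ?r" if "j \<in> {..<k}" for j using that by (intro Max_ge) auto
        show "inj_on ?e {..<k}" by (rule inj_on_subset[OF bij_betw_imp_inj_on[OF e]]) simp
      qed (simp add: supp_ball_polydisc gdist_polydisc_eq)
      then show "\<exists>\<Phi>. isometric_map (polydisc k) (gdist_polydisc k) (GP (delta z)) gdist_c0 \<Phi>"
        unfolding supp_ball_polydisc by blast
    qed
    show "\<exists>\<Phi>. \<Phi> \<in> ball 0 1 \<rightarrow> GP (delta z) \<and> inj_on \<Phi> (ball (0::linf) 1) \<and>
           (\<forall>u\<in>ball 0 1. ((\<lambda>v. gdist_c0 (\<Phi> v) (\<Phi> u)) \<longlongrightarrow> 0) (at u within ball 0 1))"
      by (rule continuous_injection_into_GP[OF z bij_betw_imp_inj_on[OF e] ze])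
  qed
  have part5: "\<exists>\<Phi>. isometric_map (ball 0 1) gdist_linf_ball (GP (delta z)) gdist_c0 \<Phi>"
    if H: "infinite N2 \<and> infinite N3"
  proof -
    \<comment> \<open>The variables occupy \<open>N2\<close> alone, where the moduli have a common
      bound below 1; the coordinates in \<open>N3\<close> stay fixed at those of
      \<open>z\<close>.\<close>
    let ?e = "enumerate N2"
    have e: "bij_betw ?e UNIV N2" by (rule bij_enumerate) (use H in blast)
    have sup: "(SUP n\<in>N2. cmod (z n)) < 1" by (rule N2) (use H in auto)
    have "isometric_map (supp_ball UNIV) gdist_linf_ball (GP (delta z)) gdist_c0
        (\<lambda>u. delta (emb z UNIV ?e u))"
    proof (rule emb_isometric[OF z sup _ bij_betw_imp_inj_on[OF e]])
      show "cmod (z (?e j)) \<le> (SUP n\<in>N2. cmod (z n))" for j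
        by (rule zN2[OF bij_betw_apply[OF e UNIV_I]])
    qed (simp add: supp_ball_UNIV gdist_linf_ball_def gdist_c0_eq)
    then show ?thesis unfolding supp_ball_UNIV by blast
  qed
  show ?thesis
    by (rule conjI[OF part0 conjI[OF impI[OF part1] conjI[OF impI[OF part2]
        conjI[OF impI[OF part3] conjI[OF impI[OF part4] impI[OF part5]]]]]])
qed


end
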